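(* Let $X$ be a quasi-separated binoid scheme of finite type with a finite affine open covering $\{\mathrm{Spec}(M_i)\}_{i\in\{1,\dots,k\}}$, and let $U_i=\mathbb{R}\mathrm{Spec}(M_i)$ be the corresponding open cover of $\mathbb{R}X$, with $U_{i_0\cdots i_p}=U_{i_0}\cap\cdots\cap U_{i_p}$ and nerve $\mathcal N$. Then $$H_*(\mathbb{R}X)\cong H_*(\mathcal N,H_0),$$ i.e. the singular homology of $\mathbb{R}X$ with integer coefficients is isomorphic to the homology of the complex $$\bigoplus_{i}H_0(U_i)\longleftarrow \cdots \longleftarrow \bigoplus_{i_0<\cdots< i_p}H_0(U_{i_0\cdots i_p})\longleftarrow\cdots,$$ where the sums run over all $i_0<\cdots<i_p$ with $U_{i_0\cdots i_p}\neq\emptyset$.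
   Context: A binoid is a commutative monoid with an absorbing element $0$; homomorphisms preserve products, $1$ and $0$; all binoids are finitely generated. An ideal is a subset $I\ni0$ with $IM\subseteq I$; an ideal $\mathfrak p\ne M$ is prime if $xy\in\mathfrak p$ implies $x\in\mathfrak p$ or $y\in\mathfrak p$. $\mathrm{Spec}(M)$ is the set of prime ideals with the topology with basis $D(f)=\{\mathfrak p: f\notin\mathfrak p\}$ and structure sheaf $D(f)\mapsto M_f$ (localisation). A binoid scheme is a space with a sheaf of binoids that is locally of this form; it is quasi-separated if the intersection of affine open subschemes is affine. $\mathbb{R}\mathrm{Spec}(M)=\mathrm{Hom}(M,(\mathbb{R},\cdot))$ (binoid homomorphisms) with the subspace topology from $\mathbb{R}^n$ given by evaluation on generators of $M$. $\mathbb{R}X$ is the space of $\mathbb{R}$-valued points of $X$, with the open cover by the $\mathbb{R}\mathrm{Spec}(M_i)$ glued along the real spectra of the intersections. The nerve $\mathcal N$ is the simplicial complex on $\{1,\dots,k\}$ whose $p$-simplices are the $\{i_0<\cdots<i_p\}$ with $U_{i_0\cdots i_p}\ne\emptyset$. $H_*(\mathcal N,H_q)$ is the homology of the complex with $p$-th term $\bigoplus_{(i_0<\cdots<i_p)}H_q(U_{i_0\cdots i_p})$ and differential $\sum_{l=0}^p(-1)^l\partial_l$, where $\partial_l$ is induced by the inclusion $U_{i_0\cdots i_p}\subseteq U_{i_0\cdots\widehat{i_l}\cdots i_p}$. $H_*(-)$ means $H_*(-,\mathbb{Z})$. *)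

theory Defs
  imports "HOL-Homology.Homology" "HOL-Algebra.Product_Groups" "HOL-Algebra.FiniteProduct"
begin

section \<open>Binoids\<close>

record 'a pointed_monoid = "'a monoid" + absorb :: 'a

locale binoid = comm_monoid M for M :: "'a pointed_monoid" (structure) +
  assumes absorb_closed: "absorb M \<in> carrier M"
    and absorb_mult: "x \<in> carrier M \<Longrightarrow> absorb M \<otimes> x = absorb M"

inductive_set binoid_generate :: "'a pointed_monoid \<Rightarrow> 'a set \<Rightarrow> 'a set"
  for M and S where
    one: "\<one>\<^bsub>M\<^esub> \<in> binoid_generate M S"
  | absorb: "absorb M \<in> binoid_generate M S"
  | incl: "x \<in> S \<Longrightarrow> x \<in> binoid_generate M S"
  | mult: "x \<in> binoid_generate M S \<Longrightarrow> y \<in> binoid_generate M S \<Longrightarrow>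
      x \<otimes>\<^bsub>M\<^esub> y \<in> binoid_generate M S"

definition generates_binoid :: "'a pointed_monoid \<Rightarrow> 'a set \<Rightarrow> bool" where
  "generates_binoid M S \<longleftrightarrow> S \<subseteq> carrier M \<and> binoid_generate M S = carrier M"

definition fg_binoid :: "'a pointed_monoid \<Rightarrow> bool" where
  "fg_binoid M \<longleftrightarrow> binoid M \<and> (\<exists>S. finite S \<and> generates_binoid M S)"

definition binoid_hom :: "'a pointed_monoid \<Rightarrow> 'b pointed_monoid \<Rightarrow> ('a \<Rightarrow> 'b) set" where
  "binoid_hom M N = {f \<in> hom M N. f \<one>\<^bsub>M\<^esub> = \<one>\<^bsub>N\<^esub> \<and> f (absorb M) = absorb N}"

definition binoid_iso :: "'a pointed_monoid \<Rightarrow> 'b pointed_monoid \<Rightarrow> ('a \<Rightarrow> 'b) set" where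
  "binoid_iso M N = {f \<in> binoid_hom M N. bij_betw f (carrier M) (carrier N)}"

definition binoid_ideal :: "'a pointed_monoid \<Rightarrow> 'a set \<Rightarrow> bool" where
  "binoid_ideal M I \<longleftrightarrow> I \<subseteq> carrier M \<and> absorb M \<in> I \<and>
     (\<forall>x\<in>I. \<forall>m\<in>carrier M. x \<otimes>\<^bsub>M\<^esub> m \<in> I)"

definition binoid_prime :: "'a pointed_monoid \<Rightarrow> 'a set \<Rightarrow> bool" where
  "binoid_prime M P \<longleftrightarrow> binoid_ideal M P \<and> P \<noteq> carrier M \<and>
     (\<forall>x\<in>carrier M. \<forall>y\<in>carrier M. x \<otimes>\<^bsub>M\<^esub> y \<in> P \<longrightarrow> x \<in> P \<or> y \<in> P)"


section \<open>Localisation at an element\<close>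

text \<open>The pair (a, i) stands for the fraction a / f^i, and elements of the localisation are
  equivalence classes of such pairs.\<close>

definition frac_rel :: "'a pointed_monoid \<Rightarrow> 'a \<Rightarrow> (('a \<times> nat) \<times> ('a \<times> nat)) set" where
  "frac_rel M f = {((a, i), (b, j)) | a i b j. a \<in> carrier M \<and> b \<in> carrier M \<and>
     (\<exists>l::nat. f [^]\<^bsub>M\<^esub> l \<otimes>\<^bsub>M\<^esub> (a \<otimes>\<^bsub>M\<^esub> f [^]\<^bsub>M\<^esub> j) = f [^]\<^bsub>M\<^esub> l \<otimes>\<^bsub>M\<^esub> (b \<otimes>\<^bsub>M\<^esub> f [^]\<^bsub>M\<^esub> i))}"

definition fraction :: "'a pointed_monoid \<Rightarrow> 'a \<Rightarrow> 'a \<Rightarrow> nat \<Rightarrow> ('a \<times> nat) set" where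
  "fraction M f a i = frac_rel M f `` {(a, i)}"

definition localization :: "'a pointed_monoid \<Rightarrow> 'a \<Rightarrow> ('a \<times> nat) set pointed_monoid" where
  "localization M f =
     \<lparr>carrier = (carrier M \<times> UNIV) // frac_rel M f,
      monoid.mult = (\<lambda>x y. \<Union>(a, i)\<in>x. \<Union>(b, j)\<in>y. fraction M f (a \<otimes>\<^bsub>M\<^esub> b) (i + j)),
      one = fraction M f \<one>\<^bsub>M\<^esub> 0,
      absorb = fraction M f (absorb M) 0\<rparr>"

text \<open>The canonical map from the localisation at f to the localisation at g, defined
  whenever f becomes invertible in the latter: a / f^i is sent to the fraction b / g^j
  with b f^i = a g^j in the localisation at g.\<close>

definition loc_map :: "'a pointed_monoid \<Rightarrow> 'a \<Rightarrow> 'a \<Rightarrow> ('a \<times> nat) set \<Rightarrow> ('a \<times> nat) set" where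
  "loc_map M f g x = {(b, j) | b j. b \<in> carrier M \<and>
     (\<exists>(a, i)\<in>x. fraction M g (b \<otimes>\<^bsub>M\<^esub> f [^]\<^bsub>M\<^esub> i) j = fraction M g a 0)}"


section \<open>The spectrum\<close>

definition spec :: "'a pointed_monoid \<Rightarrow> 'a set set" where
  "spec M = {P. binoid_prime M P}"

definition basic_open :: "'a pointed_monoid \<Rightarrow> 'a \<Rightarrow> 'a set set" where
  "basic_open M f = {P \<in> spec M. f \<notin> P}"

definition spec_topology :: "'a pointed_monoid \<Rightarrow> 'a set topology" where
  "spec_topology M = topology_generated_by (basic_open M ` carrier M)"


section \<open>Binoid schemes\<close>

record ('x, 's) binoided_space =
  space :: "'x topology"
  sections :: "'x set \<Rightarrow> 's pointed_monoid"
  restr :: "'x set \<Rightarrow> 'x set \<Rightarrow> 's \<Rightarrow> 's"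

definition binoid_presheaf :: "('x, 's) binoided_space \<Rightarrow> bool" where
  "binoid_presheaf X \<longleftrightarrow>
     (\<forall>U. openin (space X) U \<longrightarrow> binoid (sections X U)) \<and>
     (\<forall>U V. openin (space X) U \<and> openin (space X) V \<and> V \<subseteq> U \<longrightarrow>
        restr X U V \<in> binoid_hom (sections X U) (sections X V)) \<and>
     (\<forall>U. openin (space X) U \<longrightarrow> (\<forall>s\<in>carrier (sections X U). restr X U U s = s)) \<and>
     (\<forall>U V W. openin (space X) U \<and> openin (space X) V \<and> openin (space X) W \<and>
        W \<subseteq> V \<and> V \<subseteq> U \<longrightarrow>
        (\<forall>s\<in>carrier (sections X U). restr X V W (restr X U V s) = restr X U W s))"

definition binoid_sheaf :: "('x, 's) binoided_space \<Rightarrow> bool" where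
  "binoid_sheaf X \<longleftrightarrow> binoid_presheaf X \<and>
     (\<forall>\<C> s. (\<forall>U\<in>\<C>. openin (space X) U \<and> s U \<in> carrier (sections X U)) \<and>
        (\<forall>U\<in>\<C>. \<forall>V\<in>\<C>. restr X U (U \<inter> V) (s U) = restr X V (U \<inter> V) (s V)) \<longrightarrow>
        (\<exists>!t. t \<in> carrier (sections X (\<Union>\<C>)) \<and> (\<forall>U\<in>\<C>. restr X (\<Union>\<C>) U t = s U)))"

text \<open>An isomorphism of the open subspace on V with Spec(M). The structure sheaf of Spec(M)
  is given by its values on the basis of the sets D(f), so an isomorphism of sheaves
  amounts to isomorphisms on these sets that commute with the restriction maps.\<close>

definition affine_chart ::
  "('x, 's) binoided_space \<Rightarrow> 'x set \<Rightarrow> 'm pointed_monoid \<Rightarrow>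
     ('x \<Rightarrow> 'm set) \<Rightarrow> ('m \<Rightarrow> ('m \<times> nat) set \<Rightarrow> 's) \<Rightarrow> bool" where
  "affine_chart X V M h \<gamma> \<longleftrightarrow>
     openin (space X) V \<and> fg_binoid M \<and>
     homeomorphic_map (subtopology (space X) V) (spec_topology M) h \<and>
     (\<forall>f\<in>carrier M. \<gamma> f \<in> binoid_iso (localization M f)
        (sections X {x \<in> V. h x \<in> basic_open M f})) \<and>
     (\<forall>f\<in>carrier M. \<forall>g\<in>carrier M. basic_open M g \<subseteq> basic_open M f \<longrightarrow>
        (\<forall>s\<in>carrier (localization M f).
           restr X {x \<in> V. h x \<in> basic_open M f} {x \<in> V. h x \<in> basic_open M g} (\<gamma> f s)
             = \<gamma> g (loc_map M f g s)))"

definition is_open_spec :: "('x, 's) binoided_space \<Rightarrow> 'x set \<Rightarrow> 'm pointed_monoid \<Rightarrow> bool" where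
  "is_open_spec X V M \<longleftrightarrow> (\<exists>h \<gamma>. affine_chart X V M h \<gamma>)"

text \<open>It is no restriction that M lives on the type of sections: in a chart, M is
  isomorphic to the binoid of sections over V.\<close>

definition affine_open :: "('x, 's) binoided_space \<Rightarrow> 'x set \<Rightarrow> bool" where
  "affine_open X V \<longleftrightarrow> (\<exists>M :: 's pointed_monoid. is_open_spec X V M)"

definition binoid_scheme :: "('x, 's) binoided_space \<Rightarrow> bool" where
  "binoid_scheme X \<longleftrightarrow> binoid_sheaf X \<and>
     (\<forall>x\<in>topspace (space X). \<exists>V. x \<in> V \<and> affine_open X V)"

definition quasi_separated :: "('x, 's) binoided_space \<Rightarrow> bool" where
  "quasi_separated X \<longleftrightarrow> (\<forall>V W. affine_open X V \<and> affine_open X W \<longrightarrow> affine_open X (V \<inter> W))"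

text \<open>Finite generation of the coordinate binoids is already part of \<^const>\<open>affine_chart\<close>.\<close>

definition finite_type :: "('x, 's) binoided_space \<Rightarrow> bool" where
  "finite_type X \<longleftrightarrow>
     (\<exists>\<V>. finite \<V> \<and> (\<forall>V\<in>\<V>. affine_open X V) \<and> \<Union>\<V> = topspace (space X))"


section \<open>Real points\<close>

definition real_binoid :: "real pointed_monoid" where
  "real_binoid = \<lparr>carrier = UNIV, monoid.mult = (*), one = 1, absorb = 0\<rparr>"

definition real_spec :: "'m pointed_monoid \<Rightarrow> ('m \<Rightarrow> real) set" where
  "real_spec M = binoid_hom M real_binoid \<inter> extensional (carrier M)"

definition real_spec_topology :: "'m pointed_monoid \<Rightarrow> 'm set \<Rightarrow> ('m \<Rightarrow> real) topology" where
  "real_spec_topology M S =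
     pullback_topology (real_spec M) (\<lambda>\<psi>. restrict \<psi> S) (product_topology (\<lambda>_. euclideanreal) S)"

text \<open>The spectrum of the binoid of real numbers is a point, so a morphism from it to X
  consists of a point x of X and a local homomorphism from the stalk at x to the real numbers.
  The latter is given here by its components on the sections over the open neighbourhoods of x;
  locality says that a germ with nonzero value is invertible.\<close>

definition real_points :: "('x, 's) binoided_space \<Rightarrow> ('x \<times> ('x set \<Rightarrow> 's \<Rightarrow> real)) set" where
  "real_points X = {(x, \<phi>) | x \<phi>.
     x \<in> topspace (space X) \<and> \<phi> \<in> extensional {U. openin (space X) U \<and> x \<in> U} \<and>
     (\<forall>U. openin (space X) U \<and> x \<in> U \<longrightarrow>
        \<phi> U \<in> real_spec (sections X U) \<and>
        (\<forall>V. openin (space X) V \<and> x \<in> V \<and> V \<subseteq> U \<longrightarrow>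
           (\<forall>s\<in>carrier (sections X U). \<phi> V (restr X U V s) = \<phi> U s)) \<and>
        (\<forall>s\<in>carrier (sections X U). \<phi> U s \<noteq> 0 \<longrightarrow>
           (\<exists>V. openin (space X) V \<and> x \<in> V \<and> V \<subseteq> U \<and> restr X U V s \<in> Units (sections X V))))}"

definition real_points_on ::
  "('x, 's) binoided_space \<Rightarrow> 'x set \<Rightarrow> ('x \<times> ('x set \<Rightarrow> 's \<Rightarrow> real)) set" where
  "real_points_on X V = {P \<in> real_points X. fst P \<in> V}"

text \<open>For a chart on V, this map identifies the real points on V with \<^term>\<open>real_spec M\<close>.\<close>

definition real_coord ::
  "'x set \<Rightarrow> 'm pointed_monoid \<Rightarrow> ('m \<Rightarrow> ('m \<times> nat) set \<Rightarrow> 's) \<Rightarrow>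
     'x \<times> ('x set \<Rightarrow> 's \<Rightarrow> real) \<Rightarrow> 'm \<Rightarrow> real" where
  "real_coord V M \<gamma> P = (\<lambda>m\<in>carrier M. snd P V (\<gamma> \<one>\<^bsub>M\<^esub> (fraction M \<one>\<^bsub>M\<^esub> m 0)))"

text \<open>The topology glued from the real spectra of all affine charts. Since overlaps are open
  in both charts, the open subsets of the charts form a basis of the glued topology.\<close>

definition real_space ::
  "('x, 's) binoided_space \<Rightarrow> ('x \<times> ('x set \<Rightarrow> 's \<Rightarrow> real)) topology" where
  "real_space X = topology_generated_by
     {{P \<in> real_points_on X V. real_coord V M \<gamma> P \<in> T} | V (M :: 's pointed_monoid) h \<gamma> S T.
        affine_chart X V M h \<gamma> \<and> finite S \<and> generates_binoid M S \<and>
        openin (real_spec_topology M S) T}"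


section \<open>Homology of the nerve with coefficients in the homology of the intersections\<close>

definition nerve_simplices :: "(nat \<Rightarrow> 'a set) \<Rightarrow> nat \<Rightarrow> nat \<Rightarrow> nat set set" where
  "nerve_simplices U k p =
     {\<sigma>. \<sigma> \<subseteq> {1..k} \<and> card \<sigma> = Suc p \<and> (\<Inter>i\<in>\<sigma>. U i) \<noteq> {}}"

definition nerve_face :: "nat \<Rightarrow> nat set \<Rightarrow> nat set" where
  "nerve_face l \<sigma> = \<sigma> - {sorted_list_of_set \<sigma> ! l}"

abbreviation cover_homology ::
  "'a topology \<Rightarrow> (nat \<Rightarrow> 'a set) \<Rightarrow> int \<Rightarrow> nat set \<Rightarrow> 'a chain set monoid" where
  "cover_homology T U q \<sigma> \<equiv> homology_group q (subtopology T (\<Inter>i\<in>\<sigma>. U i))"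

definition nerve_chain ::
  "'a topology \<Rightarrow> (nat \<Rightarrow> 'a set) \<Rightarrow> nat \<Rightarrow> int \<Rightarrow> nat \<Rightarrow> (nat set \<Rightarrow> 'a chain set) monoid" where
  "nerve_chain T U k q p = sum_group (nerve_simplices U k p) (cover_homology T U q)"

definition nerve_partial ::
  "'a topology \<Rightarrow> (nat \<Rightarrow> 'a set) \<Rightarrow> nat \<Rightarrow> int \<Rightarrow> nat \<Rightarrow> nat \<Rightarrow>
     (nat set \<Rightarrow> 'a chain set) \<Rightarrow> (nat set \<Rightarrow> 'a chain set)" where
  "nerve_partial T U k q p l c =
     (\<lambda>\<tau>\<in>nerve_simplices U k p.
        finprod (cover_homology T U q \<tau>)
          (\<lambda>\<sigma>. hom_induced q (subtopology T (\<Inter>i\<in>\<sigma>. U i)) {}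
                 (subtopology T (\<Inter>i\<in>\<tau>. U i)) {} id (c \<sigma>))
          {\<sigma> \<in> nerve_simplices U k (Suc p). nerve_face l \<sigma> = \<tau>})"

text \<open>The differential from degree p + 1 to degree p. Groups are written multiplicatively, so
  this is the alternating sum of the maps \<^const>\<open>nerve_partial\<close>.\<close>

definition nerve_diff ::
  "'a topology \<Rightarrow> (nat \<Rightarrow> 'a set) \<Rightarrow> nat \<Rightarrow> int \<Rightarrow> nat \<Rightarrow>
     (nat set \<Rightarrow> 'a chain set) \<Rightarrow> (nat set \<Rightarrow> 'a chain set)" where
  "nerve_diff T U k q p c =
     finprod (nerve_chain T U k q p)
       (\<lambda>l. nerve_partial T U k q p l c [^]\<^bsub>nerve_chain T U k q p\<^esub> ((-1) ^ l :: int))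
       {0..Suc p}"

definition nerve_cycles ::
  "'a topology \<Rightarrow> (nat \<Rightarrow> 'a set) \<Rightarrow> nat \<Rightarrow> int \<Rightarrow> nat \<Rightarrow> (nat set \<Rightarrow> 'a chain set) set" where
  "nerve_cycles T U k q p =
     (case p of
        0 \<Rightarrow> carrier (nerve_chain T U k q 0)
      | Suc r \<Rightarrow> kernel (nerve_chain T U k q (Suc r)) (nerve_chain T U k q r)
                  (nerve_diff T U k q r))"

definition nerve_homology ::
  "'a topology \<Rightarrow> (nat \<Rightarrow> 'a set) \<Rightarrow> nat \<Rightarrow> int \<Rightarrow> nat \<Rightarrow>
     (nat set \<Rightarrow> 'a chain set) set monoid" where
  "nerve_homology T U k q p =
     subgroup_generated (nerve_chain T U k q p) (nerve_cycles T U k q p) Mod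
       (nerve_diff T U k q p ` carrier (nerve_chain T U k q (Suc p)))"

end

theory Submission
  imports Defs "HOL-Library.Function_Algebras"
begin

text \<open>In coordinates given by generators, the real points of an affine binoid scheme form a closed
  set Y of real vectors that is stable under coordinatewise products and powers of absolute values.
  Such a set is homotopy equivalent to a finite set: by induction, remove the stratum of the points
  with a maximal support F. In logarithmic coordinates it is a union of copies of one vector space.
  It is either open and closed in Y, and then retracts onto sign vectors, or it can be pushed into
  the rest of Y along one-parameter subgroups, with exponents damped so that the rest stays fixed.

  By quasi-separatedness all intersections of the cover are affine, so their homology vanishes in
  positive degrees. Consider the double complex of singular chains on the intersections. In the
  Cech direction it is exact and resolves the small singular chains, so its total homology is that
  of the whole space; in the singular direction it is exact in positive degrees and leaves the nerve
  complex with coefficients in the zeroth homology.\<close>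

section \<open>Double complexes\<close>

text \<open>No map between the two homologies is constructed. Both edge maps start at the group of
  total cycles, both are onto, and both have the total boundaries as kernel. One extension argument,
  applied to the double complex and to its transpose, is behind all four facts. In the affine case
  the obstacle is continuity at the boundary of the top stratum: one fixed one-parameter subgroup
  would move boundary points of the wrong support, and different boundary points call for different
  subgroups. So all of them act at once, each slowed down where it must not act. They exist because
  the logarithms of points approaching a limit stay bounded on the support of the limit and tend to
  minus infinity off it. On the scheme side, finite generation gives every prime a least open
  neighbourhood D(f). A germ is then a section over D(f), that is a fraction a / f^i, so no stalks
  are formed, and the value of a real point on any section is a quotient of coordinates.\<close>

text \<open>All entries are subsets of one ambient group, so that the same locale can be
  instantiated with the two directions exchanged. Exactness is asked for in positive first index
  only; what survives is the cokernel of \<open>dh 0 q\<close> along the edge.\<close>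

locale double_complex =
  fixes C :: "nat \<Rightarrow> nat \<Rightarrow> 'c::ab_group_add set"
    and dh dv :: "nat \<Rightarrow> nat \<Rightarrow> 'c \<Rightarrow> 'c"
  assumes zero_mem: "0 \<in> C p q"
    and diff_mem: "x \<in> C p q \<Longrightarrow> y \<in> C p q \<Longrightarrow> x - y \<in> C p q"
    and dv_mem: "x \<in> C p (Suc q) \<Longrightarrow> dv p q x \<in> C p q"
    and dh_diff: "dh p q (x - y) = dh p q x - dh p q y"
    and dv_diff: "dv p q (x - y) = dv p q x - dv p q y"
    and dv_dv: "x \<in> C p (Suc (Suc q)) \<Longrightarrow> dv p q (dv p (Suc q) x) = 0"
    and anticomm: "x \<in> C (Suc p) (Suc q) \<Longrightarrow> dh p q (dv (Suc p) q x) = - dv p q (dh p (Suc q) x)"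
    and row_exact: "x \<in> C (Suc p) q \<Longrightarrow> dh p q x = 0 \<Longrightarrow> \<exists>y\<in>C (Suc (Suc p)) q. dh (Suc p) q y = x"
begin

text \<open>An element of total degree n is the sequence of its components, the p-th lying in
  C p (n - p). No signs are needed since the differentials anticommute.\<close>

definition tot :: "nat \<Rightarrow> (nat \<Rightarrow> 'c) set" where
  "tot n = {x. (\<forall>p q. p + q = n \<longrightarrow> x p \<in> C p q) \<and> (\<forall>p>n. x p = 0)}"

definition tot_cycles :: "nat \<Rightarrow> (nat \<Rightarrow> 'c) set" where
  "tot_cycles n = {x \<in> tot n. \<forall>p q. Suc (p + q) = n \<longrightarrow> dv p q (x p) + dh p q (x (Suc p)) = 0}"

definition tot_boundaries :: "nat \<Rightarrow> (nat \<Rightarrow> 'c) set" where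
  "tot_boundaries n = {x \<in> tot n. \<exists>y\<in>tot (Suc n).
     \<forall>p q. p + q = n \<longrightarrow> x p = dv p q (y p) + dh p q (y (Suc p))}"

lemma uminus_mem: "x \<in> C p q \<Longrightarrow> - x \<in> C p q"
  using diff_mem[OF zero_mem, of x] by simp

lemma add_mem: "x \<in> C p q \<Longrightarrow> y \<in> C p q \<Longrightarrow> x + y \<in> C p q"
  using diff_mem[of x p q "- y"] uminus_mem[of y] by simp

lemma dh_zero [simp]: "dh p q 0 = 0" and dv_zero [simp]: "dv p q 0 = 0"
  using dh_diff[of p q 0 0] dv_diff[of p q 0 0] by simp_all

lemma dh_uminus: "dh p q (- x) = - dh p q x" and dv_uminus: "dv p q (- x) = - dv p q x"
  using dh_diff[of p q 0 x] dv_diff[of p q 0 x] by simp_all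

lemma dh_add: "dh p q (x + y) = dh p q x + dh p q y"
  using dh_diff[of p q x "- y"] by (simp add: dh_uminus)

text \<open>A total cycle bounds as soon as its component at index 0 does: the bounding element is
  built one component at a time. The error at index k + 1 is a \<open>dh\<close>-cycle, and row
  exactness supplies the component at k + 2 that corrects it. The two starting components are kept
  because later uses prescribe them.\<close>

lemma extend_bounding_edge:
  assumes z: "z \<in> tot_cycles n"
    and y: "y0 \<in> C 0 (Suc n)" "y1 \<in> C (Suc 0) n" "z 0 = dv 0 n y0 + dh 0 n y1"
  obtains y where "y \<in> tot (Suc n)" "y 0 = y0" "y 1 = y1"
    "\<And>p q. p + q = n \<Longrightarrow> z p = dv p q (y p) + dh p q (y (Suc p))"
proof -
  have "\<exists>y. y 0 = y0 \<and> y 1 = y1 \<and> (\<forall>p q. p \<le> Suc k \<and> p + q = Suc n \<longrightarrow> y p \<in> C p q)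
      \<and> (\<forall>p q. p \<le> k \<and> p + q = n \<longrightarrow> z p = dv p q (y p) + dh p q (y (Suc p)))"
    if "k \<le> n" for k
    using that
  proof (induction k)
    case 0
    show ?case
      by (rule exI[of _ "\<lambda>p. if p = 0 then y0 else y1"]) (use y in \<open>auto simp: le_Suc_eq\<close>)
  next
    case (Suc k)
    obtain y where yy: "y 0 = y0" "y 1 = y1"
        "\<And>p q. p \<le> Suc k \<Longrightarrow> p + q = Suc n \<Longrightarrow> y p \<in> C p q"
        "\<And>p q. p \<le> k \<Longrightarrow> p + q = n \<Longrightarrow> z p = dv p q (y p) + dh p q (y (Suc p))"
      using Suc.IH[OF Suc_leD[OF Suc.prems]] by blast
    obtain q where q: "Suc (k + q) = n"
      using Suc.prems by (metis add_Suc le_Suc_ex)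
    let ?t = "z (Suc k) - dv (Suc k) q (y (Suc k))"
    have m: "y (Suc k) \<in> C (Suc k) (Suc q)" "y k \<in> C k (Suc (Suc q))"
      using q by (auto intro!: yy(3))
    have zm: "z (Suc k) \<in> C (Suc k) q" "z k \<in> C k (Suc q)"
      and zc: "dv k q (z k) + dh k q (z (Suc k)) = 0"
      using z q unfolding tot_cycles_def tot_def by auto
    have zk: "z k = dv k (Suc q) (y k) + dh k (Suc q) (y (Suc k))"
      using q by (intro yy(4)) auto
    \<comment> \<open>The cycle condition replaces \<open>dh\<close> of z (k + 1) by
      \<open>- dv\<close> of z k, and anticommutation does the same for y (k + 1). What remains is
      \<open>dv\<close> applied to \<open>dv\<close> of y k.\<close>
    have "dh k q ?t = - dv k q (z k - dh k (Suc q) (y (Suc k)))"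
      using zc m by (simp add: dh_diff dv_diff anticomm algebra_simps eq_neg_iff_add_eq_0)
    also have "\<dots> = 0"
      using dv_dv[OF m(2)] by (simp add: zk)
    finally have "dh k q ?t = 0" .
    moreover have "?t \<in> C (Suc k) q"
      using zm m by (intro diff_mem dv_mem)
    ultimately obtain w where w: "w \<in> C (Suc (Suc k)) q" "dh (Suc k) q w = ?t"
      using row_exact by blast
    show ?case
    proof (intro exI[of _ "y(Suc (Suc k) := w)"] conjI allI impI)
      fix p q' assume p: "p \<le> Suc (Suc k) \<and> p + q' = Suc n"
      then show "(y(Suc (Suc k) := w)) p \<in> C p q'"
        using w q yy(3)[of p q'] by (cases "p = Suc (Suc k)") auto
    next
      fix p q' assume p: "p \<le> Suc k \<and> p + q' = n"
      then show "z p = dv p q' ((y(Suc (Suc k) := w)) p) + dh p q' ((y(Suc (Suc k) := w)) (Suc p))"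
        using w q yy(4)[of p q'] by (cases "p = Suc k") auto
    qed (use yy in auto)
  qed
  from this[of n] obtain y where yy: "y 0 = y0" "y 1 = y1"
      "\<And>p q. p \<le> Suc n \<Longrightarrow> p + q = Suc n \<Longrightarrow> y p \<in> C p q"
      "\<And>p q. p \<le> n \<Longrightarrow> p + q = n \<Longrightarrow> z p = dv p q (y p) + dh p q (y (Suc p))"
    by auto
  show thesis
    by (rule that[of "\<lambda>p. if p \<le> Suc n then y p else 0"]) (use yy in \<open>auto simp: tot_def\<close>)
qed

lemma tot_boundaryI:
  assumes "z \<in> tot_cycles n" "y0 \<in> C 0 (Suc n)" "y1 \<in> C (Suc 0) n" "z 0 = dv 0 n y0 + dh 0 n y1"
  shows "z \<in> tot_boundaries n"
proof -
  obtain y where "y \<in> tot (Suc n)" "\<And>p q. p + q = n \<Longrightarrow> z p = dv p q (y p) + dh p q (y (Suc p))"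
    using extend_bounding_edge[OF assms] by blast
  then show ?thesis
    using assms(1) unfolding tot_boundaries_def tot_cycles_def by blast
qed

text \<open>An element that bounds the zero cycle of degree n - 1 is exactly a total cycle of degree
  n, so this is the previous extension applied to zero.\<close>

lemma tot_cycle_extending:
  assumes a: "a \<in> C 0 n" and ex: "\<And>m. n = Suc m \<Longrightarrow> \<exists>y\<in>C (Suc 0) m. dh 0 m y = dv 0 m a"
  obtains x where "x \<in> tot_cycles n" "x 0 = a"
proof (cases n)
  case 0
  show ?thesis
    by (rule that[of "\<lambda>p. if p = 0 then a else 0"]) (use a 0 in \<open>auto simp: tot_cycles_def tot_def\<close>)
next
  case (Suc m)
  then obtain y1 where y1: "y1 \<in> C (Suc 0) m" "dh 0 m y1 = dv 0 m a"
    using ex by blast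
  have "(\<lambda>_. 0) \<in> tot_cycles m"
    by (auto simp: tot_cycles_def tot_def zero_mem)
  then obtain y where "y \<in> tot (Suc m)" "y 0 = a"
    "\<And>p q. p + q = m \<Longrightarrow> 0 = dv p q (y p) + dh p q (y (Suc p))"
    \<comment> \<open>The edge equation is now 0 = \<open>dv\<close> a + \<open>dh\<close> y, hence
      the minus sign on \<open>y1\<close>.\<close>
    by (rule extend_bounding_edge[of _ m a "- y1"]) (use a y1 Suc in \<open>auto simp: dh_uminus uminus_mem\<close>)
  then show ?thesis
    using Suc by (intro that[of y]) (auto simp: tot_cycles_def)
qed

end

section \<open>Homomorphisms from additive groups\<close>

text \<open>This is how the two homologies are compared: each is the quotient of the total cycles by
  the same subgroup.\<close>

lemma iso_of_common_kernel:
  assumes "group G" "group A" "group B" "f \<in> hom G A" "g \<in> hom G B"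
    and "f ` carrier G = carrier A" "g ` carrier G = carrier B"
    and "kernel G A f = kernel G B g"
  shows "A \<cong> B"
proof -
  interpret f: group_hom G A f using assms by (simp add: group_hom_def group_hom_axioms_def)
  interpret g: group_hom G B g using assms by (simp add: group_hom_def group_hom_axioms_def)
  have "G Mod kernel G A f \<cong> A" "G Mod kernel G A f \<cong> B"
    using f.FactGroup_iso g.FactGroup_iso assms by auto
  moreover have "group (G Mod kernel G A f)"
    using f.normal_kernel normal.factorgroup_is_group by blast
  ultimately show ?thesis
    using group.iso_sym iso_trans by blast
qed

text \<open>Chains are added by type class operations, while homology groups are multiplicative
  records. The locale bridges the two notations for maps defined on an additive subset A.\<close>

locale additive_hom = comm_group G for G (structure) +
  fixes A :: "'c::ab_group_add set" and f :: "'c \<Rightarrow> 'a"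
  assumes zero_mem: "0 \<in> A" and add_mem: "x \<in> A \<Longrightarrow> y \<in> A \<Longrightarrow> x + y \<in> A"
    and uminus_mem: "x \<in> A \<Longrightarrow> - x \<in> A"
    and closed: "x \<in> A \<Longrightarrow> f x \<in> carrier G"
    and add: "x \<in> A \<Longrightarrow> y \<in> A \<Longrightarrow> f (x + y) = f x \<otimes> f y"
begin

lemma zero: "f 0 = \<one>"
  using add[OF zero_mem zero_mem] closed[OF zero_mem] by (simp add: l_cancel_one)

lemma uminus: "x \<in> A \<Longrightarrow> f (- x) = inv f x"
  using add[of "- x" x] using closed[of x] closed[OF uminus_mem[of x]] by (simp add: inv_equality uminus_mem zero)

lemma sum_mem: "finite I \<Longrightarrow> (\<And>i. i \<in> I \<Longrightarrow> g i \<in> A) \<Longrightarrow> sum g I \<in> A"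
  by (induction I rule: finite_induct) (auto intro: zero_mem add_mem)

lemma finprod_eq_sum:
  "finite I \<Longrightarrow> (\<And>i. i \<in> I \<Longrightarrow> g i \<in> A) \<Longrightarrow> (\<Otimes>i\<in>I. f (g i)) = f (sum g I)"
  by (induction I rule: finite_induct) (auto simp: zero add closed sum_mem finprod_insert)

lemma pow_sign:
  "x \<in> A \<Longrightarrow> f x [^] ((- 1) ^ l :: int) = f (if even l then x else - x)"
  using uminus[of x] closed[of x] int_pow_neg[of "f x" 1]
  by (cases "even l") (auto simp: int_pow_1)

end

section \<open>The Cech complex of singular chains\<close>

text \<open>This is multiplication by (-1)^m in an abelian group that need not have any ring
  structure.\<close>

definition alt :: "nat \<Rightarrow> 'c::ab_group_add \<Rightarrow> 'c" where
  "alt m x = (if even m then x else - x)"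

lemma alt_0 [simp]: "alt 0 x = x" and alt_Suc [simp]: "alt (Suc m) x = - alt m x"
  and alt_zero [simp]: "alt m 0 = 0" and alt_diff: "alt m (x - y) = alt m x - alt m y"
  and alt_uminus: "alt m (- x) = - alt m x" and alt_alt: "alt m (alt n x) = alt n (alt m x)"
  and alt_cancel [simp]: "alt m (alt m x) = x"
  by (auto simp: alt_def)

lemma alt_sum: "alt m (\<Sum>i\<in>I. f i) = (\<Sum>i\<in>I. alt m (f i))"
  by (simp add: alt_def sum_negf)

text \<open>Exchanging the two summations would only show that twice the sum is 0, which is too weak
  in an arbitrary abelian group. Induction on the index set cancels the new row against the new
  column instead.\<close>

lemma sum_antisymmetric:
  fixes F :: "'i \<Rightarrow> 'i \<Rightarrow> 'c::ab_group_add"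
  assumes "finite A" "\<And>i j. i \<in> A \<Longrightarrow> j \<in> A \<Longrightarrow> i \<noteq> j \<Longrightarrow> F j i = - F i j"
  shows "(\<Sum>i\<in>A. \<Sum>j\<in>A - {i}. F i j) = 0"
  using assms
proof (induction A rule: finite_induct)
  case (insert a A)
  have "(\<Sum>j\<in>insert a A - {i}. F i j) = - F a i + (\<Sum>j\<in>A - {i}. F i j)" if "i \<in> A" for i
  proof -
    have "insert a A - {i} = insert a (A - {i})" using that insert.hyps by auto
    moreover have "F i a = - F a i" by (rule insert.prems) (use that insert.hyps in auto)
    ultimately show ?thesis using that insert.hyps by simp
  qed
  moreover have "insert a A - {a} = A" using insert.hyps by auto
  moreover have "(\<Sum>i\<in>A. \<Sum>j\<in>A - {i}. F i j) = 0"
    using insert.prems by (intro insert.IH) blast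
  ultimately show ?case
    using insert.hyps by (simp add: sum.distrib sum_negf sum_subtractf)
qed auto

definition chain_part :: "('s \<Rightarrow> bool) \<Rightarrow> ('s \<Rightarrow>\<^sub>0 int) \<Rightarrow> ('s \<Rightarrow>\<^sub>0 int)" where
  "chain_part P c = frag_extend (\<lambda>s. if P s then frag_of s else 0) c"

lemma lookup_chain_part:
  "Poly_Mapping.lookup (chain_part P c) s = (if P s then Poly_Mapping.lookup c s else 0)"
proof -
  have "Poly_Mapping.keys c \<subseteq> UNIV" by simp
  then show ?thesis
  proof (induction c rule: frag_induction)
    case (one x)
    then show ?case by (auto simp: chain_part_def lookup_single)
  qed (auto simp: chain_part_def frag_extend_diff lookup_minus)
qed

lemma keys_chain_part: "Poly_Mapping.keys (chain_part P c) = {s \<in> Poly_Mapping.keys c. P s}"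
  by (auto simp: in_keys_iff lookup_chain_part split: if_splits)

lemma chain_part_0 [simp]: "chain_part P 0 = 0"
  by (simp add: chain_part_def)

lemma chain_part_alt: "chain_part P (alt m c) = alt m (chain_part P c)"
  by (simp add: chain_part_def frag_extend_minus alt_def)

lemma chain_part_sum: "finite I \<Longrightarrow> chain_part P (\<Sum>i\<in>I. f i) = (\<Sum>i\<in>I. chain_part P (f i))"
  by (simp add: chain_part_def frag_extend_sum o_def)

lemma chain_part_eq_0: "(\<And>s. s \<in> Poly_Mapping.keys c \<Longrightarrow> \<not> P s) \<Longrightarrow> chain_part P c = 0"
  unfolding chain_part_def by (rule frag_extend_eq_0) auto

lemma sum_chain_part:
  assumes "finite J" "\<And>s. s \<in> Poly_Mapping.keys c \<Longrightarrow> l s \<in> J"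
  shows "(\<Sum>j\<in>J. chain_part (\<lambda>s. l s = j) c) = c"
proof (rule poly_mapping_eqI)
  fix s
  have "Poly_Mapping.lookup (\<Sum>j\<in>J. chain_part (\<lambda>s. l s = j) c) s
      = (\<Sum>j\<in>J. if l s = j then Poly_Mapping.lookup c s else 0)"
    by (simp add: lookup_sum lookup_chain_part)
  also have "\<dots> = (if l s \<in> J then Poly_Mapping.lookup c s else 0)"
    using assms(1) by simp
  also have "\<dots> = Poly_Mapping.lookup c s"
    using assms(2) by (auto simp: in_keys_iff)
  finally show "Poly_Mapping.lookup (\<Sum>j\<in>J. chain_part (\<lambda>s. l s = j) c) s = Poly_Mapping.lookup c s" .
qed

lemma singular_chain_part: "singular_chain q Y c \<Longrightarrow> singular_chain q Y (chain_part P c)"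
  by (auto simp: singular_chain_def keys_chain_part)

lemma singular_chain_alt: "singular_chain q Y c \<Longrightarrow> singular_chain q Y (alt m c)"
  by (simp add: alt_def singular_chain_minus)

lemma chain_boundary_alt: "chain_boundary q (alt m c) = alt m (chain_boundary q c)"
  by (simp add: alt_def chain_boundary_minus)

text \<open>A chain is a function on index sets, so its differential at \<tau> collects the entries
  at all sets with one index more. The sign is the position of i in \<open>insert i \<tau>\<close>.
  At the empty set this is the augmentation: the plain sum over single indices.\<close>

definition cech_diff :: "nat \<Rightarrow> (nat set \<Rightarrow> 'c::ab_group_add) \<Rightarrow> nat set \<Rightarrow> 'c" where
  "cech_diff k c \<tau> = (\<Sum>i\<in>{1..k} - \<tau>. alt (card {j \<in> \<tau>. j < i}) (c (insert i \<tau>)))"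

lemma card_below_insert:
  fixes \<tau> :: "nat set"
  assumes "i \<notin> \<tau>"
  shows "card {l \<in> insert i \<tau>. l < j} = (if i < j then Suc (card {l \<in> \<tau>. l < j}) else card {l \<in> \<tau>. l < j})"
proof (cases "i < j")
  case True
  then have "{l \<in> insert i \<tau>. l < j} = insert i {l \<in> \<tau>. l < j}" by auto
  then show ?thesis using True assms by simp
next
  case False
  then have "{l \<in> insert i \<tau>. l < j} = {l \<in> \<tau>. l < j}" by auto
  then show ?thesis using False by simp
qed

text \<open>Inserting i and j in the two possible orders changes exactly one of the two position
  counts, and changes it by one, so the two contributions are opposite.\<close>

lemma cech_diff_cech_diff: "cech_diff k (cech_diff k c) = 0"
proof
  fix \<tau> :: "nat set"
  let ?A = "{1..k} - \<tau>"
  let ?F = "\<lambda>i j. alt (card {l \<in> \<tau>. l < i}) (alt (card {l \<in> insert i \<tau>. l < j}) (c (insert j (insert i \<tau>))))"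
  have "cech_diff k (cech_diff k c) \<tau> = (\<Sum>i\<in>?A. \<Sum>j\<in>?A - {i}. ?F i j)"
    unfolding cech_diff_def alt_sum by (intro sum.cong) auto
  also have "\<dots> = 0"
  proof (rule sum_antisymmetric)
    fix i j assume ij: "i \<in> ?A" "j \<in> ?A" "i \<noteq> j"
    then have ij': "i < j \<or> j < i" by auto
    have eq: "insert i (insert j \<tau>) = insert j (insert i \<tau>)" by auto
    have "i \<notin> \<tau>" "j \<notin> \<tau>" using ij by auto
    note cards = card_below_insert[OF this(1), of j] card_below_insert[OF this(2), of i]
    show "?F j i = - ?F i j"
      unfolding eq cards using ij' by (auto simp: alt_def)
  qed simp
  finally show "cech_diff k (cech_diff k c) \<tau> = 0 \<tau>" by simp
qed

lemma cech_diff_diff: "cech_diff k (c - d) = cech_diff k c - cech_diff k d"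
  by (auto simp: cech_diff_def alt_diff sum_subtractf)

section \<open>Cech chains of a finite family of sets and their contraction\<close>

locale finite_cover =
  fixes X :: "'a topology" and U :: "nat \<Rightarrow> 'a set" and k :: nat
begin

abbreviation XX :: "nat set \<Rightarrow> 'a topology" where
  "XX \<sigma> \<equiv> subtopology X (\<Inter>i\<in>\<sigma>. U i)"

text \<open>Extension by 0 off the p-simplices of the nerve keeps all degrees in one type and lets
  chains be compared as functions.\<close>

definition cech_chains :: "nat \<Rightarrow> nat \<Rightarrow> (nat set \<Rightarrow> 'a chain) set" where
  "cech_chains p q = {c. \<forall>\<sigma>. singular_chain q (XX \<sigma>) (c \<sigma>) \<and> (c \<sigma> \<noteq> 0 \<longrightarrow> \<sigma> \<in> nerve_simplices U k p)}"

text \<open>The factor (-1)^p turns the commuting Cech and singular differentials into anticommuting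
  ones.\<close>

definition cech_vdiff :: "nat \<Rightarrow> nat \<Rightarrow> (nat set \<Rightarrow> 'a chain) \<Rightarrow> nat set \<Rightarrow> 'a chain" where
  "cech_vdiff p q c \<sigma> = alt p (chain_boundary (Suc q) (c \<sigma>))"

definition least_index :: "nat \<Rightarrow> ((nat \<Rightarrow> real) \<Rightarrow> 'a) \<Rightarrow> nat" where
  "least_index q s = (LEAST i. i \<in> {1..k} \<and> s ` standard_simplex q \<subseteq> U i)"

text \<open>The simplices with least index i are coned off with apex i. The apex is taken least so that
  inserting it into a set of indices never produces a sign.\<close>

definition cech_homotopy :: "nat \<Rightarrow> (nat set \<Rightarrow> 'a chain) \<Rightarrow> nat set \<Rightarrow> 'a chain" where
  "cech_homotopy q c \<sigma> = chain_part (\<lambda>s. least_index q s = Min \<sigma>) (c (\<sigma> - {Min \<sigma>}))"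

lemma least_index:
  assumes "i \<in> {1..k}" "s ` standard_simplex q \<subseteq> U i"
  shows "least_index q s \<in> {1..k}" "s ` standard_simplex q \<subseteq> U (least_index q s)" "least_index q s \<le> i"
  using LeastI[of "\<lambda>i. i \<in> {1..k} \<and> s ` standard_simplex q \<subseteq> U i" i] assms
    Least_le[of "\<lambda>i. i \<in> {1..k} \<and> s ` standard_simplex q \<subseteq> U i" i]
  unfolding least_index_def by auto

lemma singular_chain_XX:
  "singular_chain q (XX \<sigma>) c \<longleftrightarrow>
     singular_chain q X c \<and> (\<forall>s\<in>Poly_Mapping.keys c. \<forall>i\<in>\<sigma>. s ` standard_simplex q \<subseteq> U i)"
  unfolding singular_chain_subtopology by blast

text \<open>Let m be the least element of \<tau>. For i > m the contributions of the two summands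
  cancel. For i < m only the first one contributes, namely the simplices of \<open>c \<tau>\<close>
  with least index i; the remaining term gives those with least index m. Every simplex of
  \<open>c \<tau>\<close> lies in U m, so its least index is at most m and these parts add up to
  \<open>c \<tau>\<close>.\<close>

lemma cech_homotopy_identity:
  assumes c: "\<And>\<sigma>. \<sigma> \<noteq> {} \<Longrightarrow> singular_chain q (XX \<sigma>) (c \<sigma>)"
    and \<tau>: "\<tau> \<subseteq> {1..k}" "\<tau> \<noteq> {}"
  shows "cech_diff k (cech_homotopy q c) \<tau> + cech_homotopy q (cech_diff k c) \<tau> = c \<tau>"
proof -
  define m where "m = Min \<tau>"
  let ?P = "\<lambda>i. chain_part (\<lambda>s. least_index q s = i)"
  have fin: "finite \<tau>" using \<tau> finite_subset by blast
  have m: "m \<in> \<tau>" "\<And>i. i \<in> \<tau> \<Longrightarrow> m \<le> i" using \<tau> fin by (auto simp: m_def)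
  have mk: "m \<in> {1..k}" using m \<tau> by auto
  let ?\<rho> = "\<tau> - {m}"
  let ?I = "{1..k} - \<tau>"
  define b where "b i = alt (card {j \<in> ?\<rho>. j < i}) (?P m (c (insert i ?\<rho>)))" for i
  have set_eq: "{1..k} - ?\<rho> = insert m ?I" using mk m by auto
  have low: "{j \<in> ?\<rho>. j < i} = {}" "{j \<in> \<tau>. j < i} = {}" if "i \<le> m" for i
    using that m(2) by fastforce+
  have "cech_homotopy q (cech_diff k c) \<tau> = (\<Sum>i\<in>insert m ?I. b i)"
    unfolding cech_homotopy_def cech_diff_def m_def[symmetric] set_eq
    by (subst chain_part_sum) (auto simp: chain_part_alt b_def)
  also have "\<dots> = ?P m (c \<tau>) + (\<Sum>i\<in>?I. b i)"
  proof -
    have "insert m ?\<rho> = \<tau>" using m(1) by auto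
    then have "b m = ?P m (c \<tau>)" unfolding b_def low(1)[OF order_refl] by simp
    then show ?thesis using m(1) by (subst sum.insert) auto
  qed
  finally have hd: "cech_homotopy q (cech_diff k c) \<tau> = ?P m (c \<tau>) + (\<Sum>i\<in>?I. b i)" .
  have termwise: "alt (card {j \<in> \<tau>. j < i}) (cech_homotopy q c (insert i \<tau>)) + b i
      = (if i < m then ?P i (c \<tau>) else 0)" if i: "i \<in> ?I" for i
  proof (cases "i < m")
    case True
    have "Min (insert i \<tau>) = i" using True m fin \<tau> by (intro Min_eqI) force+
    moreover have "insert i \<tau> - {i} = \<tau>" using i by auto
    moreover have "b i = 0"
    proof -
      \<comment> \<open>Simplices over a set that contains i lie in U i, so their least index is at
        most i and cannot be m.\<close>
      have "?P m (c (insert i ?\<rho>)) = 0"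
      proof (rule chain_part_eq_0)
        fix s assume "s \<in> Poly_Mapping.keys (c (insert i ?\<rho>))"
        then have "s ` standard_simplex q \<subseteq> U i"
          using c[of "insert i ?\<rho>"] unfolding singular_chain_XX by blast
        then show "least_index q s \<noteq> m" using least_index(3)[of i s q] i True by auto
      qed
      then show ?thesis by (simp add: b_def)
    qed
    ultimately show ?thesis using True
      unfolding low(2)[OF less_imp_le[OF True]] cech_homotopy_def by simp
  next
    case False
    then have im: "m < i" using i m by (metis DiffD2 linorder_neqE_nat)
    have "Min (insert i \<tau>) = m" using im m fin \<tau> by (intro Min_eqI) force+
    moreover have "insert i \<tau> - {m} = insert i ?\<rho>" using im by auto
    \<comment> \<open>The extra index below i is m itself, which makes the two signs
      opposite.\<close>
    moreover have "card {j \<in> \<tau>. j < i} = Suc (card {j \<in> ?\<rho>. j < i})"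
      using card_below_insert[of m ?\<rho> i] im m(1) by (simp add: insert_absorb)
    ultimately show ?thesis using False by (simp add: cech_homotopy_def b_def)
  qed
  have "cech_diff k (cech_homotopy q c) \<tau> + (\<Sum>i\<in>?I. b i)
      = (\<Sum>i\<in>?I. if i < m then ?P i (c \<tau>) else 0)"
    unfolding cech_diff_def sum.distrib[symmetric] using termwise by (intro sum.cong) auto
  \<comment> \<open>No index below m belongs to \<tau>, so all of them occur in the sum.\<close>
  also have "\<dots> = (\<Sum>i\<in>{1..<m}. ?P i (c \<tau>))"
  proof (rule sum.mono_neutral_cong_right)
    show "{1..<m} \<subseteq> ?I" using mk m(2) by force
  qed auto
  finally have "cech_diff k (cech_homotopy q c) \<tau> + cech_homotopy q (cech_diff k c) \<tau>
      = (\<Sum>i\<in>insert m {1..<m}. ?P i (c \<tau>))"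
    unfolding hd by (simp add: algebra_simps)
  also have "\<dots> = c \<tau>"
  proof (rule sum_chain_part)
    fix s assume "s \<in> Poly_Mapping.keys (c \<tau>)"
    then have "s ` standard_simplex q \<subseteq> U m"
      using c[OF \<tau>(2)] m by (auto simp: singular_chain_XX)
    then show "least_index q s \<in> insert m {1..<m}" using least_index[OF mk, of s q] by auto
  qed simp
  finally show ?thesis .
qed

text \<open>A nonzero chain contains a simplex, and the nonempty image of that simplex lies in every
  U i. Membership in the nerve is therefore automatic and only the cardinality has to be
  tracked.\<close>

lemma in_nerve_simplicesI:
  assumes "singular_chain q (XX \<sigma>) c" "c \<noteq> 0" "\<sigma> \<subseteq> {1..k}" "card \<sigma> = Suc p"
  shows "\<sigma> \<in> nerve_simplices U k p"
proof -
  obtain s where "s \<in> Poly_Mapping.keys c"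
    using assms(2) by (metis all_not_in_conv keys_eq_empty)
  then have "\<forall>i\<in>\<sigma>. s ` standard_simplex q \<subseteq> U i"
    using assms(1) by (auto simp: singular_chain_XX)
  then have "(\<Inter>i\<in>\<sigma>. U i) \<noteq> {}"
    using nonempty_standard_simplex[of q] by blast
  then show ?thesis using assms by (simp add: nerve_simplices_def)
qed

lemma cech_chainsD:
  assumes "c \<in> cech_chains p q"
  shows "singular_chain q (XX \<sigma>) (c \<sigma>)" "\<sigma> \<notin> nerve_simplices U k p \<Longrightarrow> c \<sigma> = 0"
  using assms by (auto simp: cech_chains_def)

lemma cech_diff_chain:
  assumes "\<And>\<sigma>. \<sigma> \<noteq> {} \<Longrightarrow> singular_chain q (XX \<sigma>) (c \<sigma>)"
  shows "singular_chain q (XX \<tau>) (cech_diff k c \<tau>)"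
  unfolding cech_diff_def
proof (intro singular_chain_sum singular_chain_alt)
  fix i
  show "singular_chain q (XX \<tau>) (c (insert i \<tau>))"
    using assms[of "insert i \<tau>"] unfolding singular_chain_XX by blast
qed

lemma cech_diff_mem:
  assumes "c \<in> cech_chains (Suc p) q"
  shows "cech_diff k c \<in> cech_chains p q"
proof -
  have ch: "singular_chain q (XX \<tau>) (cech_diff k c \<tau>)" for \<tau>
    using cech_chainsD[OF assms] by (intro cech_diff_chain)
  moreover have "\<tau> \<in> nerve_simplices U k p" if ne: "cech_diff k c \<tau> \<noteq> 0" for \<tau>
  proof -
    obtain i where i: "i \<in> {1..k} - \<tau>" "c (insert i \<tau>) \<noteq> 0"
      using ne unfolding cech_diff_def by (metis (no_types, lifting) alt_zero sum.neutral)
    then have "insert i \<tau> \<in> nerve_simplices U k (Suc p)"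
      using cech_chainsD[OF assms] by blast
    then have "insert i \<tau> \<subseteq> {1..k}" "card (insert i \<tau>) = Suc (Suc p)"
      by (auto simp: nerve_simplices_def)
    then have "\<tau> \<subseteq> {1..k}" "card \<tau> = Suc p"
      using i by (auto simp: finite_subset card_insert_if split: if_splits dest: card_ge_0_finite)
    then show ?thesis using in_nerve_simplicesI[OF ch ne] by simp
  qed
  ultimately show ?thesis by (simp add: cech_chains_def)
qed

text \<open>Here p is the cardinality of the index sets carrying c, so that p = 0 is included: a
  chain placed at the empty set is lifted to Cech degree 0. This needs its simplices to be small.
  For nonempty index sets smallness is automatic, and it makes the least index of a simplex
  meaningful.\<close>

lemma cech_homotopy_mem:
  assumes c: "\<And>\<sigma>. singular_chain q (XX \<sigma>) (c \<sigma>)" and supp: "\<And>\<sigma>. c \<sigma> \<noteq> 0 \<Longrightarrow> \<sigma> \<subseteq> {1..k} \<and> card \<sigma> = p"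
    and small: "\<And>s. s \<in> Poly_Mapping.keys (c {}) \<Longrightarrow> \<exists>i\<in>{1..k}. s ` standard_simplex q \<subseteq> U i"
  shows "(\<lambda>\<sigma>. if \<sigma> \<subseteq> {1..k} \<and> \<sigma> \<noteq> {} then cech_homotopy q c \<sigma> else 0) \<in> cech_chains p q" (is "?h \<in> _")
proof -
  have ch: "singular_chain q (XX \<sigma>) (cech_homotopy q c \<sigma>)" if \<sigma>: "\<sigma> \<subseteq> {1..k}" "\<sigma> \<noteq> {}" for \<sigma>
    unfolding singular_chain_XX
  proof (intro conjI ballI)
    show "singular_chain q X (cech_homotopy q c \<sigma>)"
      unfolding cech_homotopy_def using c singular_chain_XX by (intro singular_chain_part) blast
  next
    have fin: "finite \<sigma>" using \<sigma> finite_subset by blast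
    fix s i assume s: "s \<in> Poly_Mapping.keys (cech_homotopy q c \<sigma>)" and i: "i \<in> \<sigma>"
    then have s: "s \<in> Poly_Mapping.keys (c (\<sigma> - {Min \<sigma>}))" "least_index q s = Min \<sigma>"
      by (auto simp: cech_homotopy_def keys_chain_part)
    show "s ` standard_simplex q \<subseteq> U i"
    proof (cases "i = Min \<sigma>")
      case False
      then show ?thesis using s c[of "\<sigma> - {Min \<sigma>}"] i by (auto simp: singular_chain_XX)
    next
      case True
      have "\<exists>i\<in>{1..k}. s ` standard_simplex q \<subseteq> U i"
      proof (cases "\<sigma> - {Min \<sigma>} = {}")
        case True
        then have "s \<in> Poly_Mapping.keys (c {})" using s(1) by (simp only: True)
        then show ?thesis by (rule small)
      next
        case False
        then obtain j where "j \<in> \<sigma> - {Min \<sigma>}" by blast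
        then have "j \<in> {1..k}" "s ` standard_simplex q \<subseteq> U j"
          using s(1) c[of "\<sigma> - {Min \<sigma>}"] \<sigma>(1) unfolding singular_chain_XX by blast+
        then show ?thesis by blast
      qed
      then show ?thesis using least_index(2) s(2) True by metis
    qed
  qed
  moreover have "\<sigma> \<in> nerve_simplices U k p" if ne: "?h \<sigma> \<noteq> 0" for \<sigma>
  proof -
    have \<sigma>: "\<sigma> \<subseteq> {1..k}" "\<sigma> \<noteq> {}" "cech_homotopy q c \<sigma> \<noteq> 0" using ne by (auto split: if_splits)
    then have fin: "finite \<sigma>" using finite_subset by blast
    have "c (\<sigma> - {Min \<sigma>}) \<noteq> 0" using \<sigma> by (auto simp: cech_homotopy_def)
    then have "card (\<sigma> - {Min \<sigma>}) = p" using supp by blast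
    then have "card \<sigma> = Suc p" using \<sigma> fin Min_in[of \<sigma>] by (metis card_Suc_Diff1)
    then show ?thesis using in_nerve_simplicesI[OF ch] \<sigma> by blast
  qed
  ultimately show ?thesis by (auto simp: cech_chains_def)
qed

lemma cech_diff_restrict:
  assumes "\<tau> \<subseteq> {1..k}"
  shows "cech_diff k (\<lambda>\<sigma>. if \<sigma> \<subseteq> {1..k} \<and> \<sigma> \<noteq> {} then c \<sigma> else 0) \<tau> = cech_diff k c \<tau>"
  unfolding cech_diff_def using assms by (intro sum.cong) auto

text \<open>The contraction of a cycle is a preimage of it. In degree 0 the condition at the empty
  set is the vanishing of the augmentation, so exactness of the augmented complex is
  included.\<close>

lemma cech_exact:
  assumes c: "c \<in> cech_chains p q" and z: "\<And>\<tau>. \<tau> \<subseteq> {1..k} \<Longrightarrow> cech_diff k c \<tau> = 0"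
  shows "\<exists>d\<in>cech_chains (Suc p) q. cech_diff k d = c"
proof
  let ?h = "\<lambda>\<sigma>. if \<sigma> \<subseteq> {1..k} \<and> \<sigma> \<noteq> {} then cech_homotopy q c \<sigma> else 0"
  have c0: "c \<sigma> \<noteq> 0 \<Longrightarrow> \<sigma> \<subseteq> {1..k} \<and> card \<sigma> = Suc p" for \<sigma>
    using cech_chainsD[OF c] by (fastforce simp: nerve_simplices_def)
  have ce: "c {} = 0" using c0[of "{}"] by auto
  show h: "?h \<in> cech_chains (Suc p) q"
    by (rule cech_homotopy_mem) (use cech_chainsD[OF c] c0 ce in auto)
  show "cech_diff k ?h = c"
  proof
    fix \<tau>
    show "cech_diff k ?h \<tau> = c \<tau>"
    proof (cases "\<tau> \<subseteq> {1..k} \<and> \<tau> \<noteq> {}")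
      case True
      have "cech_homotopy q (cech_diff k c) \<tau> = 0"
        using z[of "\<tau> - {Min \<tau>}"] True unfolding cech_homotopy_def
        by (metis Diff_subset chain_part_0 subset_trans)
      moreover have "cech_diff k ?h \<tau> = cech_diff k (cech_homotopy q c) \<tau>"
        by (rule cech_diff_restrict) (use True in blast)
      ultimately show ?thesis
        using cech_homotopy_identity[of q c \<tau>] cech_chainsD[OF c] True by simp
    next
      case False
      then have "\<not> (\<tau> \<in> nerve_simplices U k p)" by (auto simp: nerve_simplices_def)
      then show ?thesis
        using cech_diff_mem[OF h] cech_chainsD[OF c] cech_chainsD(2) by simp
    qed
  qed
qed

end

section \<open>The double complex of an open cover with acyclic intersections\<close>

locale acyclic_cover = finite_cover X U k
  for X :: "'a topology" and U :: "nat \<Rightarrow> 'a set" and k :: nat +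
  assumes open_U: "i \<in> {1..k} \<Longrightarrow> openin X (U i)"
    and covers: "topspace X \<subseteq> (\<Union>i\<in>{1..k}. U i)"
    and acyclic: "\<sigma> \<subseteq> {1..k} \<Longrightarrow> \<sigma> \<noteq> {} \<Longrightarrow> singular_chain (Suc q) (XX \<sigma>) c \<Longrightarrow>
      chain_boundary (Suc q) c = 0 \<Longrightarrow>
      \<exists>d. singular_chain (Suc (Suc q)) (XX \<sigma>) d \<and> chain_boundary (Suc (Suc q)) d = c"
begin

lemma cech_chains_zero: "0 \<in> cech_chains p q"
  by (simp add: cech_chains_def)

lemma cech_chains_diff:
  assumes "c \<in> cech_chains p q" "d \<in> cech_chains p q"
  shows "c - d \<in> cech_chains p q"
  unfolding cech_chains_def
proof (intro CollectI allI conjI impI)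
  fix \<sigma>
  show "singular_chain q (XX \<sigma>) ((c - d) \<sigma>)"
    using cech_chainsD(1)[OF assms(1)] cech_chainsD(1)[OF assms(2)] by (simp add: singular_chain_diff)
  show "\<sigma> \<in> nerve_simplices U k p" if "(c - d) \<sigma> \<noteq> 0"
    using cech_chainsD(2)[OF assms(1), of \<sigma>] cech_chainsD(2)[OF assms(2), of \<sigma>] that by fastforce
qed

lemma cech_vdiff_mem: "c \<in> cech_chains p (Suc q) \<Longrightarrow> cech_vdiff p q c \<in> cech_chains p q"
  unfolding cech_chains_def cech_vdiff_def
  by (auto intro!: singular_chain_alt singular_chain_boundary_alt) (metis alt_zero chain_boundary_0)

lemma cech_vdiff_diff: "cech_vdiff p q (c - d) = cech_vdiff p q c - cech_vdiff p q d"
  by (auto simp: cech_vdiff_def chain_boundary_diff alt_diff)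

lemma cech_vdiff_vdiff:
  assumes "c \<in> cech_chains p (Suc (Suc q))"
  shows "cech_vdiff p q (cech_vdiff p (Suc q) c) = 0"
proof
  fix \<sigma>
  show "cech_vdiff p q (cech_vdiff p (Suc q) c) \<sigma> = 0 \<sigma>"
    using chain_boundary_boundary_alt[OF cech_chainsD(1)[OF assms]]
    by (simp add: cech_vdiff_def chain_boundary_alt)
qed

lemma cech_diff_vdiff: "cech_diff k (cech_vdiff (Suc p) q c) = - cech_vdiff p q (cech_diff k c)"
proof
  fix \<tau>
  have "chain_boundary (Suc q) (cech_diff k c \<tau>)
      = (\<Sum>i\<in>{1..k} - \<tau>. alt (card {j \<in> \<tau>. j < i}) (chain_boundary (Suc q) (c (insert i \<tau>))))"
    unfolding cech_diff_def chain_boundary_sum by (simp add: chain_boundary_alt o_def)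
  then show "cech_diff k (cech_vdiff (Suc p) q c) \<tau> = (- cech_vdiff p q (cech_diff k c)) \<tau>"
    unfolding cech_diff_def[of _ "cech_vdiff _ _ _"] cech_vdiff_def
    by (simp add: alt_sum alt_uminus sum_negf alt_alt)
qed

lemma vertical_exact:
  assumes c: "c \<in> cech_chains p (Suc q)" and z: "cech_vdiff p q c = 0"
  shows "\<exists>d\<in>cech_chains p (Suc (Suc q)). cech_vdiff p (Suc q) d = c"
proof -
  \<comment> \<open>The sign in \<open>cech_vdiff\<close> is moved to the right-hand side, so that
    the filling is taken of \<open>alt p (c \<sigma>)\<close>.\<close>
  have "\<exists>d. singular_chain (Suc (Suc q)) (XX \<sigma>) d \<and> chain_boundary (Suc (Suc q)) d = alt p (c \<sigma>)"
    if "\<sigma> \<in> nerve_simplices U k p" for \<sigma>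
  proof (rule acyclic)
    show "\<sigma> \<subseteq> {1..k}" "\<sigma> \<noteq> {}" using that by (auto simp: nerve_simplices_def)
    show "singular_chain (Suc q) (XX \<sigma>) (alt p (c \<sigma>))"
      using cech_chainsD(1)[OF c] by (rule singular_chain_alt)
    show "chain_boundary (Suc q) (alt p (c \<sigma>)) = 0"
      using fun_cong[OF z, of \<sigma>] by (simp add: cech_vdiff_def chain_boundary_alt)
  qed
  then obtain d where d: "\<And>\<sigma>. \<sigma> \<in> nerve_simplices U k p \<Longrightarrow> singular_chain (Suc (Suc q)) (XX \<sigma>) (d \<sigma>)"
    "\<And>\<sigma>. \<sigma> \<in> nerve_simplices U k p \<Longrightarrow> chain_boundary (Suc (Suc q)) (d \<sigma>) = alt p (c \<sigma>)"
    by metis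
  let ?d = "\<lambda>\<sigma>. if \<sigma> \<in> nerve_simplices U k p then d \<sigma> else 0"
  have "?d \<in> cech_chains p (Suc (Suc q))"
    using d(1) by (auto simp: cech_chains_def)
  moreover have "cech_vdiff p (Suc q) ?d = c"
    using d(2) cech_chainsD(2)[OF c] by (auto simp: cech_vdiff_def)
  ultimately show ?thesis by blast
qed

sublocale rows: double_complex cech_chains "\<lambda>p q. cech_diff k" cech_vdiff
proof
  fix p q and x assume "x \<in> cech_chains (Suc p) q" "cech_diff k x = 0"
  then show "\<exists>y\<in>cech_chains (Suc (Suc p)) q. cech_diff k y = x"
    by (intro cech_exact) auto
qed (simp_all add: cech_chains_zero cech_chains_diff cech_diff_mem cech_vdiff_mem cech_diff_diff
       cech_vdiff_diff cech_vdiff_vdiff cech_diff_vdiff)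

sublocale cols: double_complex "\<lambda>q p. cech_chains p q" "\<lambda>q p. cech_vdiff p q" "\<lambda>q p. cech_diff k"
proof
  fix p q and x assume "x \<in> cech_chains q (Suc p)" "cech_vdiff q p x = 0"
  then show "\<exists>y\<in>cech_chains q (Suc (Suc p)). cech_vdiff q (Suc p) y = x"
    by (rule vertical_exact)
qed (simp_all add: cech_chains_zero cech_chains_diff cech_diff_mem cech_vdiff_mem cech_diff_diff
       cech_vdiff_diff cech_diff_cech_diff cech_diff_vdiff)

text \<open>Reversing the components of a total element of degree n reads it in the double complex
  with exchanged directions. Cycles and boundaries correspond, so every statement about the edge p =
  0 has a mirror image at the edge q = 0.\<close>

definition transpose :: "nat \<Rightarrow> (nat \<Rightarrow> 'b) \<Rightarrow> nat \<Rightarrow> 'b::zero" where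
  "transpose n x p = (if p \<le> n then x (n - p) else 0)"

lemma transpose_transpose: "(\<And>p. p > n \<Longrightarrow> x p = 0) \<Longrightarrow> transpose n (transpose n x) = x"
  by (auto simp: transpose_def)

lemma transpose_tot: "x \<in> rows.tot n \<Longrightarrow> transpose n x \<in> cols.tot n"
  "x \<in> cols.tot n \<Longrightarrow> transpose n x \<in> rows.tot n"
  unfolding rows.tot_def cols.tot_def transpose_def by auto

lemma transpose_cycles: "x \<in> rows.tot_cycles n \<Longrightarrow> transpose n x \<in> cols.tot_cycles n"
  "x \<in> cols.tot_cycles n \<Longrightarrow> transpose n x \<in> rows.tot_cycles n"
  unfolding rows.tot_cycles_def cols.tot_cycles_def using transpose_tot
  by (auto simp: transpose_def Suc_diff_le add.commute)

lemma transpose_boundary: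
  assumes "x \<in> cols.tot_boundaries n"
  shows "transpose n x \<in> rows.tot_boundaries n"
proof -
  obtain y where x: "x \<in> cols.tot n" and y: "y \<in> cols.tot (Suc n)"
    and xy: "\<And>p q. p + q = n \<Longrightarrow> x p = cech_diff k (y p) + cech_vdiff q p (y (Suc p))"
    using assms unfolding cols.tot_boundaries_def by blast
  have "transpose n x p = cech_vdiff p q (transpose (Suc n) y p) + cech_diff k (transpose (Suc n) y (Suc p))"
    if "p + q = n" for p q
  proof -
    have "n - p = q" "Suc n - p = Suc q" using that by auto
    then show ?thesis using xy[of q p] that by (simp add: transpose_def add.commute)
  qed
  then show ?thesis
    using transpose_tot(2)[OF x] transpose_tot(2)[OF y] unfolding rows.tot_boundaries_def by blast
qed

text \<open>The criterion for boundaries by the component at index 0, read in the transposed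
  complex.\<close>

lemma tot_boundaries_lastI:
  assumes z: "z \<in> rows.tot_cycles n" and a: "a \<in> cech_chains n 1" "b \<in> cech_chains (Suc n) 0"
    and zn: "z n = cech_vdiff n 0 a + cech_diff k b"
  shows "z \<in> rows.tot_boundaries n"
proof -
  have "transpose n z \<in> cols.tot_boundaries n"
    by (rule cols.tot_boundaryI[OF transpose_cycles(1)[OF z], of b a])
      (use a zn in \<open>auto simp: transpose_def add.commute\<close>)
  then have "transpose n (transpose n z) \<in> rows.tot_boundaries n"
    by (rule transpose_boundary)
  then show ?thesis
    using z by (subst (asm) transpose_transpose) (auto simp: rows.tot_cycles_def rows.tot_def)
qed

lemma tot_cycle_ending:
  assumes a: "a \<in> cech_chains n 0"
    and ex: "\<And>m. n = Suc m \<Longrightarrow> \<exists>y\<in>cech_chains m 1. cech_vdiff m 0 y = cech_diff k a"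
  obtains x where "x \<in> rows.tot_cycles n" "x n = a"
proof -
  obtain x where "x \<in> cols.tot_cycles n" "x 0 = a"
    using cols.tot_cycle_extending[OF a] ex by auto
  then show ?thesis
    using that[of "transpose n x"] transpose_cycles(2) by (auto simp: transpose_def)
qed

definition tot_group :: "nat \<Rightarrow> (nat \<Rightarrow> nat set \<Rightarrow> 'a chain) monoid" where
  "tot_group n = \<lparr>carrier = rows.tot_cycles n, monoid.mult = (+), one = 0\<rparr>"

lemma tot_cycles_zero: "0 \<in> rows.tot_cycles n"
  by (auto simp: rows.tot_cycles_def rows.tot_def cech_chains_zero)

lemma tot_cycles_diff:
  assumes x: "x \<in> rows.tot_cycles n" and y: "y \<in> rows.tot_cycles n"
  shows "x - y \<in> rows.tot_cycles n"
proof -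
  have "cech_vdiff p q ((x - y) p) + cech_diff k ((x - y) (Suc p)) = 0" if "Suc (p + q) = n" for p q
  proof -
    have "cech_vdiff p q ((x - y) p) + cech_diff k ((x - y) (Suc p))
       = (cech_vdiff p q (x p) + cech_diff k (x (Suc p))) - (cech_vdiff p q (y p) + cech_diff k (y (Suc p)))"
      by (simp add: cech_vdiff_diff cech_diff_diff)
    also have "\<dots> = 0"
      using x y that unfolding rows.tot_cycles_def by simp
    finally show ?thesis .
  qed
  moreover have "x - y \<in> rows.tot n"
    using x y unfolding rows.tot_cycles_def rows.tot_def by (auto simp: cech_chains_diff)
  ultimately show ?thesis unfolding rows.tot_cycles_def by blast
qed

lemma tot_cycles_uminus: "x \<in> rows.tot_cycles n \<Longrightarrow> - x \<in> rows.tot_cycles n"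
  using tot_cycles_diff[OF tot_cycles_zero] by simp

lemma tot_cycles_add: "x \<in> rows.tot_cycles n \<Longrightarrow> y \<in> rows.tot_cycles n \<Longrightarrow> x + y \<in> rows.tot_cycles n"
  using tot_cycles_diff[of x n "- y"] tot_cycles_uminus[of y n] by simp

lemma group_tot_group: "group (tot_group n)"
proof (rule groupI)
  fix x assume "x \<in> carrier (tot_group n)"
  then show "\<exists>y\<in>carrier (tot_group n). y \<otimes>\<^bsub>tot_group n\<^esub> x = \<one>\<^bsub>tot_group n\<^esub>"
    by (intro bexI[of _ "- x"]) (auto simp: tot_group_def tot_cycles_uminus)
qed (auto simp: tot_group_def tot_cycles_zero tot_cycles_add add.assoc)

lemma tot_cyclesD:
  assumes "x \<in> rows.tot_cycles n"
  shows "x 0 \<in> cech_chains 0 n" "x n \<in> cech_chains n 0"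
    "\<And>p q. Suc (p + q) = n \<Longrightarrow> x p \<in> cech_chains p (Suc q) \<and> x (Suc p) \<in> cech_chains (Suc p) q \<and>
       cech_vdiff p q (x p) + cech_diff k (x (Suc p)) = 0"
  using assms unfolding rows.tot_cycles_def rows.tot_def by auto

lemma tot_boundariesE:
  assumes "x \<in> rows.tot_boundaries n"
  obtains y where "\<forall>p q. p + q = n \<longrightarrow> y p \<in> cech_chains p (Suc q) \<and> y (Suc p) \<in> cech_chains (Suc p) q \<and>
    x p = cech_vdiff p q (y p) + cech_diff k (y (Suc p))"
proof -
  obtain y where "y \<in> rows.tot (Suc n)"
    "\<And>p q. p + q = n \<Longrightarrow> x p = cech_vdiff p q (y p) + cech_diff k (y (Suc p))"
    using assms unfolding rows.tot_boundaries_def by blast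
  then show ?thesis by (intro that[of y]) (auto simp: rows.tot_def)
qed

end

lemma homology_class_hom:
  "homologous_rel_set p X S \<in> hom (relcycle_group p X S) (relative_homology_group (int p) X S)"
  using normal.r_coset_hom_Mod[OF normal_subgroup_singular_relboundary_relcycle, of p X S]
  by (simp add: right_coset_singular_relboundary nontrivial_relative_homology_group)

text \<open>The nerve complex signs a face by the position l of the removed vertex in the sorted
  list, \<open>cech_diff\<close> by the number of smaller indices. This lemma identifies the
  two.\<close>

lemma card_below_nth_sorted_list_of_set:
  fixes \<sigma> :: "nat set"
  assumes "finite \<sigma>" "l < card \<sigma>"
  shows "sorted_list_of_set \<sigma> ! l \<in> \<sigma>" "card {j \<in> \<sigma>. j < sorted_list_of_set \<sigma> ! l} = l"
proof -
  let ?xs = "sorted_list_of_set \<sigma>"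
  have len: "length ?xs = card \<sigma>" and set: "set ?xs = \<sigma>" and srt: "sorted_wrt (<) ?xs"
    using assms by auto
  show "?xs ! l \<in> \<sigma>" using assms len set nth_mem by metis
  have lt: "?xs ! a < ?xs ! b" if "a < b" "b < card \<sigma>" for a b
    using that srt len sorted_wrt_nth_less by metis
  have "{j \<in> \<sigma>. j < ?xs ! l} = (!) ?xs ` {..<l}"
  proof (intro equalityI subsetI)
    fix j assume j: "j \<in> {j \<in> \<sigma>. j < ?xs ! l}"
    then have "j \<in> set ?xs" using set by blast
    then obtain a where a: "a < card \<sigma>" "j = ?xs ! a" by (metis in_set_conv_nth len)
    then have "a < l" using j lt[of l a] by (cases "a = l") (force simp: not_less_iff_gr_or_eq)+
    then show "j \<in> (!) ?xs ` {..<l}" using a by blast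
  next
    fix j assume "j \<in> (!) ?xs ` {..<l}"
    then show "j \<in> {j \<in> \<sigma>. j < ?xs ! l}"
      using lt[of _ l] assms set len by (auto intro: nth_mem[of _ ?xs, unfolded set len])
  qed
  moreover have "inj_on ((!) ?xs) {..<l}"
    using assms len by (intro inj_on_nth) auto
  ultimately show "card {j \<in> \<sigma>. j < ?xs ! l} = l"
    by (simp add: card_image)
qed

section \<open>Total cycles and the singular homology of the space\<close>

context acyclic_cover
begin

abbreviation aug :: "(nat set \<Rightarrow> 'a chain) \<Rightarrow> 'a chain" where
  "aug c \<equiv> cech_diff k c {}"

lemma aug_eq_sum: "aug c = (\<Sum>i\<in>{1..k}. c {i})"
  by (simp add: cech_diff_def)

lemma singular_chain_aug: "c \<in> cech_chains 0 q \<Longrightarrow> singular_chain q X (aug c)"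
  using cech_diff_chain[of q c "{}"] cech_chainsD(1)[of c 0 q] by simp

lemma chain_boundary_aug: "chain_boundary (Suc q) (aug c) = aug (cech_vdiff 0 q c)"
  unfolding aug_eq_sum chain_boundary_sum by (simp add: cech_vdiff_def)

text \<open>At a nonempty \<tau> the differential of a chain of Cech degree 0 only involves sets
  with at least two indices, where the chain is 0. The empty set is the only place where a condition
  remains.\<close>

lemma aug_exact:
  assumes c: "c \<in> cech_chains 0 q" and "aug c = 0"
  shows "\<exists>d\<in>cech_chains 1 q. cech_diff k d = c"
proof -
  have "cech_diff k c \<tau> = 0" if "\<tau> \<subseteq> {1..k}" for \<tau>
  proof (cases "\<tau> = {}")
    case False
    have fin: "finite \<tau>" using that finite_subset by blast
    have "c (insert i \<tau>) = 0" if "i \<in> {1..k} - \<tau>" for i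
    proof (rule cech_chainsD(2)[OF c])
      show "insert i \<tau> \<notin> nerve_simplices U k 0"
        using that fin False by (auto simp: nerve_simplices_def)
    qed
    then show ?thesis by (simp add: cech_diff_def)
  qed (use assms in auto)
  then show ?thesis using cech_exact[OF c] by simp
qed

lemma small_chain_aug:
  assumes "singular_chain q X c" and small: "\<And>s. s \<in> Poly_Mapping.keys c \<Longrightarrow> \<exists>i\<in>{1..k}. s ` standard_simplex q \<subseteq> U i"
  obtains a where "a \<in> cech_chains 0 q" "aug a = c"
proof
  let ?c = "\<lambda>\<sigma>. if \<sigma> = {} then c else 0"
  let ?h = "\<lambda>\<sigma>. if \<sigma> \<subseteq> {1..k} \<and> \<sigma> \<noteq> {} then cech_homotopy q ?c \<sigma> else 0"
  show "?h \<in> cech_chains 0 q"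
    by (rule cech_homotopy_mem) (use assms in \<open>auto split: if_splits\<close>)
  have "aug ?h = (\<Sum>i\<in>{1..k}. chain_part (\<lambda>s. least_index q s = i) c)"
    unfolding aug_eq_sum by (intro sum.cong) (auto simp: cech_homotopy_def)
  also have "\<dots> = c"
  proof (rule sum_chain_part)
    fix s assume "s \<in> Poly_Mapping.keys c"
    then obtain i where "i \<in> {1..k}" "s ` standard_simplex q \<subseteq> U i" using small by blast
    then show "least_index q s \<in> {1..k}" by (rule least_index(1))
  qed simp
  finally show "aug ?h = c" .
qed

lemma small_subdivision:
  assumes "singular_chain q X c"
  obtains N a where "a \<in> cech_chains 0 q" "aug a = (singular_subdivision q ^^ N) c"
proof -
  obtain N where N: "\<And>m f. N \<le> m \<Longrightarrow> f \<in> Poly_Mapping.keys ((singular_subdivision q ^^ m) c)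
      \<Longrightarrow> \<exists>V \<in> U ` {1..k}. f \<in> standard_simplex q \<rightarrow> V"
    using sufficient_iterated_singular_subdivision_exists[of "U ` {1..k}" X q c] open_U covers assms by blast
  have "singular_chain q X ((singular_subdivision q ^^ N) c)"
    using assms by (induction N) (auto simp: singular_chain_singular_subdivision)
  then show ?thesis
    by (rule small_chain_aug[of q]) (use N[OF order_refl] that in \<open>auto simp: image_subset_iff_funcset\<close>)
qed

text \<open>Subdividing e makes it small but replaces its boundary by the subdivision of
  \<open>aug a\<close>. The error is the boundary of the subdivision homotopy on
  \<open>aug a\<close>. That homotopy preserves chains of every subspace, so it may be applied to
  the components of a separately and its result is again small.\<close>

lemma small_boundary:
  assumes a: "a \<in> cech_chains 0 n" and e: "singular_chain (Suc n) X e" "chain_boundary (Suc n) e = aug a"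
  obtains b where "b \<in> cech_chains 0 (Suc n)" "chain_boundary (Suc n) (aug b) = aug a"
proof -
  obtain N b1 where b1: "b1 \<in> cech_chains 0 (Suc n)" "aug b1 = (singular_subdivision (Suc n) ^^ N) e"
    using small_subdivision[OF e(1)] .
  obtain h where h: "\<And>p. h p 0 = (0 :: 'a chain)"
        "\<And>p c1 c2. h p (c1-c2) = h p c1 - h p c2"
        "\<And>p Y c. singular_chain p Y c \<Longrightarrow> singular_chain (Suc p) Y (h p (c :: 'a chain))"
        "\<And>p Y c. singular_chain p Y c \<Longrightarrow> chain_boundary (Suc p) (h p c) + h (p - Suc 0) (chain_boundary p c)
                   = (singular_subdivision p ^^ N) c - c"
    using chain_homotopic_iterated_singular_subdivision[of N] by blast
  have hm: "h p (- c) = - h p c" for p c using h(2)[of p 0 c] h(1) by simp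
  have hadd: "h p (c + d) = h p c + h p d" for p c d using h(2)[of p c "- d"] hm by simp
  have hsum: "h p (\<Sum>i\<in>I. f i) = (\<Sum>i\<in>I. h p (f i))" if "finite I" for p I and f :: "nat \<Rightarrow> 'a chain"
    using that by (induction I rule: finite_induct) (auto simp: h(1) hadd)
  let ?b2 = "\<lambda>\<sigma>. h n (a \<sigma>)"
  have b2: "?b2 \<in> cech_chains 0 (Suc n)"
    using a h(1,3) unfolding cech_chains_def by force
  have aug2: "aug ?b2 = h n (aug a)"
    unfolding aug_eq_sum by (simp add: hsum)
  \<comment> \<open>Taking the boundary of the homotopy identity for e removes the term of degree n
    + 2.\<close>
  have "chain_boundary (Suc n) (chain_boundary (Suc (Suc n)) (h (Suc n) e) + h n (chain_boundary (Suc n) e))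
      = chain_boundary (Suc n) ((singular_subdivision (Suc n) ^^ N) e - e)"
    using h(4)[OF e(1)] by simp
  then have "chain_boundary (Suc n) (h n (aug a)) = chain_boundary (Suc n) (aug b1) - aug a"
    using chain_boundary_boundary_alt[OF h(3)[OF e(1)]] e b1(2)
    by (simp add: chain_boundary_add chain_boundary_diff)
  then have "chain_boundary (Suc n) (aug (b1 - ?b2)) = aug a"
    using aug2 by (simp add: cech_diff_diff chain_boundary_diff)
  then show ?thesis using that cech_chains_diff[OF b1(1) b2] by blast
qed

text \<open>The edge map at p = 0: the components of x 0 are chains on the sets U i, and their sum
  is a cycle of the whole space.\<close>

definition to_space :: "nat \<Rightarrow> (nat \<Rightarrow> nat set \<Rightarrow> 'a chain) \<Rightarrow> 'a chain set" where
  "to_space n x = homologous_rel_set n X {} (aug (x 0))"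

lemma aug_tot_cycle:
  assumes "x \<in> rows.tot_cycles n"
  shows "singular_relcycle n X {} (aug (x 0))"
proof -
  have "chain_boundary n (aug (x 0)) = 0"
  proof (cases n)
    case (Suc m)
    then have "cech_vdiff 0 m (x 0) + cech_diff k (x 1) = 0"
      using tot_cyclesD(3)[OF assms, of 0 m] by simp
    \<comment> \<open>The boundary of the sum is thus the augmentation of a Cech boundary, which is
      0.\<close>
    then have "cech_vdiff 0 m (x 0) = cech_diff k (- x 1)"
      by (simp add: eq_neg_iff_add_eq_0 rows.dh_uminus)
    then show ?thesis
      using Suc cech_diff_cech_diff[of k "- x 1"] by (simp add: chain_boundary_aug)
  qed (simp add: chain_boundary_def)
  then show ?thesis
    using singular_chain_aug[OF tot_cyclesD(1)[OF assms]] by (simp add: singular_cycle)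
qed

lemma to_space_hom: "to_space n \<in> hom (tot_group n) (homology_group (int n) X)"
proof (rule homI)
  fix x y assume xy: "x \<in> carrier (tot_group n)" "y \<in> carrier (tot_group n)"
  then have z: "singular_relcycle n X {} (aug (x 0))" "singular_relcycle n X {} (aug (y 0))"
    by (auto simp: tot_group_def aug_tot_cycle)
  show "to_space n x \<in> carrier (homology_group (int n) X)"
    using z by (auto simp: to_space_def carrier_relative_homology_group)
  show "to_space n (x \<otimes>\<^bsub>tot_group n\<^esub> y) = to_space n x \<otimes>\<^bsub>homology_group (int n) X\<^esub> to_space n y"
    using hom_mult[OF homology_class_hom[of n X "{}"], of "aug (x 0)" "aug (y 0)"] z
    by (simp add: to_space_def tot_group_def rows.dh_add)
qed

lemma to_space_surj: "to_space n ` carrier (tot_group n) = carrier (homology_group (int n) X)"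
proof (intro equalityI subsetI)
  fix z assume "z \<in> to_space n ` carrier (tot_group n)"
  then show "z \<in> carrier (homology_group (int n) X)" using to_space_hom by (auto simp: hom_def)
next
  fix z assume "z \<in> carrier (homology_group (int n) X)"
  then obtain c where c: "singular_relcycle n X {} c" "z = homologous_rel_set n X {} c"
    by (auto simp: carrier_relative_homology_group)
  \<comment> \<open>Only small cycles can be distributed over the members of the cover.\<close>
  obtain c' where c': "singular_relcycle n X {} c'" "homologous_rel n X {} c c'"
    "\<And>f. f \<in> Poly_Mapping.keys c' \<Longrightarrow> \<exists>V \<in> U ` {1..k}. f \<in> standard_simplex n \<rightarrow> V"
    using small_homologous_rel_relcycle_exists[of "U ` {1..k}" X n "{}" c] open_U covers c(1) by blast
  obtain a where a: "a \<in> cech_chains 0 n" "aug a = c'"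
    using small_chain_aug[of n c'] c'(1,3) by (auto simp: singular_cycle image_subset_iff_funcset)
  \<comment> \<open>The total boundary of \<open>c'\<close> is 0, but the boundary of its lift a
    need not be. Its augmentation vanishes, so it comes from the intersections of two members; this
    starts the extension to a total cycle.\<close>
  have "\<exists>y\<in>cech_chains 1 m. cech_diff k y = cech_vdiff 0 m a" if "n = Suc m" for m
  proof (rule aug_exact)
    show "cech_vdiff 0 m a \<in> cech_chains 0 m" using a that cech_vdiff_mem by simp
    show "aug (cech_vdiff 0 m a) = 0"
      using c'(1) that by (simp add: a(2) singular_cycle flip: chain_boundary_aug)
  qed
  then obtain x where x: "x \<in> rows.tot_cycles n" "x 0 = a"
    using rows.tot_cycle_extending[OF a(1)] by auto
  have "to_space n x = z"
    using c' c(2) by (simp add: to_space_def x(2) a(2) homologous_rel_set_eq homologous_rel_sym)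
  then show "z \<in> to_space n ` carrier (tot_group n)"
    using x by (auto simp: tot_group_def)
qed

text \<open>A bounding chain can be made small and lifted to b. Then x 0 minus the vertical boundary
  of b has augmentation 0, hence is a Cech boundary, and the component at index 0 decides whether x
  bounds.\<close>

lemma to_space_kernel:
  "kernel (tot_group n) (homology_group (int n) X) (to_space n) = rows.tot_cycles n \<inter> rows.tot_boundaries n"
proof (intro equalityI subsetI)
  fix x assume "x \<in> kernel (tot_group n) (homology_group (int n) X) (to_space n)"
  then have x: "x \<in> rows.tot_cycles n" and "singular_relboundary n X {} (aug (x 0))"
    by (auto simp: kernel_def tot_group_def to_space_def homologous_rel_set_eq_relboundary)
  then obtain e where "singular_chain (Suc n) X e" "chain_boundary (Suc n) e = aug (x 0)"
    by (auto simp: singular_boundary)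
  then obtain b where b: "b \<in> cech_chains 0 (Suc n)" "chain_boundary (Suc n) (aug b) = aug (x 0)"
    using small_boundary[OF tot_cyclesD(1)[OF x]] by blast
  have "\<exists>d\<in>cech_chains 1 n. cech_diff k d = x 0 - cech_vdiff 0 n b"
  proof (rule aug_exact)
    show "x 0 - cech_vdiff 0 n b \<in> cech_chains 0 n"
      using tot_cyclesD(1)[OF x] b(1) by (intro cech_chains_diff cech_vdiff_mem)
    show "aug (x 0 - cech_vdiff 0 n b) = 0"
      using b(2) by (simp add: cech_diff_diff chain_boundary_aug)
  qed
  then obtain d where "d \<in> cech_chains 1 n" "cech_diff k d = x 0 - cech_vdiff 0 n b" by blast
  then show "x \<in> rows.tot_cycles n \<inter> rows.tot_boundaries n"
    using rows.tot_boundaryI[OF x b(1), of d] x by simp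
next
  fix x assume x: "x \<in> rows.tot_cycles n \<inter> rows.tot_boundaries n"
  then have "x \<in> rows.tot_boundaries n" by simp
  then obtain y where y: "\<forall>p q. p + q = n \<longrightarrow> y p \<in> cech_chains p (Suc q) \<and> y (Suc p) \<in> cech_chains (Suc p) q \<and>
      x p = cech_vdiff p q (y p) + cech_diff k (y (Suc p))"
    by (rule tot_boundariesE)
  from y[rule_format, of 0 n] have y: "y 0 \<in> cech_chains 0 (Suc n)" "x 0 = cech_vdiff 0 n (y 0) + cech_diff k (y 1)"
    by auto
  have "chain_boundary (Suc n) (aug (y 0)) = aug (x 0)"
    using cech_diff_cech_diff[of k "y 1"] by (simp add: y(2) rows.dh_add chain_boundary_aug)
  then have "singular_relboundary n X {} (aug (x 0))"
    using singular_chain_aug[OF y(1)] by (auto simp: singular_boundary)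
  then show "x \<in> kernel (tot_group n) (homology_group (int n) X) (to_space n)"
    using x by (simp add: kernel_def tot_group_def to_space_def homologous_rel_set_eq_relboundary)
qed

end

section \<open>Total cycles and the nerve complex with coefficients in the zeroth homology\<close>

lemma sum_apply: "(\<Sum>i\<in>I. f i) x = (\<Sum>i\<in>I. f i x)"
  by (induction I rule: infinite_finite_induct) auto

lemma comm_group_sum_group:
  assumes "\<And>i. i \<in> I \<Longrightarrow> comm_group (G i)"
  shows "comm_group (sum_group I G)"
proof -
  have G: "\<And>i. i \<in> I \<Longrightarrow> group (G i)" using assms comm_group.axioms(2) by blast
  show ?thesis
    by (intro group.group_comm_groupI sum_group)
      (use G assms in \<open>auto simp: carrier_sum_group PiE_iff comm_monoid.m_comm comm_group.axioms(1) intro!: restrict_ext\<close>)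
qed

context acyclic_cover
begin

abbreviation N :: "nat \<Rightarrow> nat set set" where "N \<equiv> nerve_simplices U k"

abbreviation NC :: "nat \<Rightarrow> (nat set \<Rightarrow> 'a chain set) monoid" where
  "NC p \<equiv> nerve_chain X U k 0 p"

abbreviation zeroth_class :: "nat set \<Rightarrow> 'a chain \<Rightarrow> 'a chain set" where
  "zeroth_class \<sigma> \<equiv> homologous_rel_set 0 (XX \<sigma>) {}"

definition to_nerve :: "nat \<Rightarrow> (nat set \<Rightarrow> 'a chain) \<Rightarrow> nat set \<Rightarrow> 'a chain set" where
  "to_nerve p c = (\<lambda>\<sigma>\<in>N p. zeroth_class \<sigma> (c \<sigma>))"

lemma finite_N: "finite (N p)"
  by (rule finite_subset[of _ "Pow {1..k}"]) (auto simp: nerve_simplices_def)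

lemma relcycle_0: "singular_relcycle 0 Y {} c \<longleftrightarrow> singular_chain 0 Y c"
  by (simp add: singular_cycle chain_boundary_def)

lemma additive_hom_class:
  "additive_hom (homology_group 0 (XX \<sigma>)) {c. singular_chain 0 (XX \<sigma>) c} (zeroth_class \<sigma>)"
proof -
  have c: "comm_group (homology_group 0 (XX \<sigma>))" by simp
  show ?thesis
  proof (intro additive_hom.intro[OF c] additive_hom_axioms.intro)
    fix c d assume "c \<in> {c. singular_chain 0 (XX \<sigma>) c}" "d \<in> {c. singular_chain 0 (XX \<sigma>) c}"
    then show "zeroth_class \<sigma> (c + d) = zeroth_class \<sigma> c \<otimes>\<^bsub>homology_group 0 (XX \<sigma>)\<^esub> zeroth_class \<sigma> d"
      using hom_mult[OF homology_class_hom[of 0 "XX \<sigma>" "{}"], of c d] by (simp add: relcycle_0)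
  qed (auto simp: singular_chain_add singular_chain_minus carrier_relative_homology_group_0 relcycle_0)
qed

lemma comm_group_NC: "comm_group (NC p)"
  unfolding nerve_chain_def by (rule comm_group_sum_group) simp

lemma carrier_NC: "carrier (NC p) = (\<Pi>\<^sub>E \<sigma>\<in>N p. carrier (homology_group 0 (XX \<sigma>)))"
  unfolding nerve_chain_def using finite_N by (subst carrier_sum_group) auto

lemma additive_hom_to_nerve: "additive_hom (NC p) (cech_chains p 0) (to_nerve p)"
proof (intro additive_hom.intro[OF comm_group_NC] additive_hom_axioms.intro)
  fix c d assume cd: "c \<in> cech_chains p 0" "d \<in> cech_chains p 0"
  show "to_nerve p c \<in> carrier (NC p)"
    unfolding carrier_NC to_nerve_def
    using cech_chainsD(1)[OF cd(1)] additive_hom.closed[OF additive_hom_class] by auto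
  show "to_nerve p (c + d) = to_nerve p c \<otimes>\<^bsub>NC p\<^esub> to_nerve p d"
    unfolding nerve_chain_def to_nerve_def
    using cech_chainsD(1)[OF cd(1)] cech_chainsD(1)[OF cd(2)] additive_hom.add[OF additive_hom_class]
    by (auto intro!: restrict_ext)
qed (auto simp: cech_chains_zero rows.add_mem rows.uminus_mem)

lemma to_nerve_surj: "to_nerve p ` cech_chains p 0 = carrier (NC p)"
proof (intro equalityI subsetI)
  fix z assume "z \<in> to_nerve p ` cech_chains p 0"
  then show "z \<in> carrier (NC p)" using additive_hom.closed[OF additive_hom_to_nerve] by auto
next
  fix z assume z: "z \<in> carrier (NC p)"
  then have "\<exists>c. singular_chain 0 (XX \<sigma>) c \<and> z \<sigma> = zeroth_class \<sigma> c" if "\<sigma> \<in> N p" for \<sigma>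
    using that unfolding carrier_NC carrier_relative_homology_group_0 relcycle_0 by (auto dest!: PiE_mem)
  then obtain c where c: "\<And>\<sigma>. \<sigma> \<in> N p \<Longrightarrow> singular_chain 0 (XX \<sigma>) (c \<sigma>) \<and> z \<sigma> = zeroth_class \<sigma> (c \<sigma>)"
    by metis
  let ?c = "\<lambda>\<sigma>. if \<sigma> \<in> N p then c \<sigma> else 0"
  have "?c \<in> cech_chains p 0" using c by (auto simp: cech_chains_def)
  moreover have "to_nerve p ?c = z"
    using c z unfolding to_nerve_def carrier_NC
    by (auto simp: PiE_def extensional_def restrict_def fun_eq_iff)
  ultimately show "z \<in> to_nerve p ` cech_chains p 0" by blast
qed

text \<open>The group in the nerve complex is the cokernel of the vertical differential: fillings
  chosen simplex by simplex assemble to one Cech chain, with \<open>alt p\<close> undoing the sign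
  of \<open>cech_vdiff\<close>.\<close>

lemma to_nerve_eq_one_iff:
  assumes c: "c \<in> cech_chains p 0"
  shows "to_nerve p c = \<one>\<^bsub>NC p\<^esub> \<longleftrightarrow> (\<exists>d\<in>cech_chains p 1. cech_vdiff p 0 d = c)"
proof -
  have "to_nerve p c = \<one>\<^bsub>NC p\<^esub> \<longleftrightarrow> (\<forall>\<sigma>\<in>N p. zeroth_class \<sigma> (c \<sigma>) = \<one>\<^bsub>homology_group 0 (XX \<sigma>)\<^esub>)"
    unfolding to_nerve_def nerve_chain_def by (auto simp: fun_eq_iff restrict_def split: if_splits)
  also have "\<dots> \<longleftrightarrow> (\<forall>\<sigma>\<in>N p. \<exists>d. singular_chain 1 (XX \<sigma>) d \<and> chain_boundary 1 d = c \<sigma>)"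
  proof -
    have one: "\<one>\<^bsub>homology_group 0 Y\<^esub> = singular_relboundary_set 0 Y {}" for Y :: "'a topology"
      using one_relative_homology_group[of 0 Y "{}"] by simp
    show ?thesis unfolding one homologous_rel_set_eq_relboundary singular_boundary by simp
  qed
  also have "\<dots> \<longleftrightarrow> (\<exists>d\<in>cech_chains p 1. cech_vdiff p 0 d = c)"
  proof
    assume "\<forall>\<sigma>\<in>N p. \<exists>d. singular_chain 1 (XX \<sigma>) d \<and> chain_boundary 1 d = c \<sigma>"
    then obtain d where d: "\<And>\<sigma>. \<sigma> \<in> N p \<Longrightarrow> singular_chain 1 (XX \<sigma>) (d \<sigma>) \<and> chain_boundary 1 (d \<sigma>) = c \<sigma>"
      by metis
    let ?d = "\<lambda>\<sigma>. if \<sigma> \<in> N p then alt p (d \<sigma>) else 0"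
    have "?d \<in> cech_chains p 1" using d by (auto simp: cech_chains_def singular_chain_alt)
    moreover have "cech_vdiff p 0 ?d = c"
      using d cech_chainsD(2)[OF c] by (auto simp: cech_vdiff_def chain_boundary_alt)
    ultimately show "\<exists>d\<in>cech_chains p 1. cech_vdiff p 0 d = c" by blast
  next
    assume "\<exists>d\<in>cech_chains p 1. cech_vdiff p 0 d = c"
    then obtain d where d: "d \<in> cech_chains p 1" "cech_vdiff p 0 d = c" by blast
    have "singular_chain 1 (XX \<sigma>) (alt p (d \<sigma>)) \<and> chain_boundary 1 (alt p (d \<sigma>)) = c \<sigma>" for \<sigma>
      using cech_chainsD(1)[OF d(1)] fun_cong[OF d(2), of \<sigma>]
      by (auto simp: cech_vdiff_def chain_boundary_alt singular_chain_alt)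
    then show "\<forall>\<sigma>\<in>N p. \<exists>d. singular_chain 1 (XX \<sigma>) d \<and> chain_boundary 1 d = c \<sigma>" by blast
  qed
  finally show ?thesis .
qed

text \<open>The chain-level form of \<open>nerve_partial\<close>. Several simplices can have \<tau>
  as their face number l, so their entries have to be added.\<close>

definition face_sum :: "nat \<Rightarrow> nat \<Rightarrow> (nat set \<Rightarrow> 'a chain) \<Rightarrow> nat set \<Rightarrow> 'a chain" where
  "face_sum p l c \<tau> = (if \<tau> \<in> N p then \<Sum>\<sigma> | \<sigma> \<in> N (Suc p) \<and> nerve_face l \<sigma> = \<tau>. c \<sigma> else 0)"

lemma chain_face:
  assumes "c \<in> cech_chains (Suc p) 0" "nerve_face l \<sigma> = \<tau>"
  shows "singular_chain 0 (XX \<tau>) (c \<sigma>)"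
proof -
  have "\<tau> \<subseteq> \<sigma>" using assms(2) by (auto simp: nerve_face_def)
  then show ?thesis using cech_chainsD(1)[OF assms(1), of \<sigma>] unfolding singular_chain_XX by blast
qed

lemma face_sum_mem: "c \<in> cech_chains (Suc p) 0 \<Longrightarrow> face_sum p l c \<in> cech_chains p 0"
  unfolding cech_chains_def[of p] face_sum_def
  using chain_face by (auto intro!: singular_chain_sum)

text \<open>A homology class and its image under an inclusion are represented by the same
  chain.\<close>

lemma nerve_partial_to_nerve:
  assumes c: "c \<in> cech_chains (Suc p) 0"
  shows "nerve_partial X U k 0 p l (to_nerve (Suc p) c) = to_nerve p (face_sum p l c)"
  unfolding nerve_partial_def to_nerve_def[of p]
proof (rule restrict_ext)
  fix \<tau> assume \<tau>: "\<tau> \<in> N p"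
  let ?S = "{\<sigma> \<in> N (Suc p). nerve_face l \<sigma> = \<tau>}"
  interpret additive_hom "homology_group 0 (XX \<tau>)" "{c. singular_chain 0 (XX \<tau>) c}" "zeroth_class \<tau>"
    by (rule additive_hom_class)
  have step: "hom_induced 0 (XX \<sigma>) {} (XX \<tau>) {} id (to_nerve (Suc p) c \<sigma>) = zeroth_class \<tau> (c \<sigma>)"
    if \<sigma>: "\<sigma> \<in> ?S" for \<sigma>
  proof -
    have "\<tau> \<subseteq> \<sigma>" using \<sigma> by (auto simp: nerve_face_def)
    then have "continuous_map (XX \<sigma>) (XX \<tau>) id"
      by (auto simp: continuous_map_in_subtopology intro: continuous_map_from_subtopology)
    then have "hom_induced (int 0) (XX \<sigma>) {} (XX \<tau>) {} id (zeroth_class \<sigma> (c \<sigma>))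
        = zeroth_class \<tau> (chain_map 0 id (c \<sigma>))"
      using cech_chainsD(1)[OF c] by (intro hom_induced_chain_map) (auto simp: relcycle_0)
    also have "chain_map 0 id (c \<sigma>) = c \<sigma>"
      using cech_chainsD(1)[OF c] by (rule chain_map_ident)
    finally show ?thesis using \<sigma> by (simp add: to_nerve_def id_def)
  qed
  have "finprod (homology_group 0 (XX \<tau>)) (\<lambda>\<sigma>. hom_induced 0 (XX \<sigma>) {} (XX \<tau>) {} id (to_nerve (Suc p) c \<sigma>)) ?S
      = finprod (homology_group 0 (XX \<tau>)) (\<lambda>\<sigma>. zeroth_class \<tau> (c \<sigma>)) ?S"
    using step chain_face[OF c] closed by (intro finprod_cong') auto
  also have "\<dots> = zeroth_class \<tau> (sum c ?S)"
    using chain_face[OF c] finite_N by (intro finprod_eq_sum) auto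
  finally show "finprod (homology_group 0 (XX \<tau>)) (\<lambda>\<sigma>. hom_induced 0 (XX \<sigma>) {} (XX \<tau>) {} id (to_nerve (Suc p) c \<sigma>)) ?S
      = zeroth_class \<tau> (face_sum p l c \<tau>)"
    using \<tau> by (simp add: face_sum_def)
qed

text \<open>A pair of a simplex \<sigma> and a position l whose removal leaves \<tau> is the same as
  the removed index i: \<sigma> is \<open>insert i \<tau>\<close>, and l is the number of elements
  of \<tau> below i. Indices i for which \<open>insert i \<tau>\<close> is not in the nerve
  contribute 0 to \<open>cech_diff\<close>.\<close>

lemma sum_face_sum:
  assumes c: "c \<in> cech_chains (Suc p) 0"
  shows "(\<Sum>l\<in>{0..Suc p}. alt l (face_sum p l c)) = cech_diff k c"
proof
  fix \<tau>
  have alt_apply: "alt l f \<tau> = alt l (f \<tau>)" for l and f :: "nat set \<Rightarrow> 'a chain"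
    by (simp add: alt_def)
  have lhs: "(\<Sum>l\<in>{0..Suc p}. alt l (face_sum p l c)) \<tau> = (\<Sum>l\<in>{0..Suc p}. alt l (face_sum p l c \<tau>))"
    by (simp only: sum_apply alt_apply)
  show "(\<Sum>l\<in>{0..Suc p}. alt l (face_sum p l c)) \<tau> = cech_diff k c \<tau>"
  proof (cases "\<tau> \<in> N p")
    case False
    then show ?thesis
      unfolding lhs using cech_chainsD(2)[OF cech_diff_mem[OF c] False] by (simp add: face_sum_def)
  next
    case True
    then have \<tau>: "finite \<tau>" "card \<tau> = Suc p" "\<tau> \<subseteq> {1..k}"
      by (auto simp: nerve_simplices_def finite_subset)
    let ?S = "\<lambda>l. {\<sigma> \<in> N (Suc p). nerve_face l \<sigma> = \<tau>}"
    let ?J = "{i \<in> {1..k} - \<tau>. insert i \<tau> \<in> N (Suc p)}"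
    have "(\<Sum>l\<in>{0..Suc p}. alt l (face_sum p l c \<tau>)) = (\<Sum>l\<in>{0..Suc p}. \<Sum>\<sigma>\<in>?S l. alt l (c \<sigma>))"
      using True by (simp add: face_sum_def alt_sum)
    also have "\<dots> = (\<Sum>(l, \<sigma>)\<in>Sigma {0..Suc p} ?S. alt l (c \<sigma>))"
      using finite_N by (intro sum.Sigma) auto
    also have "\<dots> = (\<Sum>i\<in>?J. alt (card {j \<in> \<tau>. j < i}) (c (insert i \<tau>)))"
    proof (rule sum.reindex_bij_witness[where
          i = "\<lambda>i. (card {j \<in> \<tau>. j < i}, insert i \<tau>)" and j = "\<lambda>(l, \<sigma>). sorted_list_of_set \<sigma> ! l"])
      fix a assume a: "a \<in> Sigma {0..Suc p} ?S"
      then obtain l \<sigma> where ls: "a = (l, \<sigma>)" "l \<le> Suc p" "\<sigma> \<in> N (Suc p)" "nerve_face l \<sigma> = \<tau>" by auto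
      then have \<sigma>: "finite \<sigma>" "card \<sigma> = Suc (Suc p)" "\<sigma> \<subseteq> {1..k}"
        by (auto simp: nerve_simplices_def finite_subset)
      define i where "i = sorted_list_of_set \<sigma> ! l"
      have i: "i \<in> \<sigma>" "card {j \<in> \<sigma>. j < i} = l"
        using card_below_nth_sorted_list_of_set[of \<sigma> l] \<sigma> ls(2) by (auto simp: i_def)
      have t: "\<tau> = \<sigma> - {i}" using ls(4) by (simp add: nerve_face_def i_def)
      have "{j \<in> \<tau>. j < i} = {j \<in> \<sigma>. j < i}" unfolding t by auto
      then have l: "card {j \<in> \<tau>. j < i} = l" using i(2) by simp
      have ins: "insert i \<tau> = \<sigma>" using t i(1) by auto
      have ca: "(case a of (l, \<sigma>) \<Rightarrow> sorted_list_of_set \<sigma> ! l) = i" by (simp add: ls(1) i_def)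
      have "i \<in> {1..k} - \<tau>" using \<sigma>(3) i(1) t by blast
      then show "(case a of (l, \<sigma>) \<Rightarrow> sorted_list_of_set \<sigma> ! l) \<in> ?J"
        unfolding ca using ins ls(3) by simp
      show "(card {j \<in> \<tau>. j < (case a of (l, \<sigma>) \<Rightarrow> sorted_list_of_set \<sigma> ! l)},
            insert (case a of (l, \<sigma>) \<Rightarrow> sorted_list_of_set \<sigma> ! l) \<tau>) = a"
        unfolding ca l ins by (rule ls(1)[symmetric])
      show "alt (card {j \<in> \<tau>. j < (case a of (l, \<sigma>) \<Rightarrow> sorted_list_of_set \<sigma> ! l)})
            (c (insert (case a of (l, \<sigma>) \<Rightarrow> sorted_list_of_set \<sigma> ! l) \<tau>)) = (case a of (l, \<sigma>) \<Rightarrow> alt l (c \<sigma>))"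
        unfolding ca l ins by (simp add: ls(1))
    next
      fix i assume i: "i \<in> ?J"
      let ?\<sigma> = "insert i \<tau>" and ?l = "card {j \<in> \<tau>. j < i}"
      have "i \<in> set (sorted_list_of_set ?\<sigma>)" by (subst set_sorted_list_of_set) (use \<tau> in auto)
      then obtain l where l: "l < card ?\<sigma>" "sorted_list_of_set ?\<sigma> ! l = i"
        by (metis in_set_conv_nth sorted_list_of_set.length_sorted_key_list_of_set)
      have "{j \<in> ?\<sigma>. j < i} = {j \<in> \<tau>. j < i}" by auto
      then have "l = ?l"
        using card_below_nth_sorted_list_of_set(2)[of ?\<sigma> l] \<tau> l by simp
      then have nth: "sorted_list_of_set ?\<sigma> ! ?l = i" and "?l < card ?\<sigma>" using l by auto
      then show "(case (?l, ?\<sigma>) of (l, \<sigma>) \<Rightarrow> sorted_list_of_set \<sigma> ! l) = i" by simp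
      have "?l \<le> Suc p" using \<open>?l < card ?\<sigma>\<close> \<tau> i by simp
      then show "(?l, ?\<sigma>) \<in> Sigma {0..Suc p} ?S"
        using i nth by (auto simp: nerve_face_def)
    qed
    also have "\<dots> = cech_diff k c \<tau>"
      unfolding cech_diff_def using cech_chainsD(2)[OF c]
      by (intro sum.mono_neutral_left) (auto, metis alt_zero)
    finally show ?thesis unfolding lhs .
  qed
qed

lemma nerve_diff_to_nerve:
  assumes c: "c \<in> cech_chains (Suc p) 0"
  shows "nerve_diff X U k 0 p (to_nerve (Suc p) c) = to_nerve p (cech_diff k c)"
proof -
  interpret additive_hom "NC p" "cech_chains p 0" "to_nerve p" by (rule additive_hom_to_nerve)
  have m: "alt l (face_sum p l c) \<in> cech_chains p 0" for l
    using face_sum_mem[OF c] by (auto simp: alt_def uminus_mem)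
  have "nerve_diff X U k 0 p (to_nerve (Suc p) c)
      = finprod (NC p) (\<lambda>l. to_nerve p (alt l (face_sum p l c))) {0..Suc p}"
    unfolding nerve_diff_def nerve_partial_to_nerve[OF c]
    using m closed by (intro finprod_cong') (auto simp: pow_sign face_sum_mem[OF c] alt_def)
  also have "\<dots> = to_nerve p (\<Sum>l\<in>{0..Suc p}. alt l (face_sum p l c))"
    by (rule finprod_eq_sum) (use m in auto)
  finally show ?thesis by (simp only: sum_face_sum[OF c])
qed

lemma nerve_diff_hom: "nerve_diff X U k 0 p \<in> hom (NC (Suc p)) (NC p)"
proof (rule homI)
  fix x y assume "x \<in> carrier (NC (Suc p))" "y \<in> carrier (NC (Suc p))"
  then obtain c d where c: "c \<in> cech_chains (Suc p) 0" "x = to_nerve (Suc p) c"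
    and d: "d \<in> cech_chains (Suc p) 0" "y = to_nerve (Suc p) d"
    unfolding to_nerve_surj[symmetric] by blast
  show "nerve_diff X U k 0 p x \<in> carrier (NC p)"
    using c to_nerve_surj[of p] cech_diff_mem by (auto simp: nerve_diff_to_nerve)
  have "x \<otimes>\<^bsub>NC (Suc p)\<^esub> y = to_nerve (Suc p) (c + d)"
    using additive_hom.add[OF additive_hom_to_nerve c(1) d(1)] c(2) d(2) by simp
  then show "nerve_diff X U k 0 p (x \<otimes>\<^bsub>NC (Suc p)\<^esub> y)
      = nerve_diff X U k 0 p x \<otimes>\<^bsub>NC p\<^esub> nerve_diff X U k 0 p y"
    using c d additive_hom.add[OF additive_hom_to_nerve cech_diff_mem[OF c(1)] cech_diff_mem[OF d(1)]]
    by (simp add: nerve_diff_to_nerve rows.add_mem rows.dh_add)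
qed

lemma group_NC: "group (NC p)"
  using comm_group_NC comm_group.axioms(2) by blast

lemma group_hom_nerve_diff: "group_hom (NC (Suc p)) (NC p) (nerve_diff X U k 0 p)"
  using nerve_diff_hom group_NC by (simp add: group_hom_def group_hom_axioms_def)

lemma subgroup_nerve_cycles: "subgroup (nerve_cycles X U k 0 p) (NC p)"
  using group_hom.subgroup_kernel[OF group_hom_nerve_diff] group.subgroup_self[OF group_NC]
  by (cases p) (simp_all add: nerve_cycles_def)

text \<open>A cycle of the nerve complex is represented by a chain whose Cech differential is a
  vertical boundary, not 0. This is exactly the condition under which the chain is the last
  component of a total cycle.\<close>

lemma to_nerve_mem_cycles_iff:
  assumes "c \<in> cech_chains n 0"
  shows "to_nerve n c \<in> nerve_cycles X U k 0 n \<longleftrightarrow>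
    (\<forall>m. n = Suc m \<longrightarrow> (\<exists>y\<in>cech_chains m 1. cech_vdiff m 0 y = cech_diff k c))"
proof (cases n)
  case 0
  then show ?thesis using to_nerve_surj[of 0] assms by (auto simp: nerve_cycles_def)
next
  case (Suc m)
  then show ?thesis
    using to_nerve_surj[of n] assms
    by (auto simp: nerve_cycles_def kernel_def nerve_diff_to_nerve to_nerve_eq_one_iff cech_diff_mem)
qed

abbreviation cycle_group :: "nat \<Rightarrow> (nat set \<Rightarrow> 'a chain set) monoid" where
  "cycle_group n \<equiv> subgroup_generated (NC n) (nerve_cycles X U k 0 n)"

abbreviation nerve_boundaries :: "nat \<Rightarrow> (nat set \<Rightarrow> 'a chain set) set" where
  "nerve_boundaries n \<equiv> nerve_diff X U k 0 n ` carrier (NC (Suc n))"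

lemma carrier_cycle_group: "carrier (cycle_group n) = nerve_cycles X U k 0 n"
  using subgroup.carrier_subgroup_generated_subgroup[OF subgroup_nerve_cycles] .

lemma nerve_boundaries_eq: "nerve_boundaries n = (\<lambda>b. to_nerve n (cech_diff k b)) ` cech_chains (Suc n) 0"
  unfolding to_nerve_surj[symmetric] image_image by (intro image_cong refl nerve_diff_to_nerve)

lemma normal_nerve_boundaries: "nerve_boundaries n \<lhd> cycle_group n"
proof -
  have "nerve_boundaries n \<subseteq> nerve_cycles X U k 0 n"
    unfolding nerve_boundaries_eq
    by (auto simp: to_nerve_mem_cycles_iff cech_diff_mem cech_diff_cech_diff
        intro!: bexI[of _ 0] cech_chains_zero)
  then have "subgroup (nerve_boundaries n) (cycle_group n)"
    using group_hom.img_is_subgroup[OF group_hom_nerve_diff[of n]] group_NC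
    by (intro group.subgroup_of_subgroup_generated) auto
  moreover have "comm_group (cycle_group n)"
    using group.abelian_subgroup_generated[OF group_NC comm_group_NC] .
  ultimately show ?thesis by (simp add: comm_group.normal_iff_subgroup)
qed

text \<open>The edge map at q = 0: the last component of x consists of 0-chains, and their classes
  form a cycle of the nerve complex.\<close>

definition to_nerve_homology :: "nat \<Rightarrow> (nat \<Rightarrow> nat set \<Rightarrow> 'a chain) \<Rightarrow> (nat set \<Rightarrow> 'a chain set) set" where
  "to_nerve_homology n x = nerve_boundaries n #>\<^bsub>cycle_group n\<^esub> to_nerve n (x n)"

lemma to_nerve_tot_cycle:
  assumes "x \<in> rows.tot_cycles n"
  shows "to_nerve n (x n) \<in> nerve_cycles X U k 0 n"
proof -
  have "\<exists>y\<in>cech_chains m 1. cech_vdiff m 0 y = cech_diff k (x n)" if n: "n = Suc m" for m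
  proof (rule bexI[of _ "- x m"])
    have *: "x m \<in> cech_chains m 1" "cech_vdiff m 0 (x m) + cech_diff k (x n) = 0"
      using tot_cyclesD(3)[OF assms, of m 0] n by auto
    then show "- x m \<in> cech_chains m 1" using rows.uminus_mem by blast
    show "cech_vdiff m 0 (- x m) = cech_diff k (x n)"
      using *(2) by (simp add: rows.dv_uminus eq_neg_iff_add_eq_0 neg_eq_iff_add_eq_0)
  qed
  then show ?thesis using to_nerve_mem_cycles_iff[OF tot_cyclesD(2)[OF assms]] by blast
qed

lemma to_nerve_homology_hom: "to_nerve_homology n \<in> hom (tot_group n) (nerve_homology X U k 0 n)"
proof -
  have "(\<lambda>x. to_nerve n (x n)) \<in> hom (tot_group n) (cycle_group n)"
  proof (rule homI)
    fix x y assume xy: "x \<in> carrier (tot_group n)" "y \<in> carrier (tot_group n)"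
    then show "to_nerve n (x n) \<in> carrier (cycle_group n)"
      by (simp add: carrier_cycle_group tot_group_def to_nerve_tot_cycle)
    show "to_nerve n ((x \<otimes>\<^bsub>tot_group n\<^esub> y) n) = to_nerve n (x n) \<otimes>\<^bsub>cycle_group n\<^esub> to_nerve n (y n)"
      using additive_hom.add[OF additive_hom_to_nerve, of "x n" n "y n"] xy tot_cyclesD(2)
      by (simp add: tot_group_def)
  qed
  from Group.hom_compose[OF this normal.r_coset_hom_Mod[OF normal_nerve_boundaries]]
  show ?thesis by (simp add: nerve_homology_def to_nerve_homology_def[abs_def] o_def)
qed

lemma to_nerve_homology_surj: "to_nerve_homology n ` carrier (tot_group n) = carrier (nerve_homology X U k 0 n)"
proof (intro equalityI subsetI)
  fix z assume "z \<in> to_nerve_homology n ` carrier (tot_group n)"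
  then show "z \<in> carrier (nerve_homology X U k 0 n)" using to_nerve_homology_hom by (auto simp: hom_def)
next
  fix z assume "z \<in> carrier (nerve_homology X U k 0 n)"
  then obtain w where w: "w \<in> nerve_cycles X U k 0 n" "z = nerve_boundaries n #>\<^bsub>cycle_group n\<^esub> w"
    by (auto simp: nerve_homology_def carrier_FactGroup carrier_cycle_group)
  then have "w \<in> carrier (NC n)" using subgroup.subset[OF subgroup_nerve_cycles] by blast
  then obtain a where a: "a \<in> cech_chains n 0" "w = to_nerve n a"
    unfolding to_nerve_surj[symmetric] by blast
  then obtain x where "x \<in> rows.tot_cycles n" "x n = a"
    using tot_cycle_ending[OF a(1)] w(1) to_nerve_mem_cycles_iff[OF a(1)] by blast
  then show "z \<in> to_nerve_homology n ` carrier (tot_group n)"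
    using a w(2) by (auto simp: tot_group_def to_nerve_homology_def)
qed

text \<open>The class is trivial if and only if x n is a vertical boundary plus a Cech boundary, and
  the last component alone decides whether x bounds.\<close>

lemma to_nerve_homology_kernel:
  "kernel (tot_group n) (nerve_homology X U k 0 n) (to_nerve_homology n) = rows.tot_cycles n \<inter> rows.tot_boundaries n"
proof -
  have grp: "group (cycle_group n)" using group_NC by (simp add: group.group_subgroup_generated)
  have sub: "subgroup (nerve_boundaries n) (cycle_group n)"
    using normal_nerve_boundaries normal_imp_subgroup by blast
  have "to_nerve_homology n x = \<one>\<^bsub>nerve_homology X U k 0 n\<^esub> \<longleftrightarrow> x \<in> rows.tot_boundaries n"
    if x: "x \<in> rows.tot_cycles n" for x
  proof -
    note xn = tot_cyclesD(2)[OF x]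
    have "to_nerve_homology n x = \<one>\<^bsub>nerve_homology X U k 0 n\<^esub> \<longleftrightarrow> to_nerve n (x n) \<in> nerve_boundaries n"
    proof -
      have w: "to_nerve n (x n) \<in> carrier (cycle_group n)"
        using to_nerve_tot_cycle[OF x] by (simp add: carrier_cycle_group)
      show ?thesis
        unfolding nerve_homology_def one_FactGroup to_nerve_homology_def
        using group.coset_join1[OF grp _ w sub] group.coset_join2[OF grp w sub] subgroup.subset[OF sub]
        by blast
    qed
    also have "\<dots> \<longleftrightarrow> (\<exists>b\<in>cech_chains (Suc n) 0. to_nerve n (x n - cech_diff k b) = \<one>\<^bsub>NC n\<^esub>)"
    proof -
      interpret additive_hom "NC n" "cech_chains n 0" "to_nerve n" by (rule additive_hom_to_nerve)
      have "to_nerve n (x n) = to_nerve n (cech_diff k b) \<longleftrightarrow> to_nerve n (x n - cech_diff k b) = \<one>\<^bsub>NC n\<^esub>"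
        if b: "b \<in> cech_chains (Suc n) 0" for b
      proof -
        note db = cech_diff_mem[OF b]
        have "to_nerve n (x n) = to_nerve n (x n - cech_diff k b) \<otimes>\<^bsub>NC n\<^esub> to_nerve n (cech_diff k b)"
          using add[OF cech_chains_diff[OF xn db] db] by simp
        then show ?thesis
          using closed[OF db] closed[OF cech_chains_diff[OF xn db]] by (simp only: r_cancel_one)
      qed
      then show ?thesis unfolding nerve_boundaries_eq by blast
    qed
    also have "\<dots> \<longleftrightarrow> (\<exists>b\<in>cech_chains (Suc n) 0. \<exists>a\<in>cech_chains n 1. cech_vdiff n 0 a = x n - cech_diff k b)"
      using xn by (auto simp: to_nerve_eq_one_iff cech_chains_diff cech_diff_mem)
    also have "\<dots> \<longleftrightarrow> x \<in> rows.tot_boundaries n"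
    proof
      assume "\<exists>b\<in>cech_chains (Suc n) 0. \<exists>a\<in>cech_chains n 1. cech_vdiff n 0 a = x n - cech_diff k b"
      then obtain a b where "b \<in> cech_chains (Suc n) 0" "a \<in> cech_chains n 1" "cech_vdiff n 0 a = x n - cech_diff k b"
        by blast
      then show "x \<in> rows.tot_boundaries n"
        by (intro tot_boundaries_lastI[OF x, of a b]) simp_all
    next
      assume "x \<in> rows.tot_boundaries n"
      then obtain y where y: "\<forall>p q. p + q = n \<longrightarrow> y p \<in> cech_chains p (Suc q) \<and> y (Suc p) \<in> cech_chains (Suc p) q \<and>
        x p = cech_vdiff p q (y p) + cech_diff k (y (Suc p))"
        by (rule tot_boundariesE)
      from y[rule_format, of n 0] show "\<exists>b\<in>cech_chains (Suc n) 0. \<exists>a\<in>cech_chains n 1. cech_vdiff n 0 a = x n - cech_diff k b"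
        by (intro bexI[of _ "y (Suc n)"] bexI[of _ "y n"]) auto
    qed
    finally show ?thesis .
  qed
  then show ?thesis by (auto simp: kernel_def tot_group_def)
qed

theorem homology_iso_nerve_homology: "homology_group (int n) X \<cong> nerve_homology X U k 0 n"
proof -
  have "group (nerve_homology X U k 0 n)"
    unfolding nerve_homology_def using normal_nerve_boundaries by (rule normal.factorgroup_is_group)
  moreover have "kernel (tot_group n) (homology_group (int n) X) (to_space n)
      = kernel (tot_group n) (nerve_homology X U k 0 n) (to_nerve_homology n)"
    by (simp only: to_space_kernel to_nerve_homology_kernel)
  ultimately show ?thesis
    using iso_of_common_kernel[OF group_tot_group group_relative_homology_group _ to_space_hom
        to_nerve_homology_hom to_space_surj to_nerve_homology_surj] by blast
qed

end

section \<open>Real spectra are homotopy equivalent to finite sets\<close>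

text \<open>Vectors with coordinates in S are extended by 0. Since 0 powr t = 0 for all t, taking powers
  preserves supports, also for negative exponents.\<close>

definition power_closed :: "'s set \<Rightarrow> ('s \<Rightarrow> real) set \<Rightarrow> bool" where
  "power_closed S Y \<longleftrightarrow> closed Y \<and> (\<forall>\<phi>\<in>Y. \<forall>x. x \<notin> S \<longrightarrow> \<phi> x = 0) \<and>
     (\<forall>\<phi>\<in>Y. \<forall>\<psi>\<in>Y. (\<lambda>x. \<phi> x * \<psi> x) \<in> Y) \<and> (\<forall>\<phi>\<in>Y. \<forall>t. (\<lambda>x. \<bar>\<phi> x\<bar> powr t) \<in> Y)"

text \<open>Clear the coordinates in G one at a time by Gaussian elimination: as they are bounded, this
  changes the coordinates in H by a bounded amount only.\<close>

lemma eliminate_bounded_coordinates: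
  fixes W :: "('s \<Rightarrow> real) set"
  assumes "finite G" "finite H"
    and "\<And>v w. v \<in> W \<Longrightarrow> w \<in> W \<Longrightarrow> (\<lambda>x. v x + w x) \<in> W" and "\<And>v t. v \<in> W \<Longrightarrow> (\<lambda>x. t * v x) \<in> W"
    and "\<And>B. \<exists>w\<in>W. (\<forall>x\<in>G. \<bar>w x\<bar> \<le> C) \<and> (\<forall>x\<in>H. w x \<le> - B)"
  shows "\<exists>v\<in>W. (\<forall>x\<in>G. v x = 0) \<and> (\<forall>x\<in>H. v x < 0)"
  using assms
proof (induction G arbitrary: W C rule: finite_induct)
  case empty
  obtain w where w: "w \<in> W" "\<forall>x\<in>H. w x \<le> - 1" using empty(4)[of 1] by blast
  show ?case by (rule bexI[OF _ w(1)]) (use w(2) in force)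
next
  case (insert g G)
  show ?case
  proof (cases "\<forall>w\<in>W. w g = 0")
    case True
    have "\<exists>w\<in>W. (\<forall>x\<in>G. \<bar>w x\<bar> \<le> C) \<and> (\<forall>x\<in>H. w x \<le> - B)" for B using insert.prems(4)[of B] by blast
    then have "\<exists>v\<in>W. (\<forall>x\<in>G. v x = 0) \<and> (\<forall>x\<in>H. v x < 0)"
      by (intro insert.IH[OF insert.prems(1)] insert.prems(2,3)) auto
    then show ?thesis using True by auto
  next
    case False
    then obtain u0 where u0: "u0 \<in> W" "u0 g \<noteq> 0" by blast
    define u where "u = (\<lambda>x. (1 / u0 g) * u0 x)"
    have u: "u \<in> W" "u g = 1" using insert.prems(3)[OF u0(1), of "1 / u0 g"] u0(2) by (auto simp: u_def)
    define W' where "W' = {w \<in> W. w g = 0}"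
    define K where "K = (\<Sum>x\<in>G \<union> H. \<bar>u x\<bar>)"
    have K: "\<bar>u x\<bar> \<le> K" if "x \<in> G \<union> H" for x
      unfolding K_def using that insert.hyps insert.prems(1) by (intro member_le_sum) auto
    have "\<exists>v\<in>W'. (\<forall>x\<in>G. v x = 0) \<and> (\<forall>x\<in>H. v x < 0)"
    proof (rule insert.IH[OF insert.prems(1)])
      \<comment> \<open>Subtracting w g times u clears the coordinate g. The correction is at most C
        * K in absolute value; the demand w x \<le> - (B + C * K) on H absorbs it, and on G the
        bound grows to C + C * K.\<close>
      show "\<exists>w\<in>W'. (\<forall>x\<in>G. \<bar>w x\<bar> \<le> C + C * K) \<and> (\<forall>x\<in>H. w x \<le> - B)" for B
      proof -
        obtain w where w: "w \<in> W" "\<forall>x\<in>insert g G. \<bar>w x\<bar> \<le> C" "\<forall>x\<in>H. w x \<le> - (B + C * K)"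
          using insert.prems(4)[of "B + C * K"] by blast
        define v where "v = (\<lambda>x. w x + (- w g) * u x)"
        have "v \<in> W'"
          using insert.prems(2)[OF w(1) insert.prems(3)[OF u(1), of "- w g"]] u(2) by (simp add: v_def W'_def)
        moreover have bnd: "\<bar>(- w g) * u x\<bar> \<le> C * K" if "x \<in> G \<union> H" for x
          using w(2) K[OF that] unfolding abs_mult by (intro mult_mono) auto
        have "\<bar>v x\<bar> \<le> C + C * K" if "x \<in> G" for x
          using bnd[of x] w(2) that unfolding v_def by (intro order_trans[OF abs_triangle_ineq] add_mono) auto
        moreover have "v x \<le> - B" if "x \<in> H" for x
        proof -
          have "w x \<le> - (B + C * K)" "(- w g) * u x \<le> C * K" using bnd[of x] w(3) that by auto
          then show ?thesis by (simp add: v_def)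
        qed
        ultimately show ?thesis by blast
      qed
    qed (use insert.prems(2,3) in \<open>auto simp: W'_def\<close>)
    then show ?thesis by (auto simp: W'_def)
  qed
qed

lemma homotopic_with_canonI:
  fixes h :: "real \<times> 'a::topological_space \<Rightarrow> 'b::topological_space"
  assumes "continuous_on ({0..1} \<times> A) h" "h ` ({0..1} \<times> A) \<subseteq> B"
    and "\<And>x. x \<in> A \<Longrightarrow> h (0, x) = f x" "\<And>x. x \<in> A \<Longrightarrow> h (1, x) = g x"
  shows "homotopic_with_canon (\<lambda>_. True) A B f g"
proof -
  have "continuous_map (prod_topology (top_of_set {0..1}) (top_of_set A)) (top_of_set B) h"
    unfolding subtopology_Times[symmetric] prod_topology_euclidean using assms(1,2) by auto
  then show ?thesis using assms(3,4) by (subst homotopic_with) auto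
qed

lemma homotopic_with_canonE:
  fixes f g :: "'a::topological_space \<Rightarrow> 'b::topological_space"
  assumes "homotopic_with_canon (\<lambda>_. True) A B f g"
  obtains h :: "real \<times> 'a \<Rightarrow> 'b" where "continuous_on ({0..1} \<times> A) h" "h ` ({0..1} \<times> A) \<subseteq> B"
    "\<forall>x\<in>A. h (0, x) = f x" "\<forall>x\<in>A. h (1, x) = g x"
proof -
  obtain h where h: "continuous_map (prod_topology (top_of_set {0..1::real}) (top_of_set A)) (top_of_set B) h"
    "\<forall>x\<in>A. h (0, x) = f x" "\<forall>x\<in>A. h (1, x) = g x"
    using assms by (subst (asm) homotopic_with) auto
  from h(1) have "continuous_on ({0..1} \<times> A) h" "h ` ({0..1} \<times> A) \<subseteq> B"
    unfolding subtopology_Times[symmetric] prod_topology_euclidean by auto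
  then show ?thesis using h(2,3) that by blast
qed

lemma continuous_on_Min:
  fixes f :: "'i \<Rightarrow> 'a::topological_space \<Rightarrow> real"
  assumes "finite I" "I \<noteq> {}" "\<And>i. i \<in> I \<Longrightarrow> continuous_on A (f i)"
  shows "continuous_on A (\<lambda>x. Min ((\<lambda>i. f i x) ` I))"
  using assms
proof (induction I rule: finite_ne_induct)
  case (insert i I)
  then have "continuous_on A (\<lambda>x. min (f i x) (Min ((\<lambda>i. f i x) ` I)))"
    by (intro continuous_on_min) auto
  then show ?case using insert.hyps by simp
qed simp

section \<open>The stratum of a maximal support\<close>

locale top_stratum =
  fixes S :: "'s set" and Y :: "('s \<Rightarrow> real) set" and F :: "'s set"
  assumes finite_S: "finite S" and Y: "power_closed S Y" and F_subset: "F \<subseteq> S"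
    and maximal: "\<And>\<phi>. \<phi> \<in> Y \<Longrightarrow> \<forall>x\<in>F. \<phi> x \<noteq> 0 \<Longrightarrow> \<forall>x. x \<notin> F \<longrightarrow> \<phi> x = 0"
begin

definition V :: "('s \<Rightarrow> real) set" where "V = {\<phi> \<in> Y. \<forall>x\<in>F. \<phi> x \<noteq> 0}"
definition Z :: "('s \<Rightarrow> real) set" where "Z = {\<phi> \<in> Y. \<exists>x\<in>F. \<phi> x = 0}"

text \<open>Logarithmic coordinates on the positive points with support F. Products and real powers
  of points become sums and multiples in W; values outside F are irrelevant.\<close>

definition ex :: "('s \<Rightarrow> real) \<Rightarrow> 's \<Rightarrow> real" where "ex v = (\<lambda>x. if x \<in> F then exp (v x) else 0)"
definition W :: "('s \<Rightarrow> real) set" where "W = {v. ex v \<in> Y}"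

text \<open>G belongs to J if some direction v in W fixes the coordinates in G and shrinks the
  others in F to 0 along exp (t v). These are the supports of the limits of one-parameter subgroups,
  as for the faces of a cone.\<close>

definition J :: "'s set set" where
  "J = {G. G \<subset> F \<and> (\<exists>v\<in>W. (\<forall>x\<in>G. v x = 0) \<and> (\<forall>x\<in>F - G. v x < 0))}"

lemma finite_F: "finite F"
  using F_subset finite_S finite_subset by blast

lemma finite_J: "finite J"
  by (rule finite_subset[of _ "Pow F"]) (auto simp: J_def finite_F)

lemma Y_mult: "\<phi> \<in> Y \<Longrightarrow> \<psi> \<in> Y \<Longrightarrow> (\<lambda>x. \<phi> x * \<psi> x) \<in> Y"
  and Y_powr: "\<phi> \<in> Y \<Longrightarrow> (\<lambda>x. \<bar>\<phi> x\<bar> powr t) \<in> Y" and closed_Y: "closed Y"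
  using Y by (auto simp: power_closed_def)

lemma V_zero: "\<phi> \<in> V \<Longrightarrow> x \<notin> F \<Longrightarrow> \<phi> x = 0"
  using maximal by (auto simp: V_def)

lemma W_add: "v \<in> W \<Longrightarrow> w \<in> W \<Longrightarrow> (\<lambda>x. v x + w x) \<in> W"
proof -
  assume "v \<in> W" "w \<in> W"
  then have "(\<lambda>x. ex v x * ex w x) \<in> Y" by (intro Y_mult) (auto simp: W_def)
  also have "(\<lambda>x. ex v x * ex w x) = ex (\<lambda>x. v x + w x)" by (auto simp: ex_def exp_add)
  finally show ?thesis by (simp add: W_def)
qed

lemma W_scale: "v \<in> W \<Longrightarrow> (\<lambda>x. t * v x) \<in> W"
proof -
  assume "v \<in> W"
  then have "(\<lambda>x. \<bar>ex v x\<bar> powr t) \<in> Y" by (intro Y_powr) (auto simp: W_def)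
  also have "(\<lambda>x. \<bar>ex v x\<bar> powr t) = ex (\<lambda>x. t * v x)" by (auto simp: ex_def powr_def)
  finally show ?thesis by (simp add: W_def)
qed

lemma log_mem_W: "\<phi> \<in> V \<Longrightarrow> (\<lambda>x. ln \<bar>\<phi> x\<bar>) \<in> W"
proof -
  assume "\<phi> \<in> V"
  then have "(\<lambda>x. \<bar>\<phi> x\<bar> powr 1) \<in> Y" by (intro Y_powr) (auto simp: V_def)
  also have "(\<lambda>x. \<bar>\<phi> x\<bar> powr 1) = ex (\<lambda>x. ln \<bar>\<phi> x\<bar>)"
    using \<open>\<phi> \<in> V\<close> V_zero[OF \<open>\<phi> \<in> V\<close>] by (auto simp: ex_def V_def)
  finally show ?thesis by (simp add: W_def)
qed

lemma closed_Z: "closed Z"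
proof -
  have "closed {\<phi> :: 's \<Rightarrow> real. \<phi> x = 0}" for x
    by (intro closed_Collect_eq continuous_on_const continuous_on_product_coordinates)
  then have "closed (Y \<inter> (\<Union>x\<in>F. {\<phi>. \<phi> x = 0}))"
    using closed_Y finite_F by (intro closed_Int closed_UN) auto
  also have "Y \<inter> (\<Union>x\<in>F. {\<phi>. \<phi> x = 0}) = Z" by (auto simp: Z_def)
  finally show ?thesis .
qed

lemma power_closed_Z: "power_closed S Z"
  unfolding power_closed_def
proof (intro conjI ballI allI impI)
  fix \<phi> \<psi> assume "\<phi> \<in> Z" "\<psi> \<in> Z"
  then show "(\<lambda>x. \<phi> x * \<psi> x) \<in> Z" using Y_mult by (auto simp: Z_def)
next
  fix \<phi> t assume "\<phi> \<in> Z"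
  then show "(\<lambda>x. \<bar>\<phi> x\<bar> powr t) \<in> Z" using Y_powr by (auto simp: Z_def)
next
  fix \<phi> x assume "\<phi> \<in> Z" "x \<notin> S"
  then show "\<phi> x = 0" using Y by (auto simp: Z_def power_closed_def)
qed (rule closed_Z)

lemma V_subset: "V \<subseteq> Y" and Z_subset: "Z \<subseteq> Y" and Y_eq: "Y = V \<union> Z" and V_Z: "V \<inter> Z = {}"
  by (auto simp: V_def Z_def)

lemma closure_V_subset: "closure V \<subseteq> Y"
  using closed_Y V_subset by (simp add: closure_minimal)

lemma closure_V_zero: "\<phi> \<in> closure V \<Longrightarrow> x \<notin> F \<Longrightarrow> \<phi> x = 0"
proof -
  assume *: "\<phi> \<in> closure V" "x \<notin> F"
  have "closure V \<subseteq> {\<phi>. \<phi> x = 0}"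
    using V_zero *(2) by (intro closure_minimal closed_Collect_eq) auto
  then show ?thesis using * by blast
qed

lemma tendsto_coordinate: "((\<lambda>\<phi>. \<phi> x) \<longlongrightarrow> \<phi>0 x) (at (\<phi>0 :: 's \<Rightarrow> real) within A)"
proof -
  have "((\<lambda>\<phi>. \<phi> x) \<longlongrightarrow> \<phi>0 x) (at \<phi>0 within UNIV)"
    using continuous_on_product_coordinates[of x] unfolding continuous_on_def by blast
  then show ?thesis by (rule tendsto_within_subset) simp
qed

text \<open>Near the limit the logarithms of points of V are bounded on its support and arbitrarily
  negative on the rest of F. Elimination turns such vectors into one that vanishes on the support
  and is negative on the rest.\<close>

lemma limit_support_mem_J:
  assumes "\<phi>0 \<in> closure V" "\<phi>0 \<in> Z"
  shows "{x \<in> F. \<phi>0 x \<noteq> 0} \<in> J"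
proof -
  let ?G = "{x \<in> F. \<phi>0 x \<noteq> 0}"
  \<comment> \<open>The point is in the closure of V but, lying in Z, not in V itself, so it is a
    genuine limit point.\<close>
  have nt: "at \<phi>0 within V \<noteq> bot"
    using assms V_Z by (auto simp: closure_def trivial_limit_within)
  \<comment> \<open>The summand 1 leaves room for points whose logarithms are within distance 1 of
    those of the limit.\<close>
  define C where "C = (\<Sum>x\<in>?G. \<bar>ln \<bar>\<phi>0 x\<bar>\<bar>) + 1"
  have "\<exists>v\<in>W. (\<forall>x\<in>?G. v x = 0) \<and> (\<forall>x\<in>F - ?G. v x < 0)"
  proof (rule eliminate_bounded_coordinates)
    show "\<exists>w\<in>W. (\<forall>x\<in>?G. \<bar>w x\<bar> \<le> C) \<and> (\<forall>x\<in>F - ?G. w x \<le> - B)" for B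
    proof -
      have "\<forall>\<^sub>F \<phi> in at \<phi>0 within V. \<bar>ln \<bar>\<phi> x\<bar>\<bar> \<le> C" if "x \<in> ?G" for x
      proof -
        have "((\<lambda>\<phi>. ln \<bar>\<phi> x\<bar>) \<longlongrightarrow> ln \<bar>\<phi>0 x\<bar>) (at \<phi>0 within V)"
          using that by (intro tendsto_ln tendsto_rabs tendsto_coordinate) auto
        then have "\<forall>\<^sub>F \<phi> in at \<phi>0 within V. dist (ln \<bar>\<phi> x\<bar>) (ln \<bar>\<phi>0 x\<bar>) < 1"
          by (rule tendstoD) simp
        moreover have "\<bar>ln \<bar>\<phi>0 x\<bar>\<bar> \<le> C - 1"
          unfolding C_def using that finite_F member_le_sum[of x ?G "\<lambda>x. \<bar>ln \<bar>\<phi>0 x\<bar>\<bar>"] by auto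
        ultimately show ?thesis
          by (elim eventually_mono) (auto simp: dist_real_def)
      qed
      then have 1: "\<forall>\<^sub>F \<phi> in at \<phi>0 within V. \<forall>x\<in>?G. \<bar>ln \<bar>\<phi> x\<bar>\<bar> \<le> C"
        using finite_F by (intro eventually_ball_finite) auto
      have "\<forall>\<^sub>F \<phi> in at \<phi>0 within V. \<bar>\<phi> x\<bar> < exp (- B)" if "x \<in> F - ?G" for x
      proof -
        have "((\<lambda>\<phi>. \<bar>\<phi> x\<bar>) \<longlongrightarrow> \<bar>\<phi>0 x\<bar>) (at \<phi>0 within V)"
          by (intro tendsto_rabs tendsto_coordinate)
        then show ?thesis using that by (intro order_tendstoD(2)) auto
      qed
      then have 2: "\<forall>\<^sub>F \<phi> in at \<phi>0 within V. \<forall>x\<in>F - ?G. \<bar>\<phi> x\<bar> < exp (- B)"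
        using finite_F by (intro eventually_ball_finite) auto
      have 3: "\<forall>\<^sub>F \<phi> in at \<phi>0 within V. \<phi> \<in> V"
        by (simp add: eventually_at_topological exI[of _ UNIV])
      obtain \<phi> where \<phi>: "\<forall>x\<in>?G. \<bar>ln \<bar>\<phi> x\<bar>\<bar> \<le> C" "\<forall>x\<in>F - ?G. \<bar>\<phi> x\<bar> < exp (- B)" "\<phi> \<in> V"
        using eventually_happens'[OF nt eventually_conj[OF 1 eventually_conj[OF 2 3]]] by blast
      have "\<forall>x\<in>F - ?G. ln \<bar>\<phi> x\<bar> \<le> - B"
      proof
        fix x assume that: "x \<in> F - ?G"
        have "0 < \<bar>\<phi> x\<bar>" "\<bar>\<phi> x\<bar> \<le> exp (- B)" using that \<phi>(2,3) by (auto simp: V_def less_imp_le)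
        then have "ln \<bar>\<phi> x\<bar> \<le> ln (exp (- B))" by (subst ln_le_cancel_iff) auto
        then show "ln \<bar>\<phi> x\<bar> \<le> - B" by simp
      qed
      then show ?thesis using \<phi>(1) by (intro bexI[OF _ log_mem_W[OF \<phi>(3)]]) simp
    qed
  qed (use finite_F W_add W_scale in auto)
  moreover have "?G \<subset> F" using assms(2) by (auto simp: Z_def)
  ultimately show ?thesis by (simp add: J_def)
qed

definition weight :: "'s set \<Rightarrow> 's \<Rightarrow> real" where
  "weight G = (SOME v. v \<in> W \<and> (\<forall>x\<in>G. v x = 0) \<and> (\<forall>x\<in>F - G. v x < 0))"

lemma weight:
  assumes "G \<in> J"
  shows "weight G \<in> W" "x \<in> G \<Longrightarrow> weight G x = 0" "x \<in> F - G \<Longrightarrow> weight G x < 0"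
proof -
  have "\<exists>v. v \<in> W \<and> (\<forall>x\<in>G. v x = 0) \<and> (\<forall>x\<in>F - G. v x < 0)" using assms by (auto simp: J_def)
  from someI_ex[OF this] show "weight G \<in> W" "x \<in> G \<Longrightarrow> weight G x = 0" "x \<in> F - G \<Longrightarrow> weight G x < 0"
    by (auto simp: weight_def)
qed

text \<open>Points of V are moved along the one-parameter subgroups of the weights. Near a point of Z with
  support G' the ratio of least_size to size_off G tends to 0 for all G not containing G', so nonzero
  coordinates are not moved in the limit. The ratio is 1 for some G, so at t = 1 some coordinate of
  the image vanishes.\<close>

definition size_off :: "'s set \<Rightarrow> ('s \<Rightarrow> real) \<Rightarrow> real" where
  "size_off G \<phi> = (\<Sum>x\<in>F - G. \<bar>\<phi> x\<bar>)"

definition least_size :: "('s \<Rightarrow> real) \<Rightarrow> real" where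
  "least_size \<phi> = Min ((\<lambda>G. size_off G \<phi>) ` J)"

text \<open>For a positive base the factor is exp (- ln base * \<open>weight G x\<close>): the flow
  of the weight at time - ln base, and base 0 stands for infinite time. Division by 0 gives 0, so
  the base is 1 when \<open>size_off G \<phi>\<close> is 0. The case x \<in> G is separate because 0
  powr 0 is 0 here, whereas such coordinates must stay fixed.\<close>

definition damping :: "'s \<Rightarrow> real \<times> ('s \<Rightarrow> real) \<Rightarrow> real" where
  "damping x = (\<lambda>(t, \<phi>). \<Prod>G\<in>J. if x \<in> G then 1 else (1 - t * (least_size \<phi> / size_off G \<phi>)) powr (- weight G x))"

definition push :: "real \<times> ('s \<Rightarrow> real) \<Rightarrow> 's \<Rightarrow> real" where
  "push p = (\<lambda>x. snd p x * damping x p)"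

lemma size_off_nonneg: "0 \<le> size_off G \<phi>"
  by (simp add: size_off_def sum_nonneg)

lemma size_off_ge: "x \<in> F - G \<Longrightarrow> \<bar>\<phi> x\<bar> \<le> size_off G \<phi>"
  unfolding size_off_def using finite_F by (intro member_le_sum) auto

lemma least_size_le: "G \<in> J \<Longrightarrow> least_size \<phi> \<le> size_off G \<phi>"
  unfolding least_size_def using finite_J by (intro Min_le) auto

lemma least_size_nonneg: "J \<noteq> {} \<Longrightarrow> 0 \<le> least_size \<phi>"
  unfolding least_size_def using finite_J size_off_nonneg by (intro Min.boundedI) auto

lemma base_bounds:
  assumes "G \<in> J" "0 \<le> t" "t \<le> 1"
  shows "0 \<le> 1 - t * (least_size \<phi> / size_off G \<phi>)" "1 - t * (least_size \<phi> / size_off G \<phi>) \<le> 1"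
proof -
  have r: "0 \<le> least_size \<phi> / size_off G \<phi>" "least_size \<phi> / size_off G \<phi> \<le> 1"
    using least_size_nonneg[of \<phi>] size_off_nonneg[of G \<phi>] least_size_le[OF assms(1), of \<phi>] assms(1)
    by (auto simp: divide_le_eq_1 intro!: divide_nonneg_nonneg)
  then have "t * (least_size \<phi> / size_off G \<phi>) \<le> 1 * 1"
    using assms by (intro mult_mono) auto
  then show "0 \<le> 1 - t * (least_size \<phi> / size_off G \<phi>)" by simp
  show "1 - t * (least_size \<phi> / size_off G \<phi>) \<le> 1" using mult_nonneg_nonneg[OF assms(2) r(1)] by linarith
qed

lemma damping_bounds:
  assumes "x \<in> F" "0 \<le> t" "t \<le> 1"
  shows "0 \<le> damping x (t, \<phi>)" "damping x (t, \<phi>) \<le> 1"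
proof -
  have "0 \<le> (if x \<in> G then 1 else (1 - t * (least_size \<phi> / size_off G \<phi>)) powr (- weight G x))"
    "(if x \<in> G then 1 else (1 - t * (least_size \<phi> / size_off G \<phi>)) powr (- weight G x)) \<le> 1" if "G \<in> J" for G
  proof -
    show "(if x \<in> G then 1 else (1 - t * (least_size \<phi> / size_off G \<phi>)) powr (- weight G x)) \<le> 1"
      using weight(3)[OF that, of x] base_bounds[OF that assms(2,3), of \<phi>] assms(1)
        powr_mono2[of "- weight G x" "1 - t * (least_size \<phi> / size_off G \<phi>)" 1] by auto
  qed auto
  then show "0 \<le> damping x (t, \<phi>)" "damping x (t, \<phi>) \<le> 1"
    unfolding damping_def by (auto intro!: prod_nonneg prod_le_1)
qed

lemma continuous_on_coordinate_snd: "continuous_on A (\<lambda>p :: real \<times> ('s \<Rightarrow> real). snd p x)"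
  by (rule continuous_on_compose2[OF continuous_on_product_coordinates continuous_on_snd]) auto

lemma continuous_size_off: "continuous_on A (\<lambda>p :: real \<times> ('s \<Rightarrow> real). size_off G (snd p))"
  unfolding size_off_def
  by (intro continuous_on_sum continuous_on_rabs continuous_on_coordinate_snd)

lemma continuous_least_size: "J \<noteq> {} \<Longrightarrow> continuous_on A (\<lambda>p :: real \<times> ('s \<Rightarrow> real). least_size (snd p))"
  unfolding least_size_def using finite_J by (intro continuous_on_Min continuous_size_off)

text \<open>If the coordinate x is nonzero at the limit, then \<open>size_off G\<close> is at least
  its absolute value for every G without x, so no denominator degenerates. The exponents are
  positive, so the powers remain continuous where the base reaches 0.\<close>

lemma tendsto_damping:
  assumes "J \<noteq> {}" "x \<in> F" "0 \<le> t0" "t0 \<le> 1" "\<phi>0 x \<noteq> 0" and A: "A \<subseteq> {0..1} \<times> UNIV"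
  shows "(damping x \<longlongrightarrow> damping x (t0, \<phi>0)) (at (t0, \<phi>0) within A)"
  unfolding damping_def split_def
proof (rule tendsto_prod)
  fix G assume G: "G \<in> J"
  let ?b = "\<lambda>p :: real \<times> ('s \<Rightarrow> real). 1 - fst p * (least_size (snd p) / size_off G (snd p))"
  show "((\<lambda>p. if x \<in> G then 1 else ?b p powr - weight G x) \<longlongrightarrow>
      (if x \<in> G then 1 else ?b (t0, \<phi>0) powr - weight G x)) (at (t0, \<phi>0) within A)"
  proof (cases "x \<in> G")
    case False
    have pos: "size_off G \<phi>0 \<noteq> 0" using size_off_ge[of x G \<phi>0] False assms by force
    have lim: "((\<lambda>p. f (snd p)) \<longlongrightarrow> f \<phi>0) (at (t0, \<phi>0) within A)"
      if "continuous_on UNIV (\<lambda>p :: real \<times> ('s \<Rightarrow> real). f (snd p))" for f :: "('s \<Rightarrow> real) \<Rightarrow> real"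
      using that unfolding continuous_on_def by (auto intro: tendsto_within_subset[of _ _ _ UNIV])
    have "(?b \<longlongrightarrow> 1 - t0 * (least_size \<phi>0 / size_off G \<phi>0)) (at (t0, \<phi>0) within A)"
      using pos tendsto_fst[OF tendsto_ident_at, of "(t0, \<phi>0)" A] continuous_size_off continuous_least_size[OF assms(1)]
      by (intro tendsto_diff tendsto_const tendsto_mult tendsto_divide lim) auto
    moreover have "\<forall>\<^sub>F p in at (t0, \<phi>0) within A. 0 \<le> ?b p"
      using A base_bounds(1)[OF G] by (intro eventually_at_topological[THEN iffD2] exI[of _ UNIV]) force
    ultimately show ?thesis
      using False weight(3)[OF G, of x] assms by (auto intro!: tendsto_powr2)
  qed simp
qed

text \<open>Where a coordinate vanishes its damping factor may jump, but it stays in [0, 1], and the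
  product is squeezed to 0. Elsewhere the damping factor itself is continuous.\<close>

lemma continuous_on_push:
  assumes "J \<noteq> {}"
  shows "continuous_on ({0..1} \<times> closure V) push"
proof (rule continuous_on_coordinatewise_then_product)
  fix x
  show "continuous_on ({0..1} \<times> closure V) (\<lambda>p. push p x)"
  proof (cases "x \<in> F")
    case False
    then have "push p x = 0" if "p \<in> {0..1} \<times> closure V" for p
      using that closure_V_zero by (auto simp: push_def)
    then show ?thesis by (metis (no_types, lifting) continuous_on_cong continuous_on_const)
  next
    case x: True
    show ?thesis
      unfolding continuous_on_def
    proof
      fix p :: "real \<times> ('s \<Rightarrow> real)" assume p: "p \<in> {0..1} \<times> closure V"
      then obtain t0 \<phi>0 where p0: "p = (t0, \<phi>0)" "0 \<le> t0" "t0 \<le> 1" by auto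
      let ?F = "at p within {0..1} \<times> closure V"
      have c: "((\<lambda>p. snd p x) \<longlongrightarrow> snd p x) ?F"
        using continuous_on_coordinate_snd[of "{0..1} \<times> closure V" x] p unfolding continuous_on_def by blast
      show "((\<lambda>p. push p x) \<longlongrightarrow> push p x) ?F"
      proof (cases "\<phi>0 x = 0")
        case True
        have "((\<lambda>p. push p x) \<longlongrightarrow> 0) ?F"
        proof (rule Lim_null_comparison)
          show "((\<lambda>p. \<bar>snd p x\<bar>) \<longlongrightarrow> 0) ?F" using tendsto_rabs[OF c] True p0 by simp
          have "norm (push q x) \<le> \<bar>snd q x\<bar>" if "q \<in> {0..1} \<times> closure V" for q
            using that damping_bounds[OF x, of "fst q" "snd q"]
            by (auto simp: push_def abs_mult intro!: mult_left_le)
          then show "\<forall>\<^sub>F q in ?F. norm (push q x) \<le> \<bar>snd q x\<bar>"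
            by (auto simp: eventually_at_topological intro!: exI[of _ UNIV])
        qed
        then show ?thesis using True p0 by (simp add: push_def)
      next
        case False
        then show ?thesis
          unfolding push_def using c tendsto_damping[OF assms x p0(2,3), of \<phi>0 "{0..1} \<times> closure V"] p0(1)
          by (intro tendsto_mult) auto
      qed
    qed
  qed
qed

text \<open>The support of the point is itself a member of J, and its \<open>size_off\<close> is 0.
  Hence \<open>least_size\<close> is 0 and every base is 1.\<close>

lemma push_eq_of_Z:
  assumes "\<phi> \<in> closure V" "\<phi> \<in> Z"
  shows "push (t, \<phi>) = \<phi>"
proof
  fix x
  let ?G = "{x \<in> F. \<phi> x \<noteq> 0}"
  have G: "?G \<in> J" using limit_support_mem_J[OF assms] .
  have "size_off ?G \<phi> = 0" by (simp add: size_off_def)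
  then have "least_size \<phi> = 0" using least_size_le[OF G, of \<phi>] least_size_nonneg[of \<phi>] G by auto
  then have "damping x (t, \<phi>) = 1" unfolding damping_def prod.case by (intro prod.neutral) simp
  then show "push (t, \<phi>) x = \<phi> x" by (simp add: push_def)
qed

lemma push_zero: "push (0, \<phi>) = \<phi>"
  by (auto simp: push_def damping_def prod.neutral)

lemma V_size_off_pos: "\<phi> \<in> V \<Longrightarrow> G \<in> J \<Longrightarrow> 0 < size_off G \<phi>"
proof -
  assume *: "\<phi> \<in> V" "G \<in> J"
  then obtain x where "x \<in> F - G" by (auto simp: J_def)
  then show ?thesis using size_off_ge[of x G \<phi>] * by (force simp: V_def)
qed

text \<open>For t < 1 all bases are positive, so the push is multiplication by \<open>ex w\<close>,
  where w is a linear combination of weights and hence lies in W.\<close>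

lemma push_mem_interior:
  assumes "\<phi> \<in> V" "0 \<le> t" "t < 1"
  shows "push (t, \<phi>) \<in> Y"
proof -
  let ?b = "\<lambda>G. 1 - t * (least_size \<phi> / size_off G \<phi>)"
  have b: "0 < ?b G" if "G \<in> J" for G
  proof -
    have "least_size \<phi> / size_off G \<phi> \<le> 1"
      using V_size_off_pos[OF assms(1) that] least_size_le[OF that, of \<phi>] by simp
    moreover have "0 \<le> least_size \<phi> / size_off G \<phi>"
      using that least_size_nonneg[of \<phi>] size_off_nonneg by (intro divide_nonneg_nonneg) auto
    ultimately have "t * (least_size \<phi> / size_off G \<phi>) \<le> t * 1" using assms by (intro mult_left_mono) auto
    then show ?thesis using assms by simp
  qed
  define w where "w = (\<lambda>x. \<Sum>G\<in>J. - ln (?b G) * weight G x)"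
  have "(\<lambda>x. \<Sum>G\<in>J'. - ln (?b G) * weight G x) \<in> W" if "finite J'" "J' \<subseteq> J" for J'
    using that
  proof (induction J' rule: finite_induct)
    case empty
    \<comment> \<open>The zero vector lies in W because V has a point whose logarithm can be
      multiplied by 0.\<close>
    have "(\<lambda>x. 0 * ln \<bar>\<phi> x\<bar>) \<in> W" by (rule W_scale[OF log_mem_W[OF assms(1)]])
    then show ?case by simp
  next
    case (insert G J')
    then have "(\<lambda>x. - ln (?b G) * weight G x + (\<Sum>G\<in>J'. - ln (?b G) * weight G x)) \<in> W"
      by (intro W_add W_scale weight(1)) auto
    then show ?case using insert.hyps by simp
  qed
  then have w: "w \<in> W" using finite_J by (auto simp: w_def)
  have "push (t, \<phi>) = (\<lambda>x. \<phi> x * ex w x)"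
  proof
    fix x
    show "push (t, \<phi>) x = \<phi> x * ex w x"
    proof (cases "x \<in> F")
      case True
      have "(if x \<in> G then 1 else ?b G powr - weight G x) = exp (- ln (?b G) * weight G x)" if "G \<in> J" for G
        using b[OF that] weight(2)[OF that, of x] by (auto simp: powr_def)
      then have "damping x (t, \<phi>) = exp (w x)"
        unfolding damping_def w_def using finite_J by (simp add: exp_sum)
      then show ?thesis using True by (simp add: push_def ex_def)
    next
      case False
      then show ?thesis using V_zero[OF assms(1)] by (simp add: push_def)
    qed
  qed
  then show ?thesis using Y_mult w assms(1) by (auto simp: W_def V_def)
qed

lemma push_mem:
  assumes "J \<noteq> {}" "\<phi> \<in> closure V" "0 \<le> t" "t \<le> 1"
  shows "push (t, \<phi>) \<in> Y"
proof (cases "\<phi> \<in> V")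
  case False
  then have "\<phi> \<in> Z" using assms closure_V_subset Y_eq by blast
  then show ?thesis using push_eq_of_Z assms Z_subset by auto
next
  case True
  have cont: "continuous_on {0..1} (\<lambda>t. push (t, \<phi>))"
    using assms(2)
    by (intro continuous_on_compose2[OF continuous_on_push[OF assms(1)]] continuous_intros) auto
  \<comment> \<open>At t = 1 a base can be 0 and the group argument fails; the endpoint is reached
    by continuity, Y being closed.\<close>
  have "(\<lambda>t. push (t, \<phi>)) ` closure {0..<1} \<subseteq> Y"
    by (rule image_closure_subset) (use cont closed_Y push_mem_interior[OF True] in auto)
  then show ?thesis using assms(3,4) by (simp add: image_subset_iff)
qed

lemma push_one_mem_Z:
  assumes "J \<noteq> {}" "\<phi> \<in> closure V"
  shows "push (1, \<phi>) \<in> Z"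
proof (cases "\<phi> \<in> V")
  case False
  then have "\<phi> \<in> Z" using assms closure_V_subset Y_eq by blast
  then show ?thesis using push_eq_of_Z assms by auto
next
  case True
  have "least_size \<phi> \<in> (\<lambda>G. size_off G \<phi>) ` J"
    unfolding least_size_def using finite_J assms(1) by (intro Min_in) auto
  then obtain G where G: "G \<in> J" "least_size \<phi> = size_off G \<phi>" by blast
  then obtain x where x: "x \<in> F - G" by (auto simp: J_def)
  \<comment> \<open>For a G that attains the minimum the ratio is 1, so at t = 1 the coordinates in
    F - G are multiplied by 0.\<close>
  have "1 - 1 * (least_size \<phi> / size_off G \<phi>) = 0"
    using V_size_off_pos[OF True G(1)] unfolding G(2) by simp
  then have "(if x \<in> G then 1 else (1 - 1 * (least_size \<phi> / size_off G \<phi>)) powr - weight G x) = 0"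
    using x by simp
  then have "damping x (1, \<phi>) = 0"
    unfolding damping_def prod.case using G(1) by (intro prod_zero[OF finite_J]) blast
  then have "push (1, \<phi>) x = 0" by (simp add: push_def)
  then show ?thesis using push_mem[OF assms, of 1] x by (auto simp: Z_def)
qed

text \<open>The push on the closure of V and the constant homotopy on Z live on closed sets and
  agree on the overlap, since the push fixes the points of Z there.\<close>

lemma retract_to_Z:
  assumes "J \<noteq> {}"
  obtains r where "homotopic_with_canon (\<lambda>_. True) Y Y id r" "r ` Y \<subseteq> Z"
proof -
  let ?h = "\<lambda>p. if snd p \<in> closure V then push p else snd p"
  have Yeq: "{0..1} \<times> Y = ({0..1::real} \<times> closure V) \<union> ({0..1} \<times> Z)"
    using Y_eq closure_V_subset closure_subset[of V] by blast
  have "continuous_on ({0..1} \<times> Y) ?h"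
    unfolding Yeq
  proof (rule continuous_on_cases)
    show "continuous_on ({0..1} \<times> Z) snd" by (intro continuous_intros)
    show "\<forall>p. p \<in> {0..1} \<times> closure V \<and> snd p \<notin> closure V \<or> p \<in> {0..1} \<times> Z \<and> snd p \<in> closure V \<longrightarrow>
        push p = snd p"
      using push_eq_of_Z by auto
  qed (use closed_Z continuous_on_push[OF assms] in \<open>auto intro!: closed_Times\<close>)
  moreover have "?h ` ({0..1} \<times> Y) \<subseteq> Y"
    using push_mem[OF assms] by auto
  ultimately have "homotopic_with_canon (\<lambda>_. True) Y Y id (\<lambda>\<phi>. ?h (1, \<phi>))"
    by (rule homotopic_with_canonI) (auto simp: push_zero)
  moreover have "(\<lambda>\<phi>. ?h (1, \<phi>)) ` Y \<subseteq> Z"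
    using push_one_mem_Z[OF assms] Y_eq closure_subset by auto
  ultimately show ?thesis using that by blast
qed

text \<open>No point of Z is a limit of V, because its support would belong to J. So V and Z are
  disjoint closed sets and homotopies on them can be chosen independently. On V the map \<phi> *
  |\<phi>| powr (-t) leads from \<phi> to its vector of signs, of which there are finitely
  many.\<close>

lemma split_off:
  assumes "J = {}" and Z: "homotopic_with_canon (\<lambda>_. True) Z Z id r" "finite (r ` Z)"
  obtains r' where "homotopic_with_canon (\<lambda>_. True) Y Y id r'" "finite (r' ` Y)"
proof -
  have "closure V \<inter> Z = {}"
  proof (rule ccontr)
    assume "closure V \<inter> Z \<noteq> {}"
    then obtain \<phi> where "\<phi> \<in> closure V" "\<phi> \<in> Z" by auto
    then show False using limit_support_mem_J[of \<phi>] assms(1) by simp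
  qed
  then have clV: "closure V = V" using closure_V_subset Y_eq closure_subset[of V] by blast
  obtain g where g: "continuous_on ({0..1::real} \<times> Z) g" "g ` ({0..1} \<times> Z) \<subseteq> Z"
    "\<forall>x\<in>Z. g (0, x) = id x" "\<forall>x\<in>Z. g (1, x) = r x"
    by (rule homotopic_with_canonE[OF Z(1)])
  define f :: "real \<times> ('s \<Rightarrow> real) \<Rightarrow> 's \<Rightarrow> real" where "f p = (\<lambda>x. snd p x * \<bar>snd p x\<bar> powr (- fst p))" for p
  let ?h = "\<lambda>p. if snd p \<in> V then f p else g p"
  have contf: "continuous_on ({0..1} \<times> V) f"
  proof (rule continuous_on_coordinatewise_then_product)
    fix x
    show "continuous_on ({0..1} \<times> V) (\<lambda>p. f p x)"
    proof (cases "x \<in> F")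
      case True
      then show ?thesis
        unfolding f_def by (intro continuous_intros continuous_on_coordinate_snd) (auto simp: V_def)
    next
      case False
      then have "f p x = 0" if "p \<in> {0..1} \<times> V" for p using that V_zero by (auto simp: f_def)
      then show ?thesis by (metis (no_types, lifting) continuous_on_cong continuous_on_const)
    qed
  qed
  have Yeq: "{0..1} \<times> Y = ({0..1::real} \<times> V) \<union> ({0..1} \<times> Z)" using Y_eq by blast
  have "continuous_on ({0..1} \<times> Y) ?h"
    unfolding Yeq
  proof (rule continuous_on_cases)
    show "closed ({0..1::real} \<times> V)" using closed_closure[of V] by (simp add: clV closed_Times)
  qed (use closed_Z contf g(1) V_Z in \<open>auto intro!: closed_Times\<close>)
  moreover have "?h ` ({0..1} \<times> Y) \<subseteq> Y"
  proof -
    have "f (t, \<phi>) \<in> Y" if "\<phi> \<in> V" for t \<phi>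
      using that V_subset by (auto simp: f_def intro!: Y_mult Y_powr)
    then show ?thesis using g(2) Y_eq by fastforce
  qed
  ultimately have "homotopic_with_canon (\<lambda>_. True) Y Y id (\<lambda>\<phi>. ?h (1, \<phi>))"
  proof (rule homotopic_with_canonI)
    fix \<phi> assume "\<phi> \<in> Y"
    then show "?h (0, \<phi>) = id \<phi>" using g(3) Y_eq by (auto simp: f_def fun_eq_iff)
  qed simp
  moreover have "finite ((\<lambda>\<phi>. ?h (1, \<phi>)) ` Y)"
  proof (rule finite_subset)
    have "f (1, \<phi>) \<in> {s. \<forall>x. (x \<in> S \<longrightarrow> s x \<in> {-1, 0, 1}) \<and> (x \<notin> S \<longrightarrow> s x = 0)}" if "\<phi> \<in> V" for \<phi>
    proof -
      have "\<phi> x = 0" if "x \<notin> S" for x using V_zero[OF \<open>\<phi> \<in> V\<close>, of x] that F_subset by blast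
      moreover have "f (1, \<phi>) x \<in> {-1, 0, 1}" for x
        by (cases "\<phi> x" "0 :: real" rule: linorder_cases) (auto simp: f_def powr_minus_divide)
      ultimately show ?thesis by (auto simp: f_def)
    qed
    then show "(\<lambda>\<phi>. ?h (1, \<phi>)) ` Y \<subseteq> {s. \<forall>x. (x \<in> S \<longrightarrow> s x \<in> {-1, 0, 1}) \<and> (x \<notin> S \<longrightarrow> s x = 0)} \<union> r ` Z"
      using Y_eq g(4) by auto
    show "finite ({s :: 's \<Rightarrow> real. \<forall>x. (x \<in> S \<longrightarrow> s x \<in> {-1, 0, 1}) \<and> (x \<notin> S \<longrightarrow> s x = 0)} \<union> r ` Z)"
      using finite_S Z(2) by (intro finite_UnI finite_set_of_finite_funs) auto
  qed
  ultimately show ?thesis using that by blast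
qed

end

text \<open>Induction on the number of supports that occur in Y. A support of greatest cardinality
  is contained in no other, and removing its stratum removes it from the list.\<close>

theorem power_closed_homotopic_finite:
  fixes Y :: "('s \<Rightarrow> real) set"
  assumes "finite S" "power_closed S Y"
  obtains r where "homotopic_with_canon (\<lambda>_. True) Y Y id r" "finite (r ` Y)"
proof -
  let ?supp = "\<lambda>\<phi> :: 's \<Rightarrow> real. {x. \<phi> x \<noteq> 0}"
  have sub: "?supp ` Y \<subseteq> Pow S" if "power_closed S Y" for Y using that by (auto simp: power_closed_def)
  have "\<exists>r. homotopic_with_canon (\<lambda>_. True) Y Y id r \<and> finite (r ` Y)"
    using assms(2)
  proof (induction "card (?supp ` Y)" arbitrary: Y rule: less_induct)
    case less
    have fin: "finite (?supp ` Y)" using sub[OF less.prems] assms(1) finite_subset by blast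
    show ?case
    proof (cases "Y = {}")
      case True
      then show ?thesis by (intro exI[of _ id]) simp
    next
      case False
      have "Max (card ` ?supp ` Y) \<in> card ` ?supp ` Y" using fin False by (intro Max_in) auto
      then obtain F where F0: "Max (card ` ?supp ` Y) = card F" "F \<in> ?supp ` Y" by (rule imageE)
      have F: "F \<in> ?supp ` Y" "\<And>G. G \<in> ?supp ` Y \<Longrightarrow> card G \<le> card F"
        using F0(2) Max_ge[OF finite_imageI[OF fin, of card]] unfolding F0(1) by blast+
      interpret top_stratum S Y F
      proof
        fix \<phi> assume \<phi>: "\<phi> \<in> Y" "\<forall>x\<in>F. \<phi> x \<noteq> 0"
        have "finite (?supp \<phi>)" using sub[OF less.prems] \<phi>(1) assms(1) finite_subset by blast
        then have "F = ?supp \<phi>" using \<phi> F(2)[of "?supp \<phi>"] by (intro card_seteq) auto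
        then show "\<forall>x. x \<notin> F \<longrightarrow> \<phi> x = 0" by auto
      qed (use assms less.prems F sub in auto)
      have "F \<notin> ?supp ` Z" by (auto simp: Z_def)
      then have "?supp ` Z \<subset> ?supp ` Y" using F(1) Z_subset by blast
      then have "card (?supp ` Z) < card (?supp ` Y)" using fin by (rule psubset_card_mono[rotated])
      then obtain r where r: "homotopic_with_canon (\<lambda>_. True) Z Z id r" "finite (r ` Z)"
        using less.hyps power_closed_Z by blast
      show ?thesis
      proof (cases "J = {}")
        case True
        then show ?thesis using split_off r by metis
      next
        case False
        then obtain q where q: "homotopic_with_canon (\<lambda>_. True) Y Y id q" "q ` Y \<subseteq> Z"
          using retract_to_Z by blast
        have "continuous_map (top_of_set Y) (top_of_set Z) q"
          using homotopic_with_imp_continuous[OF q(1)] q(2) by auto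
        \<comment> \<open>The homotopy from the identity of Z to r is precomposed with q, which maps
          into Z; this needs no homotopy defined on all of Y.\<close>
        then have "homotopic_with_canon (\<lambda>_. True) Y Z (id \<circ> q) (r \<circ> q)"
          using homotopic_with_compose_continuous_map_right[OF r(1), where q = "\<lambda>_. True"] by blast
        then have "homotopic_with_canon (\<lambda>_. True) Y Y q (r \<circ> q)"
          using Z_subset homotopic_with_subset_right by fastforce
        then have "homotopic_with_canon (\<lambda>_. True) Y Y id (r \<circ> q)"
          using q(1) homotopic_with_trans by blast
        moreover have "(r \<circ> q) ` Y \<subseteq> r ` Z" using q(2) by auto
        ultimately show ?thesis using r(2) finite_subset by blast
      qed
    qed
  qed
  then show ?thesis using that by blast
qed

section \<open>Binoids and localisations\<close>

context binoid
begin

lemma frac_rel_iff: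
  "((a, i), (b, j)) \<in> frac_rel M f \<longleftrightarrow> a \<in> carrier M \<and> b \<in> carrier M \<and>
     (\<exists>l::nat. f [^] l \<otimes> (a \<otimes> f [^] j) = f [^] l \<otimes> (b \<otimes> f [^] i))"
  by (auto simp: frac_rel_def)

lemma equiv_frac_rel:
  assumes f: "f \<in> carrier M"
  shows "equiv (carrier M \<times> UNIV) (frac_rel M f)"
proof (rule equivI)
  show "frac_rel M f \<subseteq> (carrier M \<times> UNIV) \<times> carrier M \<times> UNIV"
    by (auto simp: frac_rel_def)
  show "refl_on (carrier M \<times> UNIV) (frac_rel M f)"
    by (auto simp: refl_on_def frac_rel_iff)
  show "sym (frac_rel M f)"
    by (rule symI) (clarsimp simp: frac_rel_iff, metis)
  show "trans (frac_rel M f)"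
  proof (rule transI)
    fix x y z assume "(x, y) \<in> frac_rel M f" "(y, z) \<in> frac_rel M f"
    moreover obtain a i b j c k where "x = (a, i)" "y = (b, j)" "z = (c, k)"
      by (metis surj_pair)
    ultimately obtain l l' :: nat where
      abc: "a \<in> carrier M" "b \<in> carrier M" "c \<in> carrier M" "x = (a, i)" "z = (c, k)"
      and l: "f [^] l \<otimes> (a \<otimes> f [^] j) = f [^] l \<otimes> (b \<otimes> f [^] i)"
      and l': "f [^] l' \<otimes> (b \<otimes> f [^] k) = f [^] l' \<otimes> (c \<otimes> f [^] j)"
      by (auto simp: frac_rel_iff)
    \<comment> \<open>The denominator f^j of the middle fraction is not cancellable, so it is
      absorbed into the exponent of the common factor.\<close>
    have "f [^] (l + l' + j) \<otimes> (a \<otimes> f [^] k) = (f [^] l \<otimes> (a \<otimes> f [^] j)) \<otimes> (f [^] l' \<otimes> f [^] k)"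
      using abc f by (simp add: nat_pow_mult[symmetric] m_ac)
    also have "\<dots> = (f [^] l' \<otimes> (b \<otimes> f [^] k)) \<otimes> (f [^] l \<otimes> f [^] i)"
      unfolding l using abc f by (simp add: m_ac)
    also have "\<dots> = f [^] (l + l' + j) \<otimes> (c \<otimes> f [^] i)"
      unfolding l' using abc f by (simp add: nat_pow_mult[symmetric] m_ac)
    finally show "(x, z) \<in> frac_rel M f" using abc by (auto simp: frac_rel_iff)
  qed
qed

lemma fraction_eq_iff:
  assumes "f \<in> carrier M" "a \<in> carrier M" "b \<in> carrier M"
  shows "fraction M f a i = fraction M f b j \<longleftrightarrow>
    (\<exists>l::nat. f [^] l \<otimes> (a \<otimes> f [^] j) = f [^] l \<otimes> (b \<otimes> f [^] i))"
  unfolding fraction_def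
  by (subst eq_equiv_class_iff[OF equiv_frac_rel]) (use assms in \<open>auto simp: frac_rel_iff\<close>)

lemma mem_fraction_iff:
  assumes "f \<in> carrier M" "a \<in> carrier M"
  shows "(b, j) \<in> fraction M f a i \<longleftrightarrow> b \<in> carrier M \<and> fraction M f b j = fraction M f a i"
  unfolding fraction_def
  using equiv_class_eq_iff[OF equiv_frac_rel[OF assms(1)], of "(a, i)" "(b, j)"] assms
  by auto

lemma fraction_mem: "f \<in> carrier M \<Longrightarrow> a \<in> carrier M \<Longrightarrow> fraction M f a i \<in> carrier (localization M f)"
  by (auto simp: localization_def fraction_def intro: quotientI)

lemma localizationE:
  assumes "c \<in> carrier (localization M f)"
  obtains a i where "a \<in> carrier M" "c = fraction M f a i"
  using assms by (auto simp: localization_def fraction_def elim!: quotientE)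

text \<open>The unions in the definition of the product range over a constant family of classes,
  because the product fraction does not depend on the representatives.\<close>

lemma mult_fraction:
  assumes f: "f \<in> carrier M" and ab: "a \<in> carrier M" "b \<in> carrier M"
  shows "fraction M f a i \<otimes>\<^bsub>localization M f\<^esub> fraction M f b j = fraction M f (a \<otimes> b) (i + j)"
proof -
  have *: "fraction M f (a' \<otimes> b') (i' + j') = fraction M f (a \<otimes> b) (i + j)"
    if *: "(a', i') \<in> fraction M f a i" "(b', j') \<in> fraction M f b j" for a' b' i' j'
  proof -
    have c: "a' \<in> carrier M" "b' \<in> carrier M" using * f ab by (auto simp: mem_fraction_iff)
    obtain l l' :: nat where l: "f [^] l \<otimes> (a' \<otimes> f [^] i) = f [^] l \<otimes> (a \<otimes> f [^] i')"
      and l': "f [^] l' \<otimes> (b' \<otimes> f [^] j) = f [^] l' \<otimes> (b \<otimes> f [^] j')"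
      using * f ab c by (auto simp: mem_fraction_iff fraction_eq_iff)
    have "f [^] (l + l') \<otimes> ((a' \<otimes> b') \<otimes> f [^] (i + j)) = (f [^] l \<otimes> (a' \<otimes> f [^] i)) \<otimes> (f [^] l' \<otimes> (b' \<otimes> f [^] j))"
      using ab c f by (simp add: nat_pow_mult[symmetric] m_ac)
    also have "\<dots> = f [^] (l + l') \<otimes> ((a \<otimes> b) \<otimes> f [^] (i' + j'))"
      unfolding l l' using ab c f by (simp add: nat_pow_mult[symmetric] m_ac)
    finally show ?thesis using ab c f by (subst fraction_eq_iff) auto
  qed
  have mem: "(a, i) \<in> fraction M f a i" "(b, j) \<in> fraction M f b j"
    using f ab by (auto simp: mem_fraction_iff)
  have "fraction M f a i \<otimes>\<^bsub>localization M f\<^esub> fraction M f b j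
      = (\<Union>(a', i')\<in>fraction M f a i. \<Union>(b', j')\<in>fraction M f b j. fraction M f (a' \<otimes> b') (i' + j'))"
    by (simp add: localization_def)
  also have "\<dots> = (\<Union>_\<in>fraction M f a i. \<Union>_\<in>fraction M f b j. fraction M f (a \<otimes> b) (i + j))"
    by (intro SUP_cong refl) (auto simp: * intro!: SUP_cong)
  also have "\<dots> = fraction M f (a \<otimes> b) (i + j)"
    using mem by blast
  finally show ?thesis .
qed

lemma one_localization: "\<one>\<^bsub>localization M f\<^esub> = fraction M f \<one> 0"
  and absorb_localization: "absorb (localization M f) = fraction M f (absorb M) 0"
  by (simp_all add: localization_def)

text \<open>Localising at 1 changes nothing. Since D(1) is the whole spectrum, this identifies M
  with the sections over a chart.\<close>

lemma fraction_hom_one: "(\<lambda>m. fraction M \<one> m 0) \<in> binoid_iso M (localization M \<one>)"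
proof -
  have "inj_on (\<lambda>m. fraction M \<one> m 0) (carrier M)"
    by (rule inj_onI) (simp add: fraction_eq_iff)
  moreover have "carrier (localization M \<one>) \<subseteq> (\<lambda>m. fraction M \<one> m 0) ` carrier M"
  proof
    fix c assume "c \<in> carrier (localization M \<one>)"
    then obtain a i where a: "a \<in> carrier M" "c = fraction M \<one> a i" by (rule localizationE)
    then have "c = fraction M \<one> a 0" by (simp add: fraction_eq_iff)
    then show "c \<in> (\<lambda>m. fraction M \<one> m 0) ` carrier M" using a by blast
  qed
  ultimately show ?thesis
    by (auto simp: binoid_iso_def binoid_hom_def bij_betw_def hom_def mult_fraction fraction_mem
        one_localization absorb_localization)
qed

lemma loc_map_fraction:
  assumes "g \<in> carrier M" "a \<in> carrier M"
  shows "loc_map M \<one> g (fraction M \<one> a 0) = fraction M g a 0"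
proof -
  have *: "(a', i) \<in> fraction M \<one> a 0 \<longleftrightarrow> a' = a" for a' i
    using assms by (auto simp: mem_fraction_iff fraction_eq_iff)
  have "(\<exists>(a', i)\<in>fraction M \<one> a 0. fraction M g (b \<otimes> \<one> [^] i) j = fraction M g a' 0)
      \<longleftrightarrow> fraction M g b j = fraction M g a 0" if "b \<in> carrier M" for b j
  proof
    assume "\<exists>(a', i)\<in>fraction M \<one> a 0. fraction M g (b \<otimes> \<one> [^] i) j = fraction M g a' 0"
    then obtain a' i where "(a', i) \<in> fraction M \<one> a 0" "fraction M g (b \<otimes> \<one> [^] i) j = fraction M g a' 0"
      by blast
    then show "fraction M g b j = fraction M g a 0" using *[of a' i] that by simp
  next
    assume "fraction M g b j = fraction M g a 0"
    then show "\<exists>(a', i)\<in>fraction M \<one> a 0. fraction M g (b \<otimes> \<one> [^] i) j = fraction M g a' 0"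
      using *[of a 0] that by (intro bexI[of _ "(a, 0)"]) simp_all
  qed
  then have "(b, j) \<in> loc_map M \<one> g (fraction M \<one> a 0) \<longleftrightarrow> (b, j) \<in> fraction M g a 0" for b j
    unfolding mem_fraction_iff[OF assms] loc_map_def
    by (simp only: mem_Collect_eq prod.inject ex_simps simp_thms) (simp cong: conj_cong)
  then have "\<forall>p. p \<in> loc_map M \<one> g (fraction M \<one> a 0) \<longleftrightarrow> p \<in> fraction M g a 0"
    unfolding split_paired_All by blast
  then show ?thesis by blast
qed

lemma prime_pow:
  assumes "P \<in> spec M" "f \<in> carrier M" "f \<notin> P"
  shows "f [^] (n::nat) \<notin> P"
proof (induction n)
  case 0
  have "\<one> \<notin> P"
  proof
    assume "\<one> \<in> P"
    then have "\<forall>m\<in>carrier M. \<one> \<otimes> m \<in> P" "P \<subseteq> carrier M"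
      using assms(1) unfolding spec_def binoid_prime_def binoid_ideal_def by blast+
    then show False using assms(1) by (auto simp: spec_def binoid_prime_def)
  qed
  then show ?case by simp
next
  case (Suc n)
  then show ?case using assms unfolding spec_def binoid_prime_def by auto
qed

lemma one_notin_prime: "P \<in> spec M \<Longrightarrow> \<one> \<notin> P"
  using prime_pow[of P "\<one>" 0] unfolding spec_def binoid_prime_def binoid_ideal_def by auto

lemma prime_mult_iff:
  assumes "P \<in> spec M" "a \<in> carrier M" "b \<in> carrier M"
  shows "a \<otimes> b \<in> P \<longleftrightarrow> a \<in> P \<or> b \<in> P"
proof
  assume "a \<otimes> b \<in> P"
  then show "a \<in> P \<or> b \<in> P"
    using assms unfolding spec_def binoid_prime_def by blast
next
  have *: "x \<otimes> y \<in> P" if "x \<in> P" "y \<in> carrier M" for x y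
    using assms(1) that unfolding spec_def binoid_prime_def binoid_ideal_def by blast
  assume "a \<in> P \<or> b \<in> P"
  then show "a \<otimes> b \<in> P"
    using *[of a b] *[of b a] m_comm[OF assms(2,3)] assms(2,3) by auto
qed

text \<open>An element outside P is a product of generators outside P. A common multiple f of these
  finitely many generators, itself outside P, therefore has powers divisible by every element
  outside P.\<close>

lemma prime_dominating_element:
  assumes gen: "finite S" "generates_binoid M S" and P: "P \<in> spec M"
  obtains f where "f \<in> carrier M" "f \<notin> P"
    "\<And>g. g \<in> carrier M \<Longrightarrow> g \<notin> P \<Longrightarrow> \<exists>m\<in>carrier M. \<exists>n::nat. g \<otimes> m = f [^] n"
proof -
  have S: "S \<subseteq> carrier M" "binoid_generate M S = carrier M" using gen by (auto simp: generates_binoid_def)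
  have "\<exists>f\<in>carrier M. f \<notin> P \<and> (\<forall>g\<in>T. \<exists>m\<in>carrier M. g \<otimes> m = f)" if "finite T" "T \<subseteq> S - P" for T
    using that
  proof (induction T rule: finite_induct)
    case empty
    then show ?case using one_notin_prime[OF P] by blast
  next
    case (insert t T)
    then obtain f where f: "f \<in> carrier M" "f \<notin> P" "\<forall>g\<in>T. \<exists>m\<in>carrier M. g \<otimes> m = f" by blast
    have t: "t \<in> carrier M" "t \<notin> P" using insert.prems S by auto
    have "\<exists>m\<in>carrier M. g \<otimes> m = t \<otimes> f" if "g \<in> insert t T" for g
    proof (cases "g = t")
      case False
      then have "g \<in> T" using that by simp
      then obtain m where m: "m \<in> carrier M" "g \<otimes> m = f" using f(3) by blast
      have "g \<in> carrier M" using \<open>g \<in> T\<close> insert.prems S(1) by blast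
      then have "g \<otimes> (t \<otimes> m) = t \<otimes> f" using m_lcomm[of g t m] t(1) m by simp
      then show ?thesis using t(1) m(1) by blast
    qed (use f(1) in blast)
    moreover have "t \<otimes> f \<notin> P" "t \<otimes> f \<in> carrier M" using t f prime_mult_iff[OF P] by simp_all
    ultimately show ?case by blast
  qed
  from this[of "S - P"] obtain f where f: "f \<in> carrier M" "f \<notin> P"
    "\<And>g. g \<in> S - P \<Longrightarrow> \<exists>m\<in>carrier M. g \<otimes> m = f" using gen by blast
  have "g \<in> carrier M \<and> (g \<notin> P \<longrightarrow> (\<exists>m\<in>carrier M. \<exists>n::nat. g \<otimes> m = f [^] n))" if "g \<in> binoid_generate M S" for g
    using that
  proof induction
    case one
    then show ?case by (auto intro!: bexI[of _ "\<one>"] exI[of _ 0])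
  next
    case absorb
    then show ?case using P absorb_closed by (auto simp: spec_def binoid_prime_def binoid_ideal_def)
  next
    case (incl x)
    then show ?case using f(3)[of x] f(1) S by (metis DiffI nat_pow_eone subsetD)
  next
    case (mult x y)
    show ?case
    proof (intro conjI impI)
      show "x \<otimes> y \<in> carrier M" using mult.IH by simp
      assume "x \<otimes> y \<notin> P"
      then obtain m n and i j :: nat where mn: "m \<in> carrier M" "n \<in> carrier M" "x \<otimes> m = f [^] i" "y \<otimes> n = f [^] j"
        using mult.IH prime_mult_iff[OF P] by blast
      then have "(x \<otimes> y) \<otimes> (m \<otimes> n) = f [^] i \<otimes> f [^] j"
        using mult.IH by (metis m_assoc m_lcomm m_closed)
      then show "\<exists>m\<in>carrier M. \<exists>n::nat. (x \<otimes> y) \<otimes> m = f [^] n"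
        using mn f(1) by (intro bexI[of _ "m \<otimes> n"] exI[of _ "i + j"]) (auto simp: nat_pow_mult)
    qed
  qed
  then show ?thesis using that f S by blast
qed

end

section \<open>Real spectra\<close>

lemma real_binoid_simps [simp]: "carrier real_binoid = UNIV" "x \<otimes>\<^bsub>real_binoid\<^esub> y = x * y"
  "\<one>\<^bsub>real_binoid\<^esub> = 1" "absorb real_binoid = 0"
  by (simp_all add: real_binoid_def)

lemma real_spec_iff:
  "\<psi> \<in> real_spec M \<longleftrightarrow> \<psi> \<in> extensional (carrier M) \<and> \<psi> \<one>\<^bsub>M\<^esub> = 1 \<and> \<psi> (absorb M) = 0 \<and>
     (\<forall>a\<in>carrier M. \<forall>b\<in>carrier M. \<psi> (a \<otimes>\<^bsub>M\<^esub> b) = \<psi> a * \<psi> b)"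
  by (auto simp: real_spec_def binoid_hom_def hom_def)

lemma (in binoid) real_spec_pow:
  assumes "\<psi> \<in> real_spec M" "f \<in> carrier M"
  shows "\<psi> (f [^] (n::nat)) = \<psi> f ^ n"
  using assms by (induction n) (auto simp: real_spec_iff)

lemma (in binoid) real_spec_zero_prime:
  assumes "\<psi> \<in> real_spec M"
  shows "{m \<in> carrier M. \<psi> m = 0} \<in> spec M"
  using assms absorb_closed one_closed
  by (auto simp: spec_def binoid_prime_def binoid_ideal_def real_spec_iff set_eq_iff intro!: exI[of _ "\<one>"])

lemma topspace_real_spec_topology [simp]: "S \<subseteq> carrier M \<Longrightarrow> topspace (real_spec_topology M S) = real_spec M"
  unfolding real_spec_topology_def topspace_pullback_topology by auto

lemma continuous_map_real_spec_coordinate: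
  assumes "x \<in> S"
  shows "continuous_map (real_spec_topology M S) euclideanreal (\<lambda>\<psi>. \<psi> x)"
proof -
  have "continuous_map (real_spec_topology M S) euclideanreal ((\<lambda>\<psi>. \<psi> x) \<circ> (\<lambda>\<psi>. restrict \<psi> S))"
    unfolding real_spec_topology_def
    by (intro continuous_map_pullback continuous_map_product_projection assms)
  then show ?thesis using assms by (simp add: o_def)
qed

lemma continuous_map_into_real_spec:
  assumes "f ` topspace T \<subseteq> real_spec M" "\<And>x. x \<in> S \<Longrightarrow> continuous_map T euclideanreal (\<lambda>t. f t x)"
  shows "continuous_map T (real_spec_topology M S) f"
  unfolding real_spec_topology_def
proof (rule continuous_map_pullback')
  show "continuous_map T (product_topology (\<lambda>_. euclideanreal) S) ((\<lambda>\<psi>. restrict \<psi> S) \<circ> f)"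
    by (subst continuous_map_componentwise) (use assms(2) in \<open>auto simp: o_def\<close>)
qed (use assms(1) in auto)

text \<open>Extension by 0 embeds the real spectrum into a full function type, whose type class
  topology is the product topology.\<close>

definition coordinates :: "'m set \<Rightarrow> ('m \<Rightarrow> real) \<Rightarrow> 'm \<Rightarrow> real" where
  "coordinates S \<psi> = (\<lambda>x. if x \<in> S then \<psi> x else 0)"

locale generated_binoid = binoid M for M :: "'m pointed_monoid" (structure) +
  fixes S :: "'m set"
  assumes finite_S: "finite S" and generates: "generates_binoid M S"
begin

lemma S_subset: "S \<subseteq> carrier M" and generate_eq: "binoid_generate M S = carrier M"
  using generates by (auto simp: generates_binoid_def)

text \<open>Every element is a monomial in the generators, so its value is a monomial, hence
  continuous, function of the coordinates.\<close>

lemma ex_evaluation: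
  assumes "m \<in> carrier M"
  shows "\<exists>e :: ('m \<Rightarrow> real) \<Rightarrow> real. continuous_on UNIV e \<and> (\<forall>\<psi>\<in>real_spec M. e (coordinates S \<psi>) = \<psi> m)"
  using assms unfolding generate_eq[symmetric]
proof induction
  case one
  then show ?case by (intro exI[of _ "\<lambda>_. 1"]) (auto simp: real_spec_iff)
next
  case absorb
  then show ?case by (intro exI[of _ "\<lambda>_. 0"]) (auto simp: real_spec_iff)
next
  case (incl x)
  then show ?case
    by (intro exI[of _ "\<lambda>\<phi>. \<phi> x"]) (auto simp: coordinates_def)
next
  case (mult x y)
  then obtain d e :: "('m \<Rightarrow> real) \<Rightarrow> real" where "continuous_on UNIV d" "\<forall>\<psi>\<in>real_spec M. d (coordinates S \<psi>) = \<psi> x"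
    "continuous_on UNIV e" "\<forall>\<psi>\<in>real_spec M. e (coordinates S \<psi>) = \<psi> y" by blast
  then show ?case
    using mult.hyps unfolding generate_eq
    by (intro exI[of _ "\<lambda>\<phi>. d \<phi> * e \<phi>"]) (auto simp: real_spec_iff intro!: continuous_intros)
qed

definition evaluation :: "'m \<Rightarrow> ('m \<Rightarrow> real) \<Rightarrow> real" where
  "evaluation m = (SOME e. continuous_on UNIV e \<and> (\<forall>\<psi>\<in>real_spec M. e (coordinates S \<psi>) = \<psi> m))"

lemma evaluation:
  assumes "m \<in> carrier M"
  shows "continuous_on UNIV (evaluation m)" "\<psi> \<in> real_spec M \<Longrightarrow> evaluation m (coordinates S \<psi>) = \<psi> m"
  using someI_ex[OF ex_evaluation[OF assms]] unfolding evaluation_def by blast+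

text \<open>A vector that satisfies the equations defines a homomorphism by evaluation, and is its
  coordinate vector. The image is thus cut out by equations between continuous functions, possibly
  infinitely many, and is closed.\<close>

lemma image_coordinates:
  "coordinates S ` real_spec M =
    {\<phi>. (\<forall>x. x \<notin> S \<longrightarrow> \<phi> x = 0) \<and> (\<forall>x\<in>S. evaluation x \<phi> = \<phi> x) \<and> evaluation \<one> \<phi> = 1 \<and>
      evaluation (absorb M) \<phi> = 0 \<and>
      (\<forall>a\<in>carrier M. \<forall>b\<in>carrier M. evaluation (a \<otimes> b) \<phi> = evaluation a \<phi> * evaluation b \<phi>)}" (is "_ = ?R")
proof (intro equalityI subsetI)
  fix \<phi> assume "\<phi> \<in> coordinates S ` real_spec M"
  then obtain \<psi> where \<psi>: "\<psi> \<in> real_spec M" "\<phi> = coordinates S \<psi>" by blast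
  have "evaluation m \<phi> = \<psi> m" if "m \<in> carrier M" for m using evaluation(2)[OF that \<psi>(1)] \<psi>(2) by simp
  then show "\<phi> \<in> ?R"
    using \<psi> S_subset absorb_closed by (auto simp: real_spec_iff coordinates_def subset_iff)
next
  fix \<phi> assume \<phi>: "\<phi> \<in> ?R"
  let ?\<psi> = "\<lambda>m\<in>carrier M. evaluation m \<phi>"
  have "?\<psi> \<in> real_spec M" using \<phi> absorb_closed by (auto simp: real_spec_iff)
  moreover have "coordinates S ?\<psi> = \<phi>" using \<phi> S_subset by (auto simp: coordinates_def fun_eq_iff subset_iff)
  ultimately show "\<phi> \<in> coordinates S ` real_spec M"
    using imageI[of ?\<psi> "real_spec M" "coordinates S"] by simp
qed

lemma closed_image_coordinates: "closed (coordinates S ` real_spec M)"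
  unfolding image_coordinates Collect_conj_eq Collect_ball_eq Collect_all_eq Collect_imp_eq
  using S_subset absorb_closed
  by (intro closed_Int closed_INT ballI allI closed_Un closed_Collect_eq continuous_on_mult evaluation(1)
      continuous_on_product_coordinates continuous_on_const) (auto simp: closed_Collect_const)

text \<open>The pointwise product of two homomorphisms is a homomorphism, and so is a homomorphism
  followed by a power of the absolute value, which is multiplicative and fixes 0 and 1.\<close>

lemma power_closed_image_coordinates: "power_closed S (coordinates S ` real_spec M)"
  unfolding power_closed_def
proof (intro conjI ballI allI impI)
  fix \<phi> \<phi>' assume "\<phi> \<in> coordinates S ` real_spec M" "\<phi>' \<in> coordinates S ` real_spec M"
  then obtain \<psi> \<psi>' where \<psi>: "\<psi> \<in> real_spec M" "\<phi> = coordinates S \<psi>" "\<psi>' \<in> real_spec M" "\<phi>' = coordinates S \<psi>'" by blast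
  then have "(\<lambda>m\<in>carrier M. \<psi> m * \<psi>' m) \<in> real_spec M" using absorb_closed by (auto simp: real_spec_iff)
  moreover have "(\<lambda>x. \<phi> x * \<phi>' x) = coordinates S (\<lambda>m\<in>carrier M. \<psi> m * \<psi>' m)"
    using \<psi> S_subset by (auto simp: coordinates_def fun_eq_iff subset_iff)
  ultimately show "(\<lambda>x. \<phi> x * \<phi>' x) \<in> coordinates S ` real_spec M" by blast
next
  fix \<phi> t assume "\<phi> \<in> coordinates S ` real_spec M"
  then obtain \<psi> where \<psi>: "\<psi> \<in> real_spec M" "\<phi> = coordinates S \<psi>" by blast
  then have "(\<lambda>m\<in>carrier M. \<bar>\<psi> m\<bar> powr t) \<in> real_spec M"
    using absorb_closed by (auto simp: real_spec_iff abs_mult powr_mult)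
  moreover have "(\<lambda>x. \<bar>\<phi> x\<bar> powr t) = coordinates S (\<lambda>m\<in>carrier M. \<bar>\<psi> m\<bar> powr t)"
    using \<psi> S_subset by (auto simp: coordinates_def fun_eq_iff subset_iff)
  ultimately show "(\<lambda>x. \<bar>\<phi> x\<bar> powr t) \<in> coordinates S ` real_spec M" by blast
qed (use closed_image_coordinates in \<open>auto simp: coordinates_def\<close>)

lemma continuous_map_evaluate:
  assumes "m \<in> carrier M"
  shows "continuous_map (real_spec_topology M S) euclideanreal (\<lambda>\<psi>. \<psi> m)"
  using assms unfolding generate_eq[symmetric]
proof induction
  case one
  have "continuous_map (real_spec_topology M S) euclideanreal (\<lambda>\<psi>. 1)" by simp
  then show ?case by (rule continuous_map_eq) (auto simp: S_subset real_spec_iff)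
next
  case absorb
  have "continuous_map (real_spec_topology M S) euclideanreal (\<lambda>\<psi>. 0)" by simp
  then show ?case by (rule continuous_map_eq) (auto simp: S_subset real_spec_iff)
next
  case (incl x)
  then show ?case by (rule continuous_map_real_spec_coordinate)
next
  case (mult x y)
  have "continuous_map (real_spec_topology M S) euclideanreal (\<lambda>\<psi>. \<psi> x * \<psi> y)"
    by (intro continuous_map_real_mult mult.IH)
  then show ?case
    by (rule continuous_map_eq) (use mult.hyps in \<open>auto simp: S_subset real_spec_iff generate_eq\<close>)
qed

lemma homeomorphic_image_coordinates:
  "real_spec_topology M S homeomorphic_space top_of_set (coordinates S ` real_spec M)"
proof -
  have "homeomorphic_maps (real_spec_topology M S) (top_of_set (coordinates S ` real_spec M))
      (coordinates S) (\<lambda>\<phi>. \<lambda>m\<in>carrier M. evaluation m \<phi>)"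
    unfolding homeomorphic_maps_def
  proof (intro conjI ballI)
    have "continuous_map (real_spec_topology M S) (powertop_real UNIV) (coordinates S)"
      using continuous_map_real_spec_coordinate
      by (subst continuous_map_componentwise_UNIV) (auto simp: coordinates_def)
    then show "continuous_map (real_spec_topology M S) (top_of_set (coordinates S ` real_spec M)) (coordinates S)"
      by (auto simp: euclidean_product_topology continuous_map_in_subtopology S_subset)
    have inv: "(\<lambda>m\<in>carrier M. evaluation m (coordinates S \<psi>)) = \<psi>" if "\<psi> \<in> real_spec M" for \<psi>
      using evaluation(2) that by (auto simp: real_spec_iff extensional_def restrict_def)
    then show "(\<lambda>m\<in>carrier M. evaluation m (coordinates S \<psi>)) = \<psi>"
      if "\<psi> \<in> topspace (real_spec_topology M S)" for \<psi> using that S_subset by simp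
    then show "coordinates S (\<lambda>m\<in>carrier M. evaluation m \<phi>) = \<phi>"
      if "\<phi> \<in> topspace (top_of_set (coordinates S ` real_spec M))" for \<phi> using that inv by auto
    show "continuous_map (top_of_set (coordinates S ` real_spec M)) (real_spec_topology M S)
        (\<lambda>\<phi>. \<lambda>m\<in>carrier M. evaluation m \<phi>)"
    proof (rule continuous_map_into_real_spec)
      fix x assume "x \<in> S"
      then have "continuous_on (coordinates S ` real_spec M) (evaluation x)"
        using evaluation(1) S_subset continuous_on_subset by blast
      then show "continuous_map (top_of_set (coordinates S ` real_spec M)) euclideanreal
          (\<lambda>\<phi>. (\<lambda>m\<in>carrier M. evaluation m \<phi>) x)"
        using \<open>x \<in> S\<close> S_subset by auto
    qed (use inv in auto)
  qed
  then show ?thesis unfolding homeomorphic_space_def by blast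
qed

end

section \<open>Vanishing of the higher homology of real spectra\<close>

text \<open>Such a space is discrete, so its homology is the sum of the homologies of its
  points.\<close>

lemma trivial_homology_finite_Hausdorff:
  assumes "Hausdorff_space X" "finite (topspace X)" "p \<noteq> 0"
  shows "trivial_group (homology_group p X)"
proof -
  let ?U = "(\<lambda>x. {x}) ` topspace X"
  have X: "X = discrete_topology (topspace X)"
  proof -
    have "openin X {x}" if "x \<in> topspace X" for x
    proof -
      have "closedin X (topspace X - {x})"
        using assms(1,2) by (intro closedin_Hausdorff_finite) auto
      moreover have "{x} = topspace X - (topspace X - {x})" using that by auto
      ultimately show ?thesis by (metis openin_diff openin_topspace)
    qed
    then show ?thesis using discrete_topology_unique[of "topspace X" X] by simp
  qed
  have "(\<lambda>x. gfinprod (homology_group p X) (\<lambda>V. hom_induced p (subtopology X V) {} X {} id (x V)) ?U)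
      \<in> iso (sum_group ?U (\<lambda>S. homology_group p (subtopology X S))) (homology_group p X)"
  proof (rule homology_additivity_axiom_gen)
    show "pairwise disjnt ?U" by (auto simp: pairwise_def disjnt_def)
    fix C T assume C: "path_connectedin X C" "T \<in> ?U" "\<not> disjnt C T"
    then have "connectedin X C" using path_connectedin_imp_connectedin by blast
    then have "\<exists>a. C \<subseteq> {a}" by (subst (asm) X) (simp add: connectedin_discrete_topology)
    then show "C \<subseteq> T" using C(2,3) by (auto simp: disjnt_def)
  qed auto
  then have iso: "sum_group ?U (\<lambda>S. homology_group p (subtopology X S)) \<cong> homology_group p X"
    by (auto simp: is_iso_def)
  have "trivial_group (homology_group p (subtopology X S))" if "S \<in> ?U" for S
    using that assms(3) by (auto intro: homology_dimension_axiom)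
  then have "trivial_group (sum_group ?U (\<lambda>S. homology_group p (subtopology X S)))"
    by (auto simp: trivial_group_def carrier_sum_group fun_eq_iff restrict_def PiE_iff extensional_def split: if_splits)
  then show ?thesis using isomorphic_group_triviality1[OF iso] by simp
qed

text \<open>The identity on homology is induced by r and therefore factors through the homology of
  the finite image of r.\<close>

lemma trivial_homology_homotopic_finite:
  assumes "Hausdorff_space X" "homotopic_with (\<lambda>_. True) X X id r" "finite (r ` topspace X)" "p \<noteq> 0"
  shows "trivial_group (homology_group p X)"
proof -
  let ?D = "subtopology X (r ` topspace X)"
  have r: "continuous_map X X r" using assms(2) homotopic_with_imp_continuous_maps by blast
  then have top: "topspace ?D = r ` topspace X" by (auto simp: continuous_map_def)
  have triv: "trivial_group (homology_group p ?D)"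
    using assms(1,3,4) Hausdorff_space_subtopology by (intro trivial_homology_finite_Hausdorff) (auto simp: top)
  have "carrier (homology_group p X) \<subseteq> {\<one>\<^bsub>homology_group p X\<^esub>}"
  proof
    fix c assume c: "c \<in> carrier (homology_group p X)"
    have "c = hom_induced p X {} X {} id c" using c by (simp only: hom_induced_id)
    also have "\<dots> = hom_induced p X {} X {} r c"
      by (simp only: homology_homotopy_empty[OF assms(2)])
    also have "hom_induced p X {} X {} r = hom_induced p ?D {} X {} id \<circ> hom_induced p X {} ?D {} r"
      using r by (subst hom_induced_compose_empty[symmetric]) (auto simp: continuous_map_in_subtopology)
    finally have c': "c = hom_induced p ?D {} X {} id (hom_induced p X {} ?D {} r c)" by simp
    have "hom_induced p X {} ?D {} r c \<in> carrier (homology_group p ?D)" by (rule hom_induced_carrier)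
    then have one: "hom_induced p X {} ?D {} r c = \<one>\<^bsub>homology_group p ?D\<^esub>"
      using triv by (auto simp: trivial_group_def)
    show "c \<in> {\<one>\<^bsub>homology_group p X\<^esub>}"
      using c' hom_one[OF hom_induced_empty_hom[of p ?D X id]] unfolding one by simp
  qed
  moreover have "\<one>\<^bsub>homology_group p X\<^esub> \<in> carrier (homology_group p X)"
    by (rule monoid.one_closed[OF group.is_monoid[OF group_relative_homology_group]])
  ultimately have "carrier (homology_group p X) = {\<one>\<^bsub>homology_group p X\<^esub>}" by blast
  then show ?thesis by (simp add: trivial_group_def)
qed

lemma (in generated_binoid) trivial_homology_real_spec:
  assumes "p \<noteq> 0"
  shows "trivial_group (homology_group p (real_spec_topology M S))"
proof -
  let ?Y = "coordinates S ` real_spec M"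
  obtain r where r: "homotopic_with_canon (\<lambda>_. True) ?Y ?Y id r" "finite (r ` ?Y)"
    using power_closed_homotopic_finite[OF finite_S power_closed_image_coordinates] .
  have "Hausdorff_space (top_of_set ?Y)"
    unfolding euclidean_product_topology[symmetric]
    by (intro Hausdorff_space_subtopology) (simp add: Hausdorff_space_product_topology)
  then have "trivial_group (homology_group p (top_of_set ?Y))"
    using r assms by (intro trivial_homology_homotopic_finite) auto
  moreover have "homology_group p (top_of_set ?Y) \<cong> homology_group p (real_spec_topology M S)"
    using homeomorphic_image_coordinates homeomorphic_space_sym
    by (intro homeomorphic_space_imp_isomorphic_homology_groups) blast
  ultimately show ?thesis using isomorphic_group_triviality1[OF _ group_relative_homology_group] by blast
qed

lemma cycle_is_boundary_of_trivial_homology: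
  assumes "trivial_group (homology_group (int q) X)" "singular_chain q X c" "chain_boundary q c = 0"
  obtains d where "singular_chain (Suc q) X d" "chain_boundary (Suc q) d = c"
proof -
  have "homologous_rel_set q X {} c \<in> carrier (homology_group (int q) X)"
    using assms by (auto simp: carrier_relative_homology_group singular_cycle)
  then have "homologous_rel_set q X {} c = singular_relboundary_set q X {}"
    using assms(1) by (simp add: trivial_group_def)
  then have "singular_relboundary q X {} c" by (simp add: homologous_rel_set_eq_relboundary)
  then show ?thesis using that by (auto simp: singular_boundary)
qed

section \<open>Real points in a chart\<close>

lemma binoid_isoD:
  assumes "f \<in> binoid_iso M N"
  shows "x \<in> carrier M \<Longrightarrow> f x \<in> carrier N"
    "x \<in> carrier M \<Longrightarrow> y \<in> carrier M \<Longrightarrow> f (x \<otimes>\<^bsub>M\<^esub> y) = f x \<otimes>\<^bsub>N\<^esub> f y"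
    "f \<one>\<^bsub>M\<^esub> = \<one>\<^bsub>N\<^esub>" "f (absorb M) = absorb N" "bij_betw f (carrier M) (carrier N)"
  using assms by (auto simp: binoid_iso_def binoid_hom_def hom_def)

lemma binoid_homD:
  assumes "f \<in> binoid_hom M N"
  shows "x \<in> carrier M \<Longrightarrow> f x \<in> carrier N"
    "x \<in> carrier M \<Longrightarrow> y \<in> carrier M \<Longrightarrow> f (x \<otimes>\<^bsub>M\<^esub> y) = f x \<otimes>\<^bsub>N\<^esub> f y"
    "f \<one>\<^bsub>M\<^esub> = \<one>\<^bsub>N\<^esub>" "f (absorb M) = absorb N"
  using assms by (auto simp: binoid_hom_def hom_def)

lemma restr_Units:
  assumes "f \<in> binoid_hom M N" "s \<in> Units M"
  shows "f s \<in> Units N"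
proof -
  note f = binoid_homD[OF assms(1)]
  obtain t where t: "s \<in> carrier M" "t \<in> carrier M" "t \<otimes>\<^bsub>M\<^esub> s = \<one>\<^bsub>M\<^esub>" "s \<otimes>\<^bsub>M\<^esub> t = \<one>\<^bsub>M\<^esub>"
    using assms(2) by (auto simp: Units_def)
  then have "f t \<otimes>\<^bsub>N\<^esub> f s = \<one>\<^bsub>N\<^esub>" "f s \<otimes>\<^bsub>N\<^esub> f t = \<one>\<^bsub>N\<^esub>"
    using f(2)[of t s] f(2)[of s t] f(3) by simp_all
  then show ?thesis using f(1)[of s] f(1)[of t] t by (auto simp: Units_def)
qed

text \<open>If f dominates P, then D(f) is the least open neighbourhood of P.\<close>

definition dominates :: "'m pointed_monoid \<Rightarrow> 'm \<Rightarrow> 'm set \<Rightarrow> bool" where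
  "dominates M f P \<longleftrightarrow> f \<in> carrier M \<and> f \<notin> P \<and>
     (\<forall>g\<in>carrier M. g \<notin> P \<longrightarrow> (\<exists>m\<in>carrier M. \<exists>n::nat. g \<otimes>\<^bsub>M\<^esub> m = f [^]\<^bsub>M\<^esub> n))"

context binoid
begin

lemma ex_dominates:
  assumes "fg_binoid M" "P \<in> spec M"
  shows "\<exists>f. dominates M f P"
proof -
  obtain S where "finite S" "generates_binoid M S" using assms(1) by (auto simp: fg_binoid_def)
  then show ?thesis
    using prime_dominating_element[of S P] assms(2) unfolding dominates_def by metis
qed

lemma dominates_not_mem:
  assumes "dominates M f P" "Q \<in> spec M" "f \<notin> Q" "g \<in> carrier M" "g \<notin> P"
  shows "g \<notin> Q"
proof -
  obtain m and n :: nat where "m \<in> carrier M" "g \<otimes> m = f [^] n" using assms by (auto simp: dominates_def)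
  then show ?thesis
    using prime_pow[of Q f n] prime_mult_iff[of Q g m] assms by (auto simp: dominates_def)
qed

lemma topspace_spec_topology: "topspace (spec_topology M) = spec M"
proof -
  have "basic_open M \<one> = spec M" using one_notin_prime by (auto simp: basic_open_def)
  then show ?thesis
    unfolding spec_topology_def topology_generated_by_topspace by (auto simp: basic_open_def)
qed

text \<open>That T contains D(f) once it contains P is preserved by intersections and unions. For a
  basic set D(g) it holds because g divides a power of f.\<close>

lemma basic_open_subset_open:
  assumes "openin (spec_topology M) T" "P \<in> T" "dominates M f P"
  shows "basic_open M f \<subseteq> T"
proof -
  have "generate_topology_on (basic_open M ` carrier M) T"
    using assms(1) by (simp add: spec_topology_def openin_topology_generated_by_iff)
  then have "P \<in> T \<longrightarrow> basic_open M f \<subseteq> T"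
  proof induction
    case (Basis s)
    then obtain g where g: "g \<in> carrier M" "s = basic_open M g" by blast
    then show ?case using dominates_not_mem[OF assms(3)] by (auto simp: basic_open_def)
  qed auto
  then show ?thesis using assms(2) by blast
qed

end

definition local_hom_at :: "('x, 's) binoided_space \<Rightarrow> 'x \<Rightarrow> ('x set \<Rightarrow> 's \<Rightarrow> real) \<Rightarrow> 'x set \<Rightarrow> bool" where
  "local_hom_at X x \<phi> U \<longleftrightarrow> \<phi> U \<in> real_spec (sections X U) \<and>
     (\<forall>V. openin (space X) V \<and> x \<in> V \<and> V \<subseteq> U \<longrightarrow> (\<forall>s\<in>carrier (sections X U). \<phi> V (restr X U V s) = \<phi> U s)) \<and>
     (\<forall>s\<in>carrier (sections X U). \<phi> U s \<noteq> 0 \<longrightarrow>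
        (\<exists>V. openin (space X) V \<and> x \<in> V \<and> V \<subseteq> U \<and> restr X U V s \<in> Units (sections X V)))"

lemma real_points_iff:
  "(x, \<phi>) \<in> real_points X \<longleftrightarrow> x \<in> topspace (space X) \<and> \<phi> \<in> extensional {U. openin (space X) U \<and> x \<in> U} \<and>
     (\<forall>U. openin (space X) U \<and> x \<in> U \<longrightarrow> local_hom_at X x \<phi> U)"
  unfolding real_points_def local_hom_at_def by simp

locale presheaf =
  fixes X :: "('x, 's) binoided_space"
  assumes presheaf: "binoid_presheaf X"
begin

lemma binoid_sections: "openin (space X) U \<Longrightarrow> binoid (sections X U)"
  and restr_hom: "openin (space X) U \<Longrightarrow> openin (space X) W \<Longrightarrow> W \<subseteq> U \<Longrightarrow>
    restr X U W \<in> binoid_hom (sections X U) (sections X W)"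
  and restr_restr: "openin (space X) U \<Longrightarrow> openin (space X) W \<Longrightarrow> openin (space X) W' \<Longrightarrow> W' \<subseteq> W \<Longrightarrow> W \<subseteq> U \<Longrightarrow>
    s \<in> carrier (sections X U) \<Longrightarrow> restr X W W' (restr X U W s) = restr X U W' s"
  using presheaf unfolding binoid_presheaf_def by simp_all

lemma real_pointsD:
  assumes "P \<in> real_points X"
  shows "fst P \<in> topspace (space X)" "snd P \<in> extensional {U. openin (space X) U \<and> fst P \<in> U}"
    "openin (space X) U \<Longrightarrow> fst P \<in> U \<Longrightarrow> snd P U \<in> real_spec (sections X U)"
    "openin (space X) U \<Longrightarrow> fst P \<in> U \<Longrightarrow> openin (space X) W \<Longrightarrow> fst P \<in> W \<Longrightarrow> W \<subseteq> U \<Longrightarrow>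
      s \<in> carrier (sections X U) \<Longrightarrow> snd P W (restr X U W s) = snd P U s"
    "openin (space X) U \<Longrightarrow> fst P \<in> U \<Longrightarrow> s \<in> carrier (sections X U) \<Longrightarrow> snd P U s \<noteq> 0 \<Longrightarrow>
      \<exists>W. openin (space X) W \<and> fst P \<in> W \<and> W \<subseteq> U \<and> restr X U W s \<in> Units (sections X W)"
proof -
  obtain x \<phi> where eq: "P = (x, \<phi>)" by (cases P)
  have *: "x \<in> topspace (space X)" "\<phi> \<in> extensional {U. openin (space X) U \<and> x \<in> U}"
    "\<And>U. openin (space X) U \<and> x \<in> U \<Longrightarrow> local_hom_at X x \<phi> U"
    using assms unfolding eq real_points_iff by simp_all
  show "fst P \<in> topspace (space X)" "snd P \<in> extensional {U. openin (space X) U \<and> fst P \<in> U}"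
    using *(1,2) by (simp_all add: eq)
  assume U: "openin (space X) U" "fst P \<in> U"
  then have l: "local_hom_at X x \<phi> U" by (intro *(3)) (simp add: eq)
  then show "snd P U \<in> real_spec (sections X U)" by (simp add: local_hom_at_def eq)
  show "snd P W (restr X U W s) = snd P U s"
    if "openin (space X) W" "fst P \<in> W" "W \<subseteq> U" "s \<in> carrier (sections X U)"
    using l that by (simp add: local_hom_at_def eq)
  show "\<exists>W. openin (space X) W \<and> fst P \<in> W \<and> W \<subseteq> U \<and> restr X U W s \<in> Units (sections X W)"
    if "s \<in> carrier (sections X U)" "snd P U s \<noteq> 0"
    using l that by (simp add: local_hom_at_def eq)
qed

end

section \<open>Fractions as sections and the coordinates of real points in one chart\<close>

locale chart = presheaf X for X :: "('x, 's) binoided_space" +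
  fixes V :: "'x set" and M :: "'m pointed_monoid" and h :: "'x \<Rightarrow> 'm set"
    and \<gamma> :: "'m \<Rightarrow> ('m \<times> nat) set \<Rightarrow> 's"
  assumes chart: "affine_chart X V M h \<gamma>"
begin

lemma open_V: "openin (space X) V" and fg: "fg_binoid M"
  and homeo_h: "homeomorphic_map (subtopology (space X) V) (spec_topology M) h"
  using chart by (auto simp: affine_chart_def)

sublocale M: binoid M using fg by (simp add: fg_binoid_def)

definition cdom :: "'m \<Rightarrow> 'x set" where "cdom f = {x \<in> V. h x \<in> basic_open M f}"

text \<open>The section a / f^i over D(f).\<close>

definition elt :: "'m \<Rightarrow> 'm \<Rightarrow> nat \<Rightarrow> 's" where "elt f a i = \<gamma> f (fraction M f a i)"

lemma topspace_V: "topspace (subtopology (space X) V) = V"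
  using openin_subset[OF open_V] by auto

lemma h_image: "h ` V = spec M" and h_inj: "inj_on h V"
  using homeomorphic_imp_surjective_map[OF homeo_h] homeomorphic_imp_injective_map[OF homeo_h]
  unfolding topspace_V M.topspace_spec_topology by blast+

lemma h_spec: "x \<in> V \<Longrightarrow> h x \<in> spec M"
  using h_image by blast

lemma dom_iff: "x \<in> cdom f \<longleftrightarrow> x \<in> V \<and> f \<notin> h x"
  using h_spec by (auto simp: cdom_def basic_open_def)

lemma dom_subset: "cdom f \<subseteq> V" by (auto simp: cdom_def)

lemma dom_one: "cdom \<one>\<^bsub>M\<^esub> = V"
  using M.one_notin_prime h_spec by (auto simp: dom_iff)

lemma open_dom:
  assumes "f \<in> carrier M"
  shows "openin (space X) (cdom f)"
proof -
  have "openin (spec_topology M) (basic_open M f)"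
    unfolding spec_topology_def by (rule topology_generated_by_Basis) (use assms in simp)
  then have "openin (subtopology (space X) V) {x \<in> topspace (subtopology (space X) V). h x \<in> basic_open M f}"
    using homeomorphic_imp_continuous_map[OF homeo_h] openin_continuous_map_preimage by blast
  then have "openin (subtopology (space X) V) (cdom f)" by (simp only: topspace_V cdom_def)
  then show ?thesis using openin_open_subtopology[OF open_V] by blast
qed

lemma ex_dominates: "x \<in> V \<Longrightarrow> \<exists>f. dominates M f (h x)"
  using M.ex_dominates[OF fg] h_spec by blast

lemma dominates_dom: "dominates M f (h x) \<Longrightarrow> x \<in> V \<Longrightarrow> f \<in> carrier M \<and> f \<notin> h x \<and> x \<in> cdom f"
  by (simp add: dominates_def dom_iff)

text \<open>Sections over this least neighbourhood play the part of the stalk at x.\<close>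

lemma dom_least:
  assumes "dominates M f (h x)" "x \<in> V" "openin (space X) U" "x \<in> U"
  shows "cdom f \<subseteq> U"
proof -
  have "openin (subtopology (space X) V) (U \<inter> V)" using assms(3) by (simp add: openin_subtopology_Int)
  then have "openin (spec_topology M) (h ` (U \<inter> V))"
    using homeomorphic_imp_open_map[OF homeo_h] by (simp add: open_map_def)
  then have "basic_open M f \<subseteq> h ` (U \<inter> V)"
    using M.basic_open_subset_open assms by blast
  then show ?thesis using h_inj by (fastforce simp: cdom_def inj_on_def)
qed

lemma \<gamma>_iso: "f \<in> carrier M \<Longrightarrow> \<gamma> f \<in> binoid_iso (localization M f) (sections X (cdom f))"
  using chart by (simp add: affine_chart_def cdom_def)

lemma elt_closed: "f \<in> carrier M \<Longrightarrow> a \<in> carrier M \<Longrightarrow> elt f a i \<in> carrier (sections X (cdom f))"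
  unfolding elt_def by (rule binoid_isoD(1)[OF \<gamma>_iso M.fraction_mem])

lemma elt_mult:
  assumes "f \<in> carrier M" "a \<in> carrier M" "b \<in> carrier M"
  shows "elt f a i \<otimes>\<^bsub>sections X (cdom f)\<^esub> elt f b j = elt f (a \<otimes>\<^bsub>M\<^esub> b) (i + j)"
  using binoid_isoD(2)[OF \<gamma>_iso[OF assms(1)] M.fraction_mem[OF assms(1,2)] M.fraction_mem[OF assms(1,3)], of i j]
    M.mult_fraction[OF assms] by (simp add: elt_def)

lemma elt_one: "f \<in> carrier M \<Longrightarrow> elt f \<one>\<^bsub>M\<^esub> 0 = \<one>\<^bsub>sections X (cdom f)\<^esub>"
  using binoid_isoD(3)[OF \<gamma>_iso] by (simp add: elt_def M.one_localization)

lemma elt_absorb: "f \<in> carrier M \<Longrightarrow> elt f (absorb M) 0 = absorb (sections X (cdom f))"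
  using binoid_isoD(4)[OF \<gamma>_iso] by (simp add: elt_def M.absorb_localization)

lemma elt_eq_iff:
  assumes "f \<in> carrier M" "a \<in> carrier M" "b \<in> carrier M"
  shows "elt f a i = elt f b j \<longleftrightarrow> fraction M f a i = fraction M f b j"
  using binoid_isoD(5)[OF \<gamma>_iso[OF assms(1)]] M.fraction_mem assms
  unfolding elt_def bij_betw_def inj_on_def by metis

lemma eltE:
  assumes "f \<in> carrier M" "s \<in> carrier (sections X (cdom f))"
  obtains a i where "a \<in> carrier M" "s = elt f a i"
proof -
  obtain c where "c \<in> carrier (localization M f)" "s = \<gamma> f c"
    using assms binoid_isoD(5)[OF \<gamma>_iso[OF assms(1)]] unfolding bij_betw_def by blast
  then show ?thesis using M.localizationE[of c f] that unfolding elt_def by metis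
qed

lemma elt_pow_pow: "f \<in> carrier M \<Longrightarrow> elt f (f [^]\<^bsub>M\<^esub> n) n = \<one>\<^bsub>sections X (cdom f)\<^esub>"
  unfolding elt_one[symmetric] by (subst elt_eq_iff) (auto simp: M.fraction_eq_iff)

lemma elt_restr:
  assumes "f \<in> carrier M" "a \<in> carrier M"
  shows "restr X V (cdom f) (elt \<one>\<^bsub>M\<^esub> a 0) = elt f a 0"
proof -
  have "basic_open M f \<subseteq> basic_open M \<one>\<^bsub>M\<^esub>"
    using M.one_notin_prime by (auto simp: basic_open_def)
  then have "restr X (cdom \<one>\<^bsub>M\<^esub>) (cdom f) (\<gamma> \<one>\<^bsub>M\<^esub> (fraction M \<one>\<^bsub>M\<^esub> a 0)) = \<gamma> f (loc_map M \<one>\<^bsub>M\<^esub> f (fraction M \<one>\<^bsub>M\<^esub> a 0))"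
    using chart assms M.fraction_mem[OF M.one_closed assms(2)] unfolding affine_chart_def cdom_def by blast
  then show ?thesis using M.loc_map_fraction[OF assms] by (simp add: elt_def dom_one)
qed

lemma elt_Units:
  assumes "f \<in> carrier M" "a \<in> carrier M" "m \<in> carrier M" "a \<otimes>\<^bsub>M\<^esub> m = f [^]\<^bsub>M\<^esub> (n::nat)"
  shows "elt f a i \<in> Units (sections X (cdom f))"
proof -
  interpret D: binoid "sections X (cdom f)" using binoid_sections[OF open_dom[OF assms(1)]] .
  \<comment> \<open>The inverse of a / f^i is m f^i / f^n.\<close>
  let ?b = "m \<otimes>\<^bsub>M\<^esub> f [^]\<^bsub>M\<^esub> i"
  have "a \<otimes>\<^bsub>M\<^esub> ?b = f [^]\<^bsub>M\<^esub> (i + n)"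
    using assms by (simp add: M.m_assoc[symmetric] M.nat_pow_mult add.commute)
  then have "elt f a i \<otimes>\<^bsub>sections X (cdom f)\<^esub> elt f ?b n = \<one>\<^bsub>sections X (cdom f)\<^esub>"
    using assms elt_pow_pow[of f "i + n"] by (simp add: elt_mult)
  moreover have "elt f ?b n \<otimes>\<^bsub>sections X (cdom f)\<^esub> elt f a i = elt f a i \<otimes>\<^bsub>sections X (cdom f)\<^esub> elt f ?b n"
    using elt_closed assms by (intro D.m_comm) simp_all
  ultimately show ?thesis
    using elt_closed[OF assms(1,2), of i] elt_closed[of f ?b n] assms unfolding Units_def by auto
qed

lemma Units_elt:
  assumes "f \<in> carrier M" "a \<in> carrier M" "elt f a i \<in> Units (sections X (cdom f))"
  shows "\<exists>m\<in>carrier M. \<exists>n::nat. a \<otimes>\<^bsub>M\<^esub> m = f [^]\<^bsub>M\<^esub> n"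
proof -
  obtain s where "s \<in> carrier (sections X (cdom f))" "elt f a i \<otimes>\<^bsub>sections X (cdom f)\<^esub> s = \<one>\<^bsub>sections X (cdom f)\<^esub>"
    using assms(3) by (auto simp: Units_def)
  then obtain b j where b: "b \<in> carrier M" "elt f (a \<otimes>\<^bsub>M\<^esub> b) (i + j) = elt f \<one>\<^bsub>M\<^esub> 0"
    using eltE[OF assms(1)] elt_mult[OF assms(1,2)] elt_one[OF assms(1)] by metis
  then obtain l :: nat where "f [^]\<^bsub>M\<^esub> l \<otimes>\<^bsub>M\<^esub> (a \<otimes>\<^bsub>M\<^esub> b) = f [^]\<^bsub>M\<^esub> l \<otimes>\<^bsub>M\<^esub> f [^]\<^bsub>M\<^esub> (i + j)"
    using assms by (auto simp: elt_eq_iff M.fraction_eq_iff)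
  then have "a \<otimes>\<^bsub>M\<^esub> (f [^]\<^bsub>M\<^esub> l \<otimes>\<^bsub>M\<^esub> b) = f [^]\<^bsub>M\<^esub> (l + (i + j))"
    using assms b(1) by (simp add: M.m_lcomm M.nat_pow_mult)
  then show ?thesis using assms b(1) by (meson M.m_closed M.nat_pow_closed)
qed

abbreviation coord :: "'x \<times> ('x set \<Rightarrow> 's \<Rightarrow> real) \<Rightarrow> 'm \<Rightarrow> real" where
  "coord \<equiv> real_coord V M \<gamma>"

lemma coord_eq: "m \<in> carrier M \<Longrightarrow> coord P m = snd P V (elt \<one>\<^bsub>M\<^esub> m 0)"
  by (simp add: real_coord_def elt_def)

lemma coord_mem:
  assumes "P \<in> real_points_on X V"
  shows "coord P \<in> real_spec M"
proof -
  have P: "P \<in> real_points X" "fst P \<in> V" using assms by (auto simp: real_points_on_def)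
  have s: "snd P V \<in> real_spec (sections X V)" using real_pointsD(3)[OF P(1) open_V P(2)] .
  have e: "elt \<one>\<^bsub>M\<^esub> m 0 \<in> carrier (sections X V)" if "m \<in> carrier M" for m
    using elt_closed[of "\<one>\<^bsub>M\<^esub>" m 0] that by (simp add: dom_one)
  show ?thesis
    unfolding real_spec_iff
  proof (intro conjI ballI)
    show "coord P \<in> extensional (carrier M)" by (simp add: real_coord_def)
    show "coord P \<one>\<^bsub>M\<^esub> = 1" using s elt_one[of "\<one>\<^bsub>M\<^esub>"] by (simp add: coord_eq dom_one real_spec_iff)
    show "coord P (absorb M) = 0"
      using s elt_absorb[of "\<one>\<^bsub>M\<^esub>"] M.absorb_closed by (simp add: coord_eq dom_one real_spec_iff)
    fix a b assume ab: "a \<in> carrier M" "b \<in> carrier M"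
    have "snd P V (elt \<one>\<^bsub>M\<^esub> a 0 \<otimes>\<^bsub>sections X V\<^esub> elt \<one>\<^bsub>M\<^esub> b 0) = snd P V (elt \<one>\<^bsub>M\<^esub> a 0) * snd P V (elt \<one>\<^bsub>M\<^esub> b 0)"
      using s e[OF ab(1)] e[OF ab(2)] by (simp add: real_spec_iff)
    then show "coord P (a \<otimes>\<^bsub>M\<^esub> b) = coord P a * coord P b"
      using elt_mult[of "\<one>\<^bsub>M\<^esub>" a b 0 0] ab by (simp add: coord_eq dom_one)
  qed
qed

lemma real_point_dom:
  assumes "P \<in> real_points_on X V" "f \<in> carrier M" "f \<notin> h (fst P)"
  shows "snd P (cdom f) \<in> real_spec (sections X (cdom f))"
    "a \<in> carrier M \<Longrightarrow> snd P (cdom f) (elt f a 0) = coord P a"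
proof -
  have P: "P \<in> real_points X" "fst P \<in> V" "fst P \<in> cdom f" using assms by (auto simp: real_points_on_def dom_iff)
  show "snd P (cdom f) \<in> real_spec (sections X (cdom f))"
    using real_pointsD(3)[OF P(1) open_dom[OF assms(2)] P(3)] .
  assume a: "a \<in> carrier M"
  then show "snd P (cdom f) (elt f a 0) = coord P a"
    using real_pointsD(4)[OF P(1) open_V P(2) open_dom[OF assms(2)] P(3) dom_subset, of "elt \<one>\<^bsub>M\<^esub> a 0"]
      elt_closed[of "\<one>\<^bsub>M\<^esub>" a 0] elt_restr[OF assms(2) a] by (simp add: dom_one coord_eq)
qed

text \<open>If m is outside the prime, it is invertible on D(m) and has a nonzero value. Conversely
  a nonzero value makes the germ of m a unit by locality, so m divides a power of an f outside the
  prime. The coordinates therefore determine the underlying point.\<close>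

lemma coord_eq_0_iff:
  assumes P: "P \<in> real_points_on X V" and m: "m \<in> carrier M"
  shows "coord P m = 0 \<longleftrightarrow> m \<in> h (fst P)"
proof
  have rp: "P \<in> real_points X" "fst P \<in> V" using P by (auto simp: real_points_on_def)
  show "m \<in> h (fst P)" if z: "coord P m = 0"
  proof (rule ccontr)
    assume n: "m \<notin> h (fst P)"
    note d = real_point_dom[OF P m n]
    have "elt m m 0 \<otimes>\<^bsub>sections X (cdom m)\<^esub> elt m \<one>\<^bsub>M\<^esub> 1 = \<one>\<^bsub>sections X (cdom m)\<^esub>"
      using elt_mult[OF m m M.one_closed, of 0 1] elt_pow_pow[OF m, of 1] m by simp
    moreover have "snd P (cdom m) (elt m m 0 \<otimes>\<^bsub>sections X (cdom m)\<^esub> elt m \<one>\<^bsub>M\<^esub> 1)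
        = snd P (cdom m) (elt m m 0) * snd P (cdom m) (elt m \<one>\<^bsub>M\<^esub> 1)"
      using d(1) elt_closed[OF m m, of 0] elt_closed[OF m M.one_closed, of 1] by (simp add: real_spec_iff)
    ultimately have "coord P m * snd P (cdom m) (elt m \<one>\<^bsub>M\<^esub> 1) = 1"
      using d(1) d(2)[OF m] by (simp add: real_spec_iff)
    then show False using z by simp
  qed
  show "coord P m = 0" if z: "m \<in> h (fst P)"
  proof (rule ccontr)
    assume "coord P m \<noteq> 0"
    then have "snd P V (elt \<one>\<^bsub>M\<^esub> m 0) \<noteq> 0" using m by (simp add: coord_eq)
    moreover have e: "elt \<one>\<^bsub>M\<^esub> m 0 \<in> carrier (sections X V)"
      using elt_closed[of "\<one>\<^bsub>M\<^esub>" m 0] m by (simp add: dom_one)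
    ultimately obtain W where W: "openin (space X) W" "fst P \<in> W" "W \<subseteq> V" "restr X V W (elt \<one>\<^bsub>M\<^esub> m 0) \<in> Units (sections X W)"
      using real_pointsD(5)[OF rp(1) open_V rp(2)] by blast
    obtain f where f: "dominates M f (h (fst P))" using ex_dominates rp(2) by blast
    note fd = dominates_dom[OF f rp(2)]
    have sub: "cdom f \<subseteq> W" using dom_least[OF f rp(2) W(1,2)] .
    have "restr X W (cdom f) (restr X V W (elt \<one>\<^bsub>M\<^esub> m 0)) \<in> Units (sections X (cdom f))"
      using restr_Units[OF restr_hom[OF W(1) open_dom sub] W(4)] fd by blast
    then have "elt f m 0 \<in> Units (sections X (cdom f))"
      using restr_restr[OF open_V W(1) open_dom sub W(3) e] elt_restr[OF _ m] fd by simp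
    then obtain b and n :: nat where "b \<in> carrier M" "m \<otimes>\<^bsub>M\<^esub> b = f [^]\<^bsub>M\<^esub> n"
      using Units_elt[OF _ m] fd by blast
    then show False
      using z M.prime_mult_iff[OF h_spec[OF rp(2)] m, of b] M.prime_pow[OF h_spec[OF rp(2)], of f n] fd by auto
  qed
qed

lemma real_point_elt:
  assumes P: "P \<in> real_points_on X V" and f: "f \<in> carrier M" "f \<notin> h (fst P)" and a: "a \<in> carrier M"
  shows "snd P (cdom f) (elt f a i) = coord P a / coord P f ^ i"
proof -
  note d = real_point_dom[OF P f]
  have nz: "coord P f \<noteq> 0" using coord_eq_0_iff[OF P f(1)] f(2) by simp
  have "elt f a i \<otimes>\<^bsub>sections X (cdom f)\<^esub> elt f (f [^]\<^bsub>M\<^esub> i) 0 = elt f a 0"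
    using f a by (simp add: elt_mult elt_eq_iff M.fraction_eq_iff)
  moreover have "snd P (cdom f) (elt f a i \<otimes>\<^bsub>sections X (cdom f)\<^esub> elt f (f [^]\<^bsub>M\<^esub> i) 0)
      = snd P (cdom f) (elt f a i) * snd P (cdom f) (elt f (f [^]\<^bsub>M\<^esub> i) 0)"
    using d(1) elt_closed[OF f(1) a, of i] elt_closed[OF f(1), of "f [^]\<^bsub>M\<^esub> i" 0] f(1)
    by (simp add: real_spec_iff)
  ultimately have "snd P (cdom f) (elt f a i) * coord P (f [^]\<^bsub>M\<^esub> i) = coord P a"
    using d(2)[OF a] d(2)[of "f [^]\<^bsub>M\<^esub> i"] f(1) by simp
  then show ?thesis
    using nz M.real_spec_pow[OF coord_mem[OF P] f(1)] by (simp add: field_simps)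
qed

lemma real_point_value:
  assumes P: "P \<in> real_points_on X V" and U: "openin (space X) U" "fst P \<in> U"
    and f: "dominates M f (h (fst P))" and s: "s \<in> carrier (sections X U)"
    and a: "a \<in> carrier M" "restr X U (cdom f) s = elt f a i"
  shows "snd P U s = coord P a / coord P f ^ i"
proof -
  have rp: "P \<in> real_points X" "fst P \<in> V" using P by (auto simp: real_points_on_def)
  note fd = dominates_dom[OF f rp(2)]
  have "snd P U s = snd P (cdom f) (restr X U (cdom f) s)"
    using real_pointsD(4)[OF rp(1) U open_dom _ dom_least[OF f rp(2) U] s] fd by simp
  then show ?thesis using real_point_elt[OF P _ _ a(1)] fd a(2) by simp
qed

lemma restr_dom_eltE:
  assumes x: "x \<in> V" "dominates M f (h x)" and U: "openin (space X) U" "x \<in> U" and s: "s \<in> carrier (sections X U)"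
  obtains a i where "a \<in> carrier M" "restr X U (cdom f) s = elt f a i"
proof -
  note fd = dominates_dom[OF x(2,1)]
  have "restr X U (cdom f) s \<in> carrier (sections X (cdom f))"
    using binoid_homD(1)[OF restr_hom[OF U(1) open_dom dom_least[OF x(2,1) U]] s] fd by blast
  then show ?thesis using eltE fd that by metis
qed

text \<open>Equal coordinates have the same zero set, hence the same prime and the same underlying
  point. Any section restricts to a fraction a / f^i near it, whose value is computed from the
  coordinates of a and f.\<close>

lemma coord_inj: "inj_on coord (real_points_on X V)"
proof (rule inj_onI)
  fix P Q assume P: "P \<in> real_points_on X V" and Q: "Q \<in> real_points_on X V" and eq: "coord P = coord Q"
  have rP: "P \<in> real_points X" "fst P \<in> V" and rQ: "Q \<in> real_points X" "fst Q \<in> V"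
    using P Q by (auto simp: real_points_on_def)
  have sub: "h (fst P) \<subseteq> carrier M" "h (fst Q) \<subseteq> carrier M"
    using h_spec rP(2) rQ(2) unfolding spec_def binoid_prime_def binoid_ideal_def by blast+
  have "m \<in> h (fst P) \<longleftrightarrow> m \<in> h (fst Q)" if "m \<in> carrier M" for m
    using coord_eq_0_iff[OF P that] coord_eq_0_iff[OF Q that] eq by simp
  then have "h (fst P) = h (fst Q)" using sub by blast
  then have x: "fst P = fst Q" using h_inj rP(2) rQ(2) by (meson inj_onD)
  obtain f where f: "dominates M f (h (fst P))" using ex_dominates rP(2) by blast
  have "snd P = snd Q"
  proof (rule extensionalityI)
    show "snd P \<in> extensional {U. openin (space X) U \<and> fst P \<in> U}" using real_pointsD(2)[OF rP(1)] .
    show "snd Q \<in> extensional {U. openin (space X) U \<and> fst P \<in> U}" using real_pointsD(2)[OF rQ(1)] x by simp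
    fix U assume "U \<in> {U. openin (space X) U \<and> fst P \<in> U}"
    then have U: "openin (space X) U" "fst P \<in> U" "fst Q \<in> U" using x by auto
    show "snd P U = snd Q U"
    proof (rule extensionalityI)
      show "snd P U \<in> extensional (carrier (sections X U))"
        using real_pointsD(3)[OF rP(1) U(1,2)] by (simp add: real_spec_iff)
      show "snd Q U \<in> extensional (carrier (sections X U))"
        using real_pointsD(3)[OF rQ(1) U(1,3)] by (simp add: real_spec_iff)
      fix s assume s: "s \<in> carrier (sections X U)"
      obtain a i where a: "a \<in> carrier M" "restr X U (cdom f) s = elt f a i"
        using restr_dom_eltE[OF rP(2) f U(1,2) s] .
      show "snd P U s = snd Q U s"
        using real_point_value[OF P U(1,2) f s a] real_point_value[OF Q U(1,3) _ s a] f x eq by simp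
    qed
  qed
  then show "P = Q" using x by (simp add: prod_eq_iff)
qed

end

context chart
begin

text \<open>The zero set of \<psi> is a prime and gives the point x. A section is evaluated by
  restricting it to the least neighbourhood D(f) of x and applying \<psi> to numerator and
  denominator, which is possible as \<psi> f is nonzero.\<close>

lemma coord_surj: "real_spec M \<subseteq> coord ` real_points_on X V"
proof
  fix \<psi> assume \<psi>: "\<psi> \<in> real_spec M"
  have "{m \<in> carrier M. \<psi> m = 0} \<in> h ` V"
    unfolding h_image by (rule M.real_spec_zero_prime[OF \<psi>])
  then obtain x where x: "x \<in> V" "h x = {m \<in> carrier M. \<psi> m = 0}" by auto
  obtain f where f: "dominates M f (h x)" using ex_dominates x(1) by blast
  note fd = dominates_dom[OF f x(1)]
  have nz: "\<psi> f \<noteq> 0" using fd x(2) by simp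
  have xtop: "x \<in> topspace (space X)" using x(1) openin_subset[OF open_V] by blast
  define val where "val c = (THE r. \<exists>a\<in>carrier M. \<exists>i. c = elt f a i \<and> r = \<psi> a / \<psi> f ^ i)" for c
  have val: "val (elt f a i) = \<psi> a / \<psi> f ^ i" if a: "a \<in> carrier M" for a i
    unfolding val_def
  proof (rule the_equality)
    show "\<exists>b\<in>carrier M. \<exists>j. elt f a i = elt f b j \<and> \<psi> a / \<psi> f ^ i = \<psi> b / \<psi> f ^ j" using a by blast
    fix r assume "\<exists>b\<in>carrier M. \<exists>j. elt f a i = elt f b j \<and> r = \<psi> b / \<psi> f ^ j"
    then obtain b j where b: "b \<in> carrier M" "elt f a i = elt f b j" "r = \<psi> b / \<psi> f ^ j" by blast
    then obtain l :: nat where l: "f [^]\<^bsub>M\<^esub> l \<otimes>\<^bsub>M\<^esub> (a \<otimes>\<^bsub>M\<^esub> f [^]\<^bsub>M\<^esub> j) = f [^]\<^bsub>M\<^esub> l \<otimes>\<^bsub>M\<^esub> (b \<otimes>\<^bsub>M\<^esub> f [^]\<^bsub>M\<^esub> i)"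
      using elt_eq_iff[of f a b] M.fraction_eq_iff[of f a b] fd a by auto
    have ev: "\<psi> (f [^]\<^bsub>M\<^esub> l \<otimes>\<^bsub>M\<^esub> (c \<otimes>\<^bsub>M\<^esub> f [^]\<^bsub>M\<^esub> n)) = \<psi> f ^ l * (\<psi> c * \<psi> f ^ n)"
      if "c \<in> carrier M" for c n
      using \<psi> that fd M.real_spec_pow[OF \<psi>, of f] by (simp add: real_spec_iff)
    have "\<psi> f ^ l * (\<psi> a * \<psi> f ^ j) = \<psi> f ^ l * (\<psi> b * \<psi> f ^ i)"
      unfolding ev[OF a, of j, symmetric] ev[OF b(1), of i, symmetric] l ..
    then have "\<psi> b / \<psi> f ^ j = \<psi> a / \<psi> f ^ i" using nz by (simp add: frac_eq_eq)
    \<comment> \<open>Equality of fractions holds only up to a factor f^l; its value is nonzero and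
      cancels.\<close>
    then show "r = \<psi> a / \<psi> f ^ i" using b(3) by simp
  qed
  define nbhd where "nbhd = {U. openin (space X) U \<and> x \<in> U}"
  define \<phi> where "\<phi> = (\<lambda>U\<in>nbhd. \<lambda>s\<in>carrier (sections X U). val (restr X U (cdom f) s))"
  have \<phi>: "\<phi> U s = val (restr X U (cdom f) s)" if "openin (space X) U" "x \<in> U" "s \<in> carrier (sections X U)" for U s
    using that by (simp add: \<phi>_def nbhd_def)
  have sub: "cdom f \<subseteq> U" if "openin (space X) U" "x \<in> U" for U using dom_least[OF f x(1) that] .
  have odf: "openin (space X) (cdom f)" using open_dom fd by blast
  have "local_hom_at X x \<phi> U" if U: "openin (space X) U" "x \<in> U" for U
    unfolding local_hom_at_def
  proof (intro conjI allI impI ballI)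
    interpret B: binoid "sections X U" using binoid_sections[OF U(1)] .
    note rh = binoid_homD[OF restr_hom[OF U(1) odf sub[OF U]]]
    show "\<phi> U \<in> real_spec (sections X U)"
      unfolding real_spec_iff
    proof (intro conjI ballI)
      show "\<phi> U \<in> extensional (carrier (sections X U))" using U by (simp add: \<phi>_def nbhd_def)
      show "\<phi> U \<one>\<^bsub>sections X U\<^esub> = 1"
        using rh(3) elt_one[of f] val[of "\<one>\<^bsub>M\<^esub>" 0] fd \<psi> by (simp add: \<phi>[OF U] real_spec_iff)
      show "\<phi> U (absorb (sections X U)) = 0"
        using rh(4) elt_absorb[of f] val[of "absorb M" 0] fd \<psi> M.absorb_closed B.absorb_closed
        by (simp add: \<phi>[OF U] real_spec_iff)
      fix s t assume st: "s \<in> carrier (sections X U)" "t \<in> carrier (sections X U)"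
      obtain a i where a: "a \<in> carrier M" "restr X U (cdom f) s = elt f a i"
        using restr_dom_eltE[OF x(1) f U st(1)] .
      obtain b j where b: "b \<in> carrier M" "restr X U (cdom f) t = elt f b j"
        using restr_dom_eltE[OF x(1) f U st(2)] .
      have "restr X U (cdom f) (s \<otimes>\<^bsub>sections X U\<^esub> t) = elt f (a \<otimes>\<^bsub>M\<^esub> b) (i + j)"
        using rh(2)[OF st] elt_mult[of f a b i j] a b fd by simp
      then show "\<phi> U (s \<otimes>\<^bsub>sections X U\<^esub> t) = \<phi> U s * \<phi> U t"
        using a b st \<psi> by (simp add: \<phi>[OF U] val real_spec_iff power_add)
    qed
    show "\<phi> W (restr X U W s) = \<phi> U s"
      if W: "openin (space X) W \<and> x \<in> W \<and> W \<subseteq> U" and s: "s \<in> carrier (sections X U)" for W s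
    proof -
      have "restr X U W s \<in> carrier (sections X W)"
        using binoid_homD(1)[OF restr_hom[OF U(1)] s] W by blast
      then show ?thesis
        using restr_restr[OF U(1) _ odf sub _ s, of W] W U s by (simp add: \<phi>)
    qed
    show "\<exists>W. openin (space X) W \<and> x \<in> W \<and> W \<subseteq> U \<and> restr X U W s \<in> Units (sections X W)"
      if s: "s \<in> carrier (sections X U)" "\<phi> U s \<noteq> 0" for s
    proof -
      obtain a i where a: "a \<in> carrier M" "restr X U (cdom f) s = elt f a i"
        using restr_dom_eltE[OF x(1) f U s(1)] .
      then have "\<psi> a \<noteq> 0" using s by (auto simp: \<phi>[OF U] val)
      \<comment> \<open>Locality: a numerator outside the prime divides a power of f, so its
        fraction is a unit on D(f).\<close>
      then have "a \<notin> h x" using x(2) by simp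
      then obtain m and n :: nat where "m \<in> carrier M" "a \<otimes>\<^bsub>M\<^esub> m = f [^]\<^bsub>M\<^esub> n"
        using f a(1) unfolding dominates_def by blast
      then have "elt f a i \<in> Units (sections X (cdom f))" using elt_Units a(1) fd by blast
      then show ?thesis using a(2) odf fd sub[OF U] by (intro exI[of _ "cdom f"]) simp
    qed
  qed
  then have "(x, \<phi>) \<in> real_points X"
    unfolding real_points_iff using xtop by (simp add: \<phi>_def nbhd_def)
  then have P: "(x, \<phi>) \<in> real_points_on X V" using x(1) by (simp add: real_points_on_def)
  have "coord (x, \<phi>) = \<psi>"
  proof (rule extensionalityI)
    show "coord (x, \<phi>) \<in> extensional (carrier M)" by (simp add: real_coord_def)
    show "\<psi> \<in> extensional (carrier M)" using \<psi> by (simp add: real_spec_iff)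
    fix m assume m: "m \<in> carrier M"
    have "elt \<one>\<^bsub>M\<^esub> m 0 \<in> carrier (sections X V)"
      using elt_closed[of "\<one>\<^bsub>M\<^esub>" m 0] m by (simp add: dom_one)
    then show "coord (x, \<phi>) m = \<psi> m"
      using m fd x(1) open_V by (simp add: coord_eq \<phi> elt_restr val)
  qed
  then show "\<psi> \<in> coord ` real_points_on X V" using P by force
qed

lemma coord_image: "coord ` real_points_on X V = real_spec M"
  using coord_surj coord_mem by blast

end

section \<open>The topology on the real points\<close>

lemma openin_real_space:
  assumes "affine_chart X V (M :: 's pointed_monoid) h \<gamma>" "finite S" "generates_binoid M S"
    "openin (real_spec_topology M S) T"
  shows "openin (real_space (X :: ('x, 's) binoided_space)) {P \<in> real_points_on X V. real_coord V M \<gamma> P \<in> T}"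
  unfolding real_space_def by (rule topology_generated_by_Basis) (use assms in blast)

text \<open>Continuity of coordinate changes is local. Choose f with D(f) the least neighbourhood of
  the underlying point; it lies in W. Where \<psi> f is nonzero, each generator of the other chart
  restricts to a fraction, so its coordinate is a quotient of two evaluations of \<psi>.\<close>

lemma (in presheaf) real_coord_continuous_change:
  fixes M :: "'m pointed_monoid" and N :: "'n pointed_monoid"
  assumes M: "affine_chart X V M h \<gamma>" and S: "finite S" "generates_binoid M S"
    and N: "affine_chart X W N h' \<gamma>'" and S': "S' \<subseteq> carrier N"
    and T: "openin (real_spec_topology N S') T"
    and g: "\<And>\<psi>. \<psi> \<in> real_spec M \<Longrightarrow> g \<psi> \<in> real_points_on X V \<and> real_coord V M \<gamma> (g \<psi>) = \<psi>"
  shows "openin (real_spec_topology M S)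
    (g -` {P \<in> real_points_on X W. real_coord W N \<gamma>' P \<in> T} \<inter> topspace (real_spec_topology M S))"
proof -
  interpret A: chart X V M h \<gamma> using M by unfold_locales
  interpret B: chart X W N h' \<gamma>' using N by unfold_locales
  interpret G: generated_binoid M S using S by unfold_locales
  let ?RS = "real_spec_topology M S"
  let ?R = "g -` {P \<in> real_points_on X W. real_coord W N \<gamma>' P \<in> T} \<inter> topspace ?RS"
  have top: "topspace ?RS = real_spec M" using G.S_subset by simp
  have "\<exists>O'. openin ?RS O' \<and> \<psi>0 \<in> O' \<and> O' \<subseteq> ?R" if \<psi>0: "\<psi>0 \<in> ?R" for \<psi>0
  proof -
    have r0: "\<psi>0 \<in> real_spec M" "g \<psi>0 \<in> real_points_on X W" "real_coord W N \<gamma>' (g \<psi>0) \<in> T"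
      using \<psi>0 top by auto
    define x where "x = fst (g \<psi>0)"
    have x: "x \<in> V" "x \<in> W" using g[OF r0(1)] r0(2) by (auto simp: x_def real_points_on_def)
    obtain f where f: "dominates M f (h x)" using A.ex_dominates x(1) by blast
    note fd = A.dominates_dom[OF f x(1)]
    have sub: "A.cdom f \<subseteq> W" using A.dom_least[OF f x(1) B.open_V x(2)] .
    have "\<exists>a i. a \<in> carrier M \<and> restr X W (A.cdom f) (B.elt \<one>\<^bsub>N\<^esub> n 0) = A.elt f a i" if n: "n \<in> S'" for n
    proof -
      have "B.elt \<one>\<^bsub>N\<^esub> n 0 \<in> carrier (sections X W)"
        using B.elt_closed[of "\<one>\<^bsub>N\<^esub>" n 0] n S' by (auto simp: B.dom_one)
      then show ?thesis using A.restr_dom_eltE[OF x(1) f B.open_V x(2)] by metis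
    qed
    then obtain a i where a: "\<And>n. n \<in> S' \<Longrightarrow> a n \<in> carrier M"
      "\<And>n. n \<in> S' \<Longrightarrow> restr X W (A.cdom f) (B.elt \<one>\<^bsub>N\<^esub> n 0) = A.elt f (a n) (i n)" by metis
    \<comment> \<open>In coordinates this is the set of real points over D(f).\<close>
    define O0 where "O0 = {\<psi> \<in> topspace ?RS. \<psi> f \<in> - {0}}"
    have O0: "openin ?RS O0"
      unfolding O0_def by (rule openin_continuous_map_preimage[OF G.continuous_map_evaluate]) (use fd in auto)
    have mem: "g \<psi> \<in> real_points_on X W" and
      val: "\<And>n. n \<in> S' \<Longrightarrow> real_coord W N \<gamma>' (g \<psi>) n = \<psi> (a n) / \<psi> f ^ i n" if \<psi>: "\<psi> \<in> O0" for \<psi>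
    proof -
      have r: "\<psi> \<in> real_spec M" "\<psi> f \<noteq> 0" using \<psi> top by (auto simp: O0_def)
      note P = g[OF r(1), THEN conjunct1] and cP = g[OF r(1), THEN conjunct2]
      have fx: "f \<notin> h (fst (g \<psi>))" using A.coord_eq_0_iff[OF P, of f] cP r(2) fd by simp
      have rp: "g \<psi> \<in> real_points X" "fst (g \<psi>) \<in> V" using P by (auto simp: real_points_on_def)
      then have xd: "fst (g \<psi>) \<in> A.cdom f" using fx by (simp add: A.dom_iff)
      then show "g \<psi> \<in> real_points_on X W" using rp sub by (auto simp: real_points_on_def)
      fix n assume n: "n \<in> S'"
      have e: "B.elt \<one>\<^bsub>N\<^esub> n 0 \<in> carrier (sections X W)"
        using B.elt_closed[of "\<one>\<^bsub>N\<^esub>" n 0] n S' by (auto simp: B.dom_one)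
      have "real_coord W N \<gamma>' (g \<psi>) n = snd (g \<psi>) W (B.elt \<one>\<^bsub>N\<^esub> n 0)"
        using n S' by (intro B.coord_eq) auto
      also have "\<dots> = snd (g \<psi>) (A.cdom f) (A.elt f (a n) (i n))"
        using real_pointsD(4)[OF rp(1) B.open_V _ A.open_dom xd sub e] xd sub fd a(2)[OF n] by auto
      also have "\<dots> = \<psi> (a n) / \<psi> f ^ i n"
        using A.real_point_elt[OF P _ fx a(1)[OF n], of "i n"] cP fd by simp
      finally show "real_coord W N \<gamma>' (g \<psi>) n = \<psi> (a n) / \<psi> f ^ i n" .
    qed
    have topO: "topspace (subtopology ?RS O0) = O0" using openin_subset[OF O0] by auto
    have cont: "continuous_map (subtopology ?RS O0) (real_spec_topology N S') (\<lambda>\<psi>. real_coord W N \<gamma>' (g \<psi>))"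
    proof (rule continuous_map_into_real_spec)
      show "(\<lambda>\<psi>. real_coord W N \<gamma>' (g \<psi>)) ` topspace (subtopology ?RS O0) \<subseteq> real_spec N"
        unfolding topO using B.coord_mem[OF mem] by blast
      fix n assume n: "n \<in> S'"
      have c: "continuous_map (subtopology ?RS O0) euclideanreal (\<lambda>\<psi>. \<psi> b)" if "b \<in> carrier M" for b
        using G.continuous_map_evaluate[OF that] by (rule continuous_map_from_subtopology)
      have "continuous_map (subtopology ?RS O0) euclideanreal (\<lambda>\<psi>. \<psi> (a n) / \<psi> f ^ i n)"
        by (intro continuous_map_real_divide continuous_map_real_pow c a(1)[OF n])
          (use fd topO in \<open>auto simp: O0_def\<close>)
      then show "continuous_map (subtopology ?RS O0) euclideanreal (\<lambda>\<psi>. real_coord W N \<gamma>' (g \<psi>) n)"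
        by (rule continuous_map_eq) (use val n topO in auto)
    qed
    let ?O = "{\<psi> \<in> topspace (subtopology ?RS O0). real_coord W N \<gamma>' (g \<psi>) \<in> T}"
    have "openin (subtopology ?RS O0) ?O" by (rule openin_continuous_map_preimage[OF cont T])
    then have "openin ?RS ?O" using openin_open_subtopology[OF O0] by blast
    moreover have "\<psi>0 \<in> O0"
      using A.coord_eq_0_iff[of "g \<psi>0" f] g[OF r0(1)] fd r0(1) top by (auto simp: O0_def x_def)
    then have "\<psi>0 \<in> ?O" unfolding topO using r0(3) by simp
    moreover have "?O \<subseteq> ?R"
      unfolding topO using mem openin_subset[OF O0] by auto
    ultimately show ?thesis by blast
  qed
  then show ?thesis by (subst openin_subopen) blast
qed

text \<open>The glued topology might a priori be finer on a chart than that of its real spectrum.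
  Continuity of the inverse of the coordinate map is checked on the generating sets, where it is
  continuity of coordinate changes.\<close>

lemma (in presheaf) homeomorphic_real_points_on:
  fixes M :: "'s pointed_monoid"
  assumes M: "affine_chart X V M h \<gamma>" and S: "finite S" "generates_binoid M S"
  shows "openin (real_space X) (real_points_on X V)"
    "subtopology (real_space X) (real_points_on X V) homeomorphic_space real_spec_topology M S"
proof -
  interpret A: chart X V M h \<gamma> using M by unfold_locales
  interpret G: generated_binoid M S using S by unfold_locales
  let ?RS = "real_spec_topology M S" and ?R = "real_points_on X V"
  let ?c = "real_coord V M \<gamma>"
  have top: "topspace ?RS = real_spec M" using G.S_subset by simp
  have "{P \<in> ?R. ?c P \<in> topspace ?RS} = ?R" using A.coord_mem top by auto
  then show op: "openin (real_space X) ?R"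
    using openin_real_space[OF M S openin_topspace] by simp
  have topR: "topspace (subtopology (real_space X) ?R) = ?R" using openin_subset[OF op] by auto
  let ?g = "inv_into ?R ?c"
  have g: "?g \<psi> \<in> ?R \<and> ?c (?g \<psi>) = \<psi>" if "\<psi> \<in> real_spec M" for \<psi>
    using that unfolding A.coord_image[symmetric] by (simp add: inv_into_into f_inv_into_f)
  have "homeomorphic_maps (subtopology (real_space X) ?R) ?RS ?c ?g"
    unfolding homeomorphic_maps_def
  proof (intro conjI ballI)
    show "continuous_map (subtopology (real_space X) ?R) ?RS ?c"
      unfolding continuous_map_def topR
    proof (intro conjI allI impI)
      show "?c \<in> ?R \<rightarrow> topspace ?RS" using A.coord_mem top by auto
      fix T assume "openin ?RS T"
      then have "openin (real_space X) {P \<in> ?R. ?c P \<in> T}" by (rule openin_real_space[OF M S])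
      then show "openin (subtopology (real_space X) ?R) {P \<in> ?R. ?c P \<in> T}"
        unfolding openin_open_subtopology[OF op] by blast
    qed
    have "continuous_map ?RS (real_space X) ?g"
      unfolding real_space_def
    proof (rule continuous_on_generated_topo)
      let ?B = "{{P \<in> real_points_on X V. real_coord V M \<gamma> P \<in> T} | V (M :: 's pointed_monoid) h \<gamma> S T.
        affine_chart X V M h \<gamma> \<and> finite S \<and> generates_binoid M S \<and> openin (real_spec_topology M S) T}"
      show "openin ?RS (?g -` U \<inter> topspace ?RS)" if "U \<in> ?B" for U
      proof -
        obtain W and N :: "'s pointed_monoid" and h' \<gamma>' S' T where U: "U = {P \<in> real_points_on X W. real_coord W N \<gamma>' P \<in> T}"
          and N: "affine_chart X W N h' \<gamma>'" "generates_binoid N S'" "openin (real_spec_topology N S') T"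
          using \<open>U \<in> ?B\<close> by blast
        have "S' \<subseteq> carrier N" using N(2) by (simp add: generates_binoid_def)
        then show ?thesis unfolding U by (rule real_coord_continuous_change[OF M S N(1) _ N(3) g])
      qed
      have "?R \<in> ?B"
        using M S \<open>{P \<in> ?R. ?c P \<in> topspace ?RS} = ?R\<close> openin_topspace[of ?RS] by blast
      then show "?g ` topspace ?RS \<subseteq> \<Union> ?B" using g top by blast
    qed
    then show "continuous_map ?RS (subtopology (real_space X) ?R) ?g"
      using g top by (auto simp: continuous_map_in_subtopology)
    show "?g (?c P) = P" if "P \<in> topspace (subtopology (real_space X) ?R)" for P
      using that A.coord_inj unfolding topR by simp
    show "?c (?g \<psi>) = \<psi>" if "\<psi> \<in> topspace ?RS" for \<psi> using g that top by auto
  qed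
  then show "subtopology (real_space X) ?R homeomorphic_space ?RS"
    unfolding homeomorphic_space_def by blast
qed

section \<open>Transport of charts along isomorphisms\<close>

lemma spec_vimage:
  assumes "binoid M" "binoid M'" "\<eta> \<in> binoid_hom M' M" "P \<in> spec M"
  shows "{m \<in> carrier M'. \<eta> m \<in> P} \<in> spec M'"
proof -
  interpret M: binoid M by fact
  interpret M': binoid M' by fact
  note \<eta> = binoid_homD[OF assms(3)]
  have "absorb M \<in> P" using assms(4) unfolding spec_def binoid_prime_def binoid_ideal_def by blast
  moreover have "\<one>\<^bsub>M'\<^esub> \<notin> {m \<in> carrier M'. \<eta> m \<in> P}" using M.one_notin_prime[OF assms(4)] \<eta>(3) by simp
  then have "{m \<in> carrier M'. \<eta> m \<in> P} \<noteq> carrier M'" using M'.one_closed by blast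
  ultimately show ?thesis
    using M.prime_mult_iff[OF assms(4)] \<eta> M'.absorb_closed
    unfolding spec_def binoid_prime_def binoid_ideal_def by auto
qed

lemma continuous_map_spec_vimage:
  assumes "binoid M" "binoid M'" "\<eta> \<in> binoid_hom M' M"
  shows "continuous_map (spec_topology M) (spec_topology M') (\<lambda>P. {m \<in> carrier M'. \<eta> m \<in> P})" (is "continuous_map _ _ ?\<kappa>")
proof -
  interpret M: binoid M by fact
  interpret M': binoid M' by fact
  have spec: "?\<kappa> P \<in> spec M'" if "P \<in> spec M" for P using spec_vimage[OF assms that] .
  show ?thesis
    unfolding spec_topology_def[of M']
  proof (rule continuous_on_generated_topo)
    fix T assume "T \<in> basic_open M' ` carrier M'"
    then obtain g where g: "g \<in> carrier M'" "T = basic_open M' g" by blast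
    have "?\<kappa> -` T \<inter> topspace (spec_topology M) = basic_open M (\<eta> g)"
      unfolding M.topspace_spec_topology using spec g by (auto simp: basic_open_def)
    moreover have "openin (spec_topology M) (basic_open M (\<eta> g))"
      unfolding spec_topology_def using binoid_homD(1)[OF assms(3) g(1)]
      by (intro topology_generated_by_Basis) simp
    ultimately show "openin (spec_topology M) (?\<kappa> -` T \<inter> topspace (spec_topology M))" by simp
  next
    have "spec M' \<subseteq> \<Union> (basic_open M' ` carrier M')"
      using M'.one_notin_prime by (auto simp: basic_open_def intro!: bexI[of _ "\<one>\<^bsub>M'\<^esub>"])
    then show "?\<kappa> ` topspace (spec_topology M) \<subseteq> \<Union> (basic_open M' ` carrier M')"
      unfolding M.topspace_spec_topology using spec by blast
  qed
qed

lemma binoid_iso_inv_into: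
  assumes "binoid M" "\<eta> \<in> binoid_iso M N"
  shows "inv_into (carrier M) \<eta> \<in> binoid_iso N M"
proof -
  interpret binoid M by fact
  note \<eta> = binoid_isoD[OF assms(2)]
  let ?i = "inv_into (carrier M) \<eta>"
  have bij: "bij_betw ?i (carrier N) (carrier M)" using bij_betw_inv_into[OF \<eta>(5)] .
  have left: "?i (\<eta> m) = m" if "m \<in> carrier M" for m
    using \<eta>(5) that by (simp add: bij_betw_inv_into_left)
  have right: "\<eta> (?i n) = n" "?i n \<in> carrier M" if "n \<in> carrier N" for n
    using \<eta>(5) that bij by (simp_all add: bij_betw_inv_into_right bij_betw_apply)
  have "?i (x \<otimes>\<^bsub>N\<^esub> y) = ?i x \<otimes>\<^bsub>M\<^esub> ?i y" if "x \<in> carrier N" "y \<in> carrier N" for x y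
    using \<eta>(2)[of "?i x" "?i y"] left[of "?i x \<otimes>\<^bsub>M\<^esub> ?i y"] right that by simp
  moreover have "?i \<one>\<^bsub>N\<^esub> = \<one>\<^bsub>M\<^esub>" using left[of "\<one>\<^bsub>M\<^esub>"] \<eta>(3) by simp
  moreover have "?i (absorb N) = absorb M" using left[of "absorb M"] \<eta>(4) absorb_closed by simp
  ultimately show ?thesis using bij right by (simp add: binoid_iso_def binoid_hom_def hom_def)
qed

lemma binoid_iso_compose:
  assumes "\<eta> \<in> binoid_iso M N" "\<theta> \<in> binoid_iso N K"
  shows "(\<lambda>x. \<theta> (\<eta> x)) \<in> binoid_iso M K"
  using binoid_isoD[OF assms(1)] binoid_isoD[OF assms(2)] bij_betw_trans[of \<eta> _ _ \<theta>]
  by (auto simp: binoid_iso_def binoid_hom_def hom_def o_def)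

text \<open>The given charts may use binoids on any type, while \<open>affine_open\<close> and
  \<open>real_space\<close> quantify over binoids on the type of sections. Charts are therefore
  moved along an isomorphism.\<close>

locale chart_transport = chart X V M h \<gamma>
  for X :: "('x, 's) binoided_space" and V and M :: "'m pointed_monoid" and h \<gamma> +
  fixes M' :: "'n pointed_monoid" and \<eta> :: "'n \<Rightarrow> 'm"
  assumes binoid_M': "binoid M'" and \<eta>: "\<eta> \<in> binoid_iso M' M"
begin

sublocale M': binoid M' by (rule binoid_M')

lemma \<eta>_closed: "x \<in> carrier M' \<Longrightarrow> \<eta> x \<in> carrier M"
  and \<eta>_mult: "x \<in> carrier M' \<Longrightarrow> y \<in> carrier M' \<Longrightarrow> \<eta> (x \<otimes>\<^bsub>M'\<^esub> y) = \<eta> x \<otimes>\<^bsub>M\<^esub> \<eta> y"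
  and \<eta>_one: "\<eta> \<one>\<^bsub>M'\<^esub> = \<one>\<^bsub>M\<^esub>" and \<eta>_absorb: "\<eta> (absorb M') = absorb M"
  and \<eta>_bij: "bij_betw \<eta> (carrier M') (carrier M)"
  using binoid_isoD[OF \<eta>] by auto

lemma \<eta>_hom: "\<eta> \<in> binoid_hom M' M" using \<eta> by (simp add: binoid_iso_def)

lemma \<eta>_eq_iff: "x \<in> carrier M' \<Longrightarrow> y \<in> carrier M' \<Longrightarrow> \<eta> x = \<eta> y \<longleftrightarrow> x = y"
  using \<eta>_bij by (auto simp: bij_betw_def inj_on_def)

lemma \<eta>_surj: "m \<in> carrier M \<Longrightarrow> \<exists>x\<in>carrier M'. m = \<eta> x"
  using \<eta>_bij by (auto simp: bij_betw_def)

lemma \<eta>_pow: "x \<in> carrier M' \<Longrightarrow> \<eta> (x [^]\<^bsub>M'\<^esub> (n::nat)) = \<eta> x [^]\<^bsub>M\<^esub> n"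
  by (induction n) (auto simp: \<eta>_one \<eta>_mult)

lemma fraction_transport_iff:
  assumes "f \<in> carrier M'" "a \<in> carrier M'" "b \<in> carrier M'"
  shows "fraction M (\<eta> f) (\<eta> a) i = fraction M (\<eta> f) (\<eta> b) j \<longleftrightarrow> fraction M' f a i = fraction M' f b j"
proof -
  have *: "\<eta> f [^]\<^bsub>M\<^esub> l \<otimes>\<^bsub>M\<^esub> (\<eta> c \<otimes>\<^bsub>M\<^esub> \<eta> f [^]\<^bsub>M\<^esub> n) = \<eta> (f [^]\<^bsub>M'\<^esub> l \<otimes>\<^bsub>M'\<^esub> (c \<otimes>\<^bsub>M'\<^esub> f [^]\<^bsub>M'\<^esub> n))"
    if "c \<in> carrier M'" for c and l n :: nat
    using that assms(1) by (simp add: \<eta>_mult \<eta>_pow)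
  show ?thesis
    unfolding M.fraction_eq_iff[OF \<eta>_closed[OF assms(1)] \<eta>_closed[OF assms(2)] \<eta>_closed[OF assms(3)]]
      M'.fraction_eq_iff[OF assms] *[OF assms(2)] *[OF assms(3)]
    using assms by (simp add: \<eta>_eq_iff)
qed

definition \<Theta> :: "('n \<times> nat) set \<Rightarrow> ('m \<times> nat) set" where
  "\<Theta> c = (\<lambda>(a, i). (\<eta> a, i)) ` c"

text \<open>The image of a class under \<eta> is a full class, not just part of one, because \<eta>
  is onto.\<close>

lemma \<Theta>_fraction:
  assumes f: "f \<in> carrier M'" and a: "a \<in> carrier M'"
  shows "\<Theta> (fraction M' f a i) = fraction M (\<eta> f) (\<eta> a) i"
proof (intro equalityI subsetI)
  fix p assume "p \<in> \<Theta> (fraction M' f a i)"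
  then obtain b j where b: "(b, j) \<in> fraction M' f a i" "p = (\<eta> b, j)" by (auto simp: \<Theta>_def)
  then have "b \<in> carrier M'" "fraction M' f b j = fraction M' f a i" using M'.mem_fraction_iff[OF f a] by auto
  then show "p \<in> fraction M (\<eta> f) (\<eta> a) i"
    using M.mem_fraction_iff[OF \<eta>_closed[OF f] \<eta>_closed[OF a]] fraction_transport_iff[OF f _ a] b(2) \<eta>_closed by blast
next
  fix p assume p: "p \<in> fraction M (\<eta> f) (\<eta> a) i"
  obtain c j where c: "p = (c, j)" by (cases p)
  then have "c \<in> carrier M" "fraction M (\<eta> f) c j = fraction M (\<eta> f) (\<eta> a) i"
    using p M.mem_fraction_iff[OF \<eta>_closed[OF f] \<eta>_closed[OF a]] by auto
  then obtain b where b: "b \<in> carrier M'" "c = \<eta> b" using \<eta>_surj by blast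
  then have "(b, j) \<in> fraction M' f a i"
    using M'.mem_fraction_iff[OF f a] fraction_transport_iff[OF f b(1) a]
      \<open>fraction M (\<eta> f) c j = fraction M (\<eta> f) (\<eta> a) i\<close> by blast
  then show "p \<in> \<Theta> (fraction M' f a i)" using b c by (force simp: \<Theta>_def)
qed

lemma \<Theta>_iso:
  assumes f: "f \<in> carrier M'"
  shows "\<Theta> \<in> binoid_iso (localization M' f) (localization M (\<eta> f))"
proof -
  note ef = \<eta>_closed[OF f]
  have closed: "\<Theta> c \<in> carrier (localization M (\<eta> f))" if "c \<in> carrier (localization M' f)" for c
    using that by (rule M'.localizationE) (simp add: \<Theta>_fraction f ef M.fraction_mem \<eta>_closed)
  have mult: "\<Theta> (c \<otimes>\<^bsub>localization M' f\<^esub> d) = \<Theta> c \<otimes>\<^bsub>localization M (\<eta> f)\<^esub> \<Theta> d"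
    if c: "c \<in> carrier (localization M' f)" and d: "d \<in> carrier (localization M' f)" for c d
  proof -
    obtain a i where a: "a \<in> carrier M'" "c = fraction M' f a i" using c by (rule M'.localizationE)
    obtain b j where b: "b \<in> carrier M'" "d = fraction M' f b j" using d by (rule M'.localizationE)
    show ?thesis
      using a b f by (simp add: M'.mult_fraction M.mult_fraction \<Theta>_fraction \<eta>_closed \<eta>_mult)
  qed
  have "inj_on \<Theta> (carrier (localization M' f))"
  proof (rule inj_onI)
    fix c d assume c: "c \<in> carrier (localization M' f)" and d: "d \<in> carrier (localization M' f)" and eq: "\<Theta> c = \<Theta> d"
    obtain a i where a: "a \<in> carrier M'" "c = fraction M' f a i" using c by (rule M'.localizationE)
    obtain b j where b: "b \<in> carrier M'" "d = fraction M' f b j" using d by (rule M'.localizationE)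
    show "c = d" using eq a b f fraction_transport_iff[OF f a(1) b(1)] by (simp add: \<Theta>_fraction)
  qed
  moreover have "carrier (localization M (\<eta> f)) \<subseteq> \<Theta> ` carrier (localization M' f)"
  proof
    fix c assume "c \<in> carrier (localization M (\<eta> f))"
    then obtain a i where a: "a \<in> carrier M" "c = fraction M (\<eta> f) a i" by (rule M.localizationE)
    then obtain b where b: "b \<in> carrier M'" "a = \<eta> b" using \<eta>_surj by blast
    then have "c = \<Theta> (fraction M' f b i)" using a(2) \<Theta>_fraction[OF f b(1)] by simp
    then show "c \<in> \<Theta> ` carrier (localization M' f)" using M'.fraction_mem[OF f b(1)] by blast
  qed
  ultimately show ?thesis
    using closed mult f M'.absorb_closed
    by (auto simp: binoid_iso_def binoid_hom_def hom_def bij_betw_def M'.one_localization M.one_localization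
        M'.absorb_localization M.absorb_localization \<Theta>_fraction \<eta>_one \<eta>_absorb)
qed

lemma \<Theta>_loc_map:
  assumes f: "f \<in> carrier M'" and g: "g \<in> carrier M'" and c: "c \<subseteq> carrier M' \<times> UNIV"
  shows "\<Theta> (loc_map M' f g c) = loc_map M (\<eta> f) (\<eta> g) (\<Theta> c)"
proof -
  have key: "fraction M (\<eta> g) (\<eta> b \<otimes>\<^bsub>M\<^esub> \<eta> f [^]\<^bsub>M\<^esub> i) j = fraction M (\<eta> g) (\<eta> a) 0 \<longleftrightarrow>
      fraction M' g (b \<otimes>\<^bsub>M'\<^esub> f [^]\<^bsub>M'\<^esub> i) j = fraction M' g a 0"
    if "a \<in> carrier M'" "b \<in> carrier M'" for a b and i j :: nat
    using fraction_transport_iff[OF g, of "b \<otimes>\<^bsub>M'\<^esub> f [^]\<^bsub>M'\<^esub> i" a j 0] that f by (simp add: \<eta>_mult \<eta>_pow)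
  show ?thesis
  proof (intro equalityI subsetI)
    fix p assume "p \<in> \<Theta> (loc_map M' f g c)"
    then obtain b j a i where b: "p = (\<eta> b, j)" "b \<in> carrier M'" "(a, i) \<in> c"
      "fraction M' g (b \<otimes>\<^bsub>M'\<^esub> f [^]\<^bsub>M'\<^esub> i) j = fraction M' g a 0"
      by (auto simp: \<Theta>_def loc_map_def)
    then have "a \<in> carrier M'" using c by blast
    then have "fraction M (\<eta> g) (\<eta> b \<otimes>\<^bsub>M\<^esub> \<eta> f [^]\<^bsub>M\<^esub> i) j = fraction M (\<eta> g) (\<eta> a) 0" using key b by blast
    moreover have "(\<eta> a, i) \<in> \<Theta> c" using b(3) by (force simp: \<Theta>_def)
    ultimately show "p \<in> loc_map M (\<eta> f) (\<eta> g) (\<Theta> c)"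
      using b \<eta>_closed unfolding loc_map_def by blast
  next
    fix p assume "p \<in> loc_map M (\<eta> f) (\<eta> g) (\<Theta> c)"
    then obtain b' j a' i where b': "p = (b', j)" "b' \<in> carrier M" "(a', i) \<in> \<Theta> c"
      "fraction M (\<eta> g) (b' \<otimes>\<^bsub>M\<^esub> \<eta> f [^]\<^bsub>M\<^esub> i) j = fraction M (\<eta> g) a' 0"
      unfolding loc_map_def by blast
    obtain b where b: "b \<in> carrier M'" "b' = \<eta> b" using \<eta>_surj b'(2) by blast
    obtain a where a: "(a, i) \<in> c" "a' = \<eta> a" using b'(3) by (auto simp: \<Theta>_def)
    have "fraction M' g (b \<otimes>\<^bsub>M'\<^esub> f [^]\<^bsub>M'\<^esub> i) j = fraction M' g a 0"
      using key[of a b i j] a b b'(4) c by blast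
    then have "(b, j) \<in> loc_map M' f g c" using a b unfolding loc_map_def by blast
    then show "p \<in> \<Theta> (loc_map M' f g c)" using b' b by (force simp: \<Theta>_def)
  qed
qed

lemma fg_transport: "fg_binoid M'"
proof -
  obtain S where S: "finite S" "S \<subseteq> carrier M" "binoid_generate M S = carrier M"
    using fg by (auto simp: fg_binoid_def generates_binoid_def)
  define S' where "S' = {x \<in> carrier M'. \<eta> x \<in> S}"
  have "finite S'"
    using finite_vimage_IntI[of S \<eta> "carrier M'"] S(1) \<eta>_bij
    by (rule_tac finite_subset[of _ "\<eta> -` S \<inter> carrier M'"]) (auto simp: S'_def bij_betw_def)
  have "x \<in> binoid_generate M' S'" if "m \<in> binoid_generate M S" "x \<in> carrier M'" "\<eta> x = m" for m x
    using that
  proof (induction arbitrary: x)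
    case one
    then have "x = \<one>\<^bsub>M'\<^esub>" using \<eta>_eq_iff[of x "\<one>\<^bsub>M'\<^esub>"] \<eta>_one by simp
    then show ?case by (simp add: binoid_generate.one)
  next
    case absorb
    then have "x = absorb M'" using \<eta>_eq_iff[of x "absorb M'"] \<eta>_absorb M'.absorb_closed by simp
    then show ?case by (simp add: binoid_generate.absorb)
  next
    case (incl s)
    then show ?case by (intro binoid_generate.incl) (simp add: S'_def)
  next
    case (mult a b)
    have "a \<in> carrier M" "b \<in> carrier M" using mult.hyps S(3) by auto
    then obtain a' b' where ab: "a' \<in> carrier M'" "a = \<eta> a'" "b' \<in> carrier M'" "b = \<eta> b'" using \<eta>_surj by meson
    then have "\<eta> x = \<eta> (a' \<otimes>\<^bsub>M'\<^esub> b')" using mult.prems(2) by (simp add: \<eta>_mult)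
    then have "x = a' \<otimes>\<^bsub>M'\<^esub> b'" using \<eta>_eq_iff mult.prems(1) ab by simp
    then show ?case using mult.IH ab by (simp add: binoid_generate.mult)
  qed
  then have "carrier M' \<subseteq> binoid_generate M' S'" using \<eta>_closed S(3) by blast
  moreover have "x \<in> carrier M'" if "x \<in> binoid_generate M' S'" for x
    using that by induction (auto simp: S'_def M'.absorb_closed)
  ultimately have "generates_binoid M' S'" by (auto simp: generates_binoid_def S'_def)
  then show ?thesis using \<open>finite S'\<close> binoid_M' by (auto simp: fg_binoid_def)
qed

definition h' :: "'x \<Rightarrow> 'n set" where "h' x = {m \<in> carrier M'. \<eta> m \<in> h x}"

lemma homeomorphic_h': "homeomorphic_map (subtopology (space X) V) (spec_topology M') h'"
proof -
  let ?\<kappa> = "\<lambda>P. {m \<in> carrier M'. \<eta> m \<in> P}"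
  let ?\<zeta> = "inv_into (carrier M') \<eta>"
  let ?\<kappa>' = "\<lambda>Q. {m \<in> carrier M. ?\<zeta> m \<in> Q}"
  have \<zeta>: "?\<zeta> \<in> binoid_hom M M'" using binoid_iso_inv_into[OF binoid_M' \<eta>] by (simp add: binoid_iso_def)
  have left: "?\<zeta> (\<eta> x) = x" if "x \<in> carrier M'" for x
    using \<eta>_bij that by (simp add: bij_betw_inv_into_left)
  have right: "\<eta> (?\<zeta> m) = m" if "m \<in> carrier M" for m
    using \<eta>_bij that by (simp add: bij_betw_inv_into_right)
  have "homeomorphic_maps (spec_topology M) (spec_topology M') ?\<kappa> ?\<kappa>'"
    unfolding homeomorphic_maps_def
  proof (intro conjI ballI)
    show "continuous_map (spec_topology M) (spec_topology M') ?\<kappa>"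
      by (rule continuous_map_spec_vimage[OF M.binoid_axioms binoid_M' \<eta>_hom])
    show "continuous_map (spec_topology M') (spec_topology M) ?\<kappa>'"
      by (rule continuous_map_spec_vimage[OF binoid_M' M.binoid_axioms \<zeta>])
    fix P assume "P \<in> topspace (spec_topology M)"
    then have "P \<subseteq> carrier M"
      unfolding M.topspace_spec_topology spec_def binoid_prime_def binoid_ideal_def by blast
    then show "?\<kappa>' (?\<kappa> P) = P" using right binoid_homD(1)[OF \<zeta>] by (auto simp: subset_iff)
  next
    fix Q assume "Q \<in> topspace (spec_topology M')"
    then have "Q \<subseteq> carrier M'"
      unfolding M'.topspace_spec_topology spec_def binoid_prime_def binoid_ideal_def by blast
    then show "?\<kappa> (?\<kappa>' Q) = Q" using left \<eta>_closed by (auto simp: subset_iff)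
  qed
  then have "homeomorphic_map (spec_topology M) (spec_topology M') ?\<kappa>"
    using homeomorphic_map_maps by blast
  from homeomorphic_map_compose[OF homeo_h this] show ?thesis
    by (simp add: h'_def[abs_def] o_def)
qed

lemma affine_chart_transport: "affine_chart X V M' h' (\<lambda>f c. \<gamma> (\<eta> f) (\<Theta> c))"
proof -
  have mem: "h' x \<in> basic_open M' f \<longleftrightarrow> h x \<in> basic_open M (\<eta> f)" if "x \<in> V" "f \<in> carrier M'" for x f
    using spec_vimage[OF M.binoid_axioms binoid_M' \<eta>_hom h_spec[OF that(1)]] that h_spec
    by (auto simp: basic_open_def h'_def)
  have dom: "{x \<in> V. h' x \<in> basic_open M' f} = cdom (\<eta> f)" if "f \<in> carrier M'" for f
    using mem that by (auto simp: cdom_def)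
  have img: "h' ` V = spec M'"
    using homeomorphic_imp_surjective_map[OF homeomorphic_h'] topspace_V M'.topspace_spec_topology by simp
  show ?thesis
    unfolding affine_chart_def
  proof (intro conjI ballI impI)
    show "openin (space X) V" by (rule open_V)
    show "fg_binoid M'" by (rule fg_transport)
    show "homeomorphic_map (subtopology (space X) V) (spec_topology M') h'" by (rule homeomorphic_h')
    fix f assume f: "f \<in> carrier M'"
    show "(\<lambda>c. \<gamma> (\<eta> f) (\<Theta> c)) \<in> binoid_iso (localization M' f) (sections X {x \<in> V. h' x \<in> basic_open M' f})"
      unfolding dom[OF f] by (rule binoid_iso_compose[OF \<Theta>_iso[OF f] \<gamma>_iso[OF \<eta>_closed[OF f]]])
    fix g s assume g: "g \<in> carrier M'" and sub: "basic_open M' g \<subseteq> basic_open M' f" and s: "s \<in> carrier (localization M' f)"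
    have "basic_open M (\<eta> g) \<subseteq> basic_open M (\<eta> f)"
    proof
      fix P assume P: "P \<in> basic_open M (\<eta> g)"
      then obtain x where x: "x \<in> V" "P = h x" using h_image by (auto simp: basic_open_def)
      then show "P \<in> basic_open M (\<eta> f)" using P sub mem[OF x(1) f] mem[OF x(1) g] by blast
    qed
    then have "restr X (cdom (\<eta> f)) (cdom (\<eta> g)) (\<gamma> (\<eta> f) (\<Theta> s)) = \<gamma> (\<eta> g) (loc_map M (\<eta> f) (\<eta> g) (\<Theta> s))"
      using chart \<eta>_closed[OF f] \<eta>_closed[OF g] binoid_isoD(1)[OF \<Theta>_iso[OF f] s]
      unfolding affine_chart_def cdom_def by blast
    moreover have "s \<subseteq> carrier M' \<times> UNIV"
      using s by (rule M'.localizationE) (auto simp: M'.mem_fraction_iff f)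
    ultimately show "restr X {x \<in> V. h' x \<in> basic_open M' f} {x \<in> V. h' x \<in> basic_open M' g} (\<gamma> (\<eta> f) (\<Theta> s))
        = \<gamma> (\<eta> g) (\<Theta> (loc_map M' f g s))"
      unfolding dom[OF f] dom[OF g] using \<Theta>_loc_map[OF f g] by simp
  qed
qed

end

text \<open>Sending m to the section m / 1 identifies M with the sections over V, which form a
  binoid on the required type.\<close>

lemma (in presheaf) is_open_spec_imp_affine_open:
  fixes M :: "'m pointed_monoid"
  assumes "is_open_spec X V M"
  shows "affine_open X V"
proof -
  obtain h \<gamma> where c: "affine_chart X V M h \<gamma>" using assms by (auto simp: is_open_spec_def)
  interpret chart X V M h \<gamma> using c by unfold_locales
  let ?\<theta> = "\<lambda>m. \<gamma> \<one>\<^bsub>M\<^esub> (fraction M \<one>\<^bsub>M\<^esub> m 0)"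
  have "?\<theta> \<in> binoid_iso M (sections X V)"
    using binoid_iso_compose[OF M.fraction_hom_one \<gamma>_iso[OF M.one_closed]] by (simp add: dom_one)
  then have "inv_into (carrier M) ?\<theta> \<in> binoid_iso (sections X V) M"
    by (rule binoid_iso_inv_into[OF M.binoid_axioms])
  then interpret chart_transport X V M h \<gamma> "sections X V" "inv_into (carrier M) ?\<theta>"
    by (intro chart_transport.intro chart_transport_axioms.intro chart_axioms binoid_sections[OF open_V])
  show ?thesis
    using affine_chart_transport unfolding affine_open_def is_open_spec_def by blast
qed

lemma (in presheaf) affine_open_real_points_on:
  assumes "affine_open X W"
  shows "openin (real_space X) (real_points_on X W)"
    "p \<noteq> 0 \<Longrightarrow> trivial_group (homology_group p (subtopology (real_space X) (real_points_on X W)))"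
proof -
  obtain M :: "'s pointed_monoid" and h \<gamma> where M: "affine_chart X W M h \<gamma>"
    using assms by (auto simp: affine_open_def is_open_spec_def)
  then obtain S where S: "finite S" "generates_binoid M S" and b: "binoid M"
    by (auto simp: affine_chart_def fg_binoid_def)
  note H = homeomorphic_real_points_on[OF M S]
  show "openin (real_space X) (real_points_on X W)" by (rule H(1))
  assume "p \<noteq> 0"
  interpret generated_binoid M S
    using S b by (simp add: generated_binoid_def generated_binoid_axioms_def)
  have "homology_group p (real_spec_topology M S) \<cong> homology_group p (subtopology (real_space X) (real_points_on X W))"
    using homeomorphic_space_imp_isomorphic_homology_groups H(2) homeomorphic_space_sym by blast
  then show "trivial_group (homology_group p (subtopology (real_space X) (real_points_on X W)))"
    using isomorphic_group_triviality1[OF _ group_relative_homology_group] trivial_homology_real_spec[OF \<open>p \<noteq> 0\<close>] by blast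
qed

theorem mainTheorem5:
  fixes X :: "('x, 's) binoided_space"
    and k :: nat
    and V :: "nat \<Rightarrow> 'x set"
    and M :: "nat \<Rightarrow> 'm pointed_monoid"
    and U :: "nat \<Rightarrow> ('x \<times> ('x set \<Rightarrow> 's \<Rightarrow> real)) set"
    and n :: nat
  assumes "binoid_scheme X"
    and "quasi_separated X"
    and "finite_type X"
    and "\<And>i. i \<in> {1..k} \<Longrightarrow> is_open_spec X (V i) (M i)"
    and "(\<Union>i\<in>{1..k}. V i) = topspace (space X)"
    and "\<And>i. i \<in> {1..k} \<Longrightarrow> U i = real_points_on X (V i)"
  shows "homology_group (int n) (real_space X) \<cong> nerve_homology (real_space X) U k 0 n"
proof -
  interpret presheaf X
    using assms(1) by unfold_locales (simp add: binoid_scheme_def binoid_sheaf_def)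
  have aff: "affine_open X (V i)" if "i \<in> {1..k}" for i
    using is_open_spec_imp_affine_open[OF assms(4)[OF that]] .
  \<comment> \<open>Quasi-separatedness speaks of two affine opens; nonempty finite intersections
    follow by induction, starting from a single member.\<close>
  have inter: "affine_open X (\<Inter>i\<in>\<sigma>. V i)" if "finite \<sigma>" "\<sigma> \<noteq> {}" "\<sigma> \<subseteq> {1..k}" for \<sigma>
    using that
  proof (induction \<sigma> rule: finite_ne_induct)
    case (insert i \<sigma>)
    then show ?case using assms(2) aff[of i] by (simp add: quasi_separated_def)
  qed (use aff in auto)
  \<comment> \<open>A real point belongs to \<open>real_points_on X W\<close> according to its
    underlying point only, so intersections of real charts are real points over
    intersections.\<close>
  have real: "(\<Inter>i\<in>\<sigma>. U i) = real_points_on X (\<Inter>i\<in>\<sigma>. V i)" if "\<sigma> \<noteq> {}" "\<sigma> \<subseteq> {1..k}" for \<sigma>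
  proof -
    have "(\<Inter>i\<in>\<sigma>. U i) = (\<Inter>i\<in>\<sigma>. real_points_on X (V i))"
      using assms(6) that(2) by (intro INF_cong refl) blast
    also have "\<dots> = real_points_on X (\<Inter>i\<in>\<sigma>. V i)"
      using that(1) by (auto simp: real_points_on_def)
    finally show ?thesis .
  qed
  interpret acyclic_cover "real_space X" U k
  proof
    fix i assume i: "i \<in> {1..k}"
    show "openin (real_space X) (U i)"
      unfolding assms(6)[OF i] by (rule affine_open_real_points_on(1)[OF aff[OF i]])
  next
    have "topspace (real_space X) \<subseteq> real_points X"
      unfolding real_space_def topology_generated_by_topspace by (auto simp: real_points_on_def)
    moreover have "real_points X \<subseteq> (\<Union>i\<in>{1..k}. real_points_on X (V i))"
    proof
      fix P assume P: "P \<in> real_points X"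
      then have "fst P \<in> (\<Union>i\<in>{1..k}. V i)" unfolding assms(5) by (rule real_pointsD(1))
      then show "P \<in> (\<Union>i\<in>{1..k}. real_points_on X (V i))" using P by (auto simp: real_points_on_def)
    qed
    moreover have "(\<Union>i\<in>{1..k}. real_points_on X (V i)) = (\<Union>i\<in>{1..k}. U i)"
      using assms(6) by (intro SUP_cong refl) simp
    ultimately show "topspace (real_space X) \<subseteq> (\<Union>i\<in>{1..k}. U i)" by blast
  next
    fix \<sigma> q c
    assume \<sigma>: "\<sigma> \<subseteq> {1..k}" "\<sigma> \<noteq> {}"
      and c: "singular_chain (Suc q) (subtopology (real_space X) (\<Inter>i\<in>\<sigma>. U i)) c" "chain_boundary (Suc q) c = 0"
    have "affine_open X (\<Inter>i\<in>\<sigma>. V i)" using inter \<sigma> finite_subset by blast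
    then have "trivial_group (homology_group (int (Suc q)) (subtopology (real_space X) (\<Inter>i\<in>\<sigma>. U i)))"
      unfolding real[OF \<sigma>(2,1)] by (rule affine_open_real_points_on(2)) simp
    then obtain d where "singular_chain (Suc (Suc q)) (subtopology (real_space X) (\<Inter>i\<in>\<sigma>. U i)) d"
      "chain_boundary (Suc (Suc q)) d = c"
      using c by (rule cycle_is_boundary_of_trivial_homology)
    then show "\<exists>d. singular_chain (Suc (Suc q)) (subtopology (real_space X) (\<Inter>i\<in>\<sigma>. U i)) d \<and>
        chain_boundary (Suc (Suc q)) d = c" by blast
  qed
  show ?thesis by (rule homology_iso_nerve_homology)
qed

end
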